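(* Let $(M_t)_{t\ge0}$ and $(N_t)_{t\ge0}$ be two $d$-dimensional processes with independent increments defined respectively on nonlinear (resp. sublinear) expectation spaces $(\Omega_1,\mathcal{H}_1,\hat{\mathbb{E}}_1)$ and $(\Omega_2,\mathcal{H}_2,\hat{\mathbb{E}}_2)$, and assume condition (A) below holds: (A) There exist two sublinear expectations $\tilde{\mathbb{E}}_1:\mathcal{H}_1\to\mathbb{R}$ and $\tilde{\mathbb{E}}_2:\mathcal{H}_2\to\mathbb{R}$ such that (1) $\tilde{\mathbb{E}}_1$ dominates $\hat{\mathbb{E}}_1$ and $\tilde{\mathbb{E}}_2$ dominates $\hat{\mathbb{E}}_2$; (2) for each $t\ge0$, $\lim_{s\to t}\big(\tilde{\mathbb{E}}_1[|M_s-M_t|]+\tilde{\mathbb{E}}_2[|N_s-N_t|]\big)=0$. Then there exists a $2d$-dimensional process $(\tilde M_t,\tilde N_t)_{t\ge0}$ with independent increments defined on a nonlinear (resp. sublinear) expectation space $(\Omega,\mathcal{H},\hat{\mathbb{E}})$ such that $(\tilde M_t)_{t\ge0}\overset{d}{=}(M_t)_{t\ge0}$ and $(\tilde N_t)_{t\ge0}\overset{d}{=}(N_t)_{t\ge0}$. Furthermore, $(\tilde M_t,\tilde N_t)_{t\ge0}$ is a process with stationary and independent increments if $(M_t)_{t\ge0}$ and $(N_t)_{t\ge0}$ are two processes with stationary and independent increments.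
   Context: $C_{b.Lip}(\mathbb{R}^d)$ is the set of bounded Lipschitz functions on $\mathbb{R}^d$. Given a nonempty set $\Omega$, $\mathcal{H}$ is a linear space of real functions on $\Omega$ such that $X_1,\dots,X_d\in\mathcal{H}$ implies $\varphi(X_1,\dots,X_d)\in\mathcal{H}$ for all $\varphi\in C_{b.Lip}(\mathbb{R}^d)$; a $d$-dimensional random vector is $X=(X_1,\dots,X_d)$ with $X_i\in\mathcal{H}$. A nonlinear expectation is a functional $\hat{\mathbb{E}}:\mathcal{H}\to\mathbb{R}$ that is monotone ($X\ge Y\Rightarrow\hat{\mathbb{E}}[X]\ge\hat{\mathbb{E}}[Y]$) and constant preserving ($\hat{\mathbb{E}}[c]=c$); it is a sublinear expectation if moreover $\hat{\mathbb{E}}[X+Y]\le\hat{\mathbb{E}}[X]+\hat{\mathbb{E}}[Y]$ and $\hat{\mathbb{E}}[\lambda X]=\lambda\hat{\mathbb{E}}[X]$ for $\lambda\ge0$. The triple $(\Omega,\mathcal{H},\hat{\mathbb{E}})$ is then a nonlinear (resp. sublinear) expectation space. A sublinear expectation $\tilde{\mathbb{E}}$ on $\mathcal{H}$ dominates a nonlinear expectation $\hat{\mathbb{E}}$ on $\mathcal{H}$ if $\hat{\mathbb{E}}[X]-\hat{\mathbb{E}}[Y]\le\tilde{\mathbb{E}}[X-Y]$ for all $X,Y\in\mathcal{H}$ (condition (A)(2) implicitly requires $|M_s-M_t|\in\mathcal{H}_1$, $|N_s-N_t|\in\mathcal{H}_2$). A $d$-dimensional random vector $Y$ is independent from an $m$-dimensional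 random vector $X$ under $\hat{\mathbb{E}}$ if $\hat{\mathbb{E}}[\varphi(X,Y)]=\hat{\mathbb{E}}[\hat{\mathbb{E}}[\varphi(x,Y)]_{x=X}]$ for all $\varphi\in C_{b.Lip}(\mathbb{R}^{m+d})$. A $d$-dimensional process $(X_t)_{t\ge0}$ (a family of random vectors on one space) with $X_0=0$ has independent increments if for all $n$ and $0\le t_1<\dots<t_n$, $X_{t_n}-X_{t_{n-1}}$ is independent from $(X_{t_1},\dots,X_{t_{n-1}})$; it has stationary increments if $X_{t+s}-X_s\overset{d}{=}X_t$ for all $t,s\ge0$. Two random vectors $X_1,X_2$ on spaces $(\Omega_i,\mathcal{H}_i,\hat{\mathbb{E}}_i)$ are identically distributed, $X_1\overset{d}{=}X_2$, if $\hat{\mathbb{E}}_1[\varphi(X_1)]=\hat{\mathbb{E}}_2[\varphi(X_2)]$ for all $\varphi\in C_{b.Lip}$; two processes are identically distributed if all their finite-dimensional vectors $(X_{t_1},\dots,X_{t_n})$ are identically distributed. *)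

theory Defs
  imports "HOL-Analysis.Analysis"
begin

text \<open>Vectors of R^n are represented as real lists of length n.\<close>

definition vsub :: "real list \<Rightarrow> real list \<Rightarrow> real list" where
  "vsub xs ys = map2 (-) xs ys"

definition lnorm :: "real list \<Rightarrow> real" where
  "lnorm xs = sqrt (\<Sum>x\<leftarrow>xs. x ^ 2)"

definition cblip :: "nat \<Rightarrow> (real list \<Rightarrow> real) \<Rightarrow> bool" where
  "cblip n \<phi> \<longleftrightarrow>
     (\<exists>C. \<forall>x. length x = n \<longrightarrow> \<bar>\<phi> x\<bar> \<le> C) \<and>
     (\<exists>L. \<forall>x y. length x = n \<longrightarrow> length y = n \<longrightarrow> \<bar>\<phi> x - \<phi> y\<bar> \<le> L * lnorm (vsub x y))"

text \<open>An n-dimensional random vector: components belong to H. Omega is the whole type 'w.\<close>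
definition rvec :: "('w \<Rightarrow> real) set \<Rightarrow> nat \<Rightarrow> ('w \<Rightarrow> real list) \<Rightarrow> bool" where
  "rvec H n X \<longleftrightarrow> (\<forall>\<omega>. length (X \<omega>) = n) \<and> (\<forall>i<n. (\<lambda>\<omega>. X \<omega> ! i) \<in> H)"

definition lin_space :: "('w \<Rightarrow> real) set \<Rightarrow> bool" where
  "lin_space H \<longleftrightarrow> (\<lambda>_. 0) \<in> H \<and>
     (\<forall>X\<in>H. \<forall>Y\<in>H. (\<lambda>\<omega>. X \<omega> + Y \<omega>) \<in> H) \<and>
     (\<forall>X\<in>H. \<forall>c::real. (\<lambda>\<omega>. c * X \<omega>) \<in> H) \<and>
     (\<forall>n X \<phi>. rvec H n X \<and> cblip n \<phi> \<longrightarrow> (\<lambda>\<omega>. \<phi> (X \<omega>)) \<in> H)"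

definition nl_expectation :: "('w \<Rightarrow> real) set \<Rightarrow> (('w \<Rightarrow> real) \<Rightarrow> real) \<Rightarrow> bool" where
  "nl_expectation H E \<longleftrightarrow>
     (\<forall>X\<in>H. \<forall>Y\<in>H. (\<forall>\<omega>. X \<omega> \<ge> Y \<omega>) \<longrightarrow> E X \<ge> E Y) \<and>
     (\<forall>c. E (\<lambda>_. c) = c)"

definition sl_expectation :: "('w \<Rightarrow> real) set \<Rightarrow> (('w \<Rightarrow> real) \<Rightarrow> real) \<Rightarrow> bool" where
  "sl_expectation H E \<longleftrightarrow> nl_expectation H E \<and>
     (\<forall>X\<in>H. \<forall>Y\<in>H. E (\<lambda>\<omega>. X \<omega> + Y \<omega>) \<le> E X + E Y) \<and>
     (\<forall>X\<in>H. \<forall>c::real. c \<ge> 0 \<longrightarrow> E (\<lambda>\<omega>. c * X \<omega>) = c * E X)"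

definition nl_space :: "('w \<Rightarrow> real) set \<Rightarrow> (('w \<Rightarrow> real) \<Rightarrow> real) \<Rightarrow> bool" where
  "nl_space H E \<longleftrightarrow> lin_space H \<and> nl_expectation H E"

definition sl_space :: "('w \<Rightarrow> real) set \<Rightarrow> (('w \<Rightarrow> real) \<Rightarrow> real) \<Rightarrow> bool" where
  "sl_space H E \<longleftrightarrow> lin_space H \<and> sl_expectation H E"

definition dominates :: "('w \<Rightarrow> real) set \<Rightarrow> (('w \<Rightarrow> real) \<Rightarrow> real) \<Rightarrow> (('w \<Rightarrow> real) \<Rightarrow> real) \<Rightarrow> bool" where
  "dominates H Et E \<longleftrightarrow> (\<forall>X\<in>H. \<forall>Y\<in>H. E X - E Y \<le> Et (\<lambda>\<omega>. X \<omega> - Y \<omega>))"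

text \<open>Y (d-dim) is independent from X (m-dim) under E.\<close>
definition indep :: "(('w \<Rightarrow> real) \<Rightarrow> real) \<Rightarrow> nat \<Rightarrow> ('w \<Rightarrow> real list) \<Rightarrow> nat \<Rightarrow> ('w \<Rightarrow> real list) \<Rightarrow> bool" where
  "indep E m X d Y \<longleftrightarrow> (\<forall>\<phi>. cblip (m + d) \<phi> \<longrightarrow>
     E (\<lambda>\<omega>. \<phi> (X \<omega> @ Y \<omega>)) = E (\<lambda>\<omega>. E (\<lambda>\<omega>'. \<phi> (X \<omega> @ Y \<omega>'))))"

text \<open>A d-dimensional process (X_t)_{t>=0} with X_0 = 0 (values at t < 0 are irrelevant).\<close>
definition process :: "('w \<Rightarrow> real) set \<Rightarrow> nat \<Rightarrow> (real \<Rightarrow> 'w \<Rightarrow> real list) \<Rightarrow> bool" where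
  "process H d X \<longleftrightarrow> (\<forall>t\<ge>0. rvec H d (X t)) \<and> (\<forall>\<omega>. X 0 \<omega> = replicate d 0)"

definition fdv :: "(real \<Rightarrow> 'w \<Rightarrow> real list) \<Rightarrow> real list \<Rightarrow> 'w \<Rightarrow> real list" where
  "fdv X ts = (\<lambda>\<omega>. concat (map (\<lambda>t. X t \<omega>) ts))"

definition indep_incr :: "(('w \<Rightarrow> real) \<Rightarrow> real) \<Rightarrow> nat \<Rightarrow> (real \<Rightarrow> 'w \<Rightarrow> real list) \<Rightarrow> bool" where
  "indep_incr E d X \<longleftrightarrow> (\<forall>ts. length ts \<ge> 2 \<and> sorted_wrt (<) ts \<and> hd ts \<ge> 0 \<longrightarrow>
     indep E ((length ts - 1) * d) (fdv X (butlast ts)) d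
       (\<lambda>\<omega>. vsub (X (last ts) \<omega>) (X (last (butlast ts)) \<omega>)))"

definition same_law :: "nat \<Rightarrow> (('a \<Rightarrow> real) \<Rightarrow> real) \<Rightarrow> ('a \<Rightarrow> real list) \<Rightarrow>
    (('b \<Rightarrow> real) \<Rightarrow> real) \<Rightarrow> ('b \<Rightarrow> real list) \<Rightarrow> bool" where
  "same_law n E1 X1 E2 X2 \<longleftrightarrow> (\<forall>\<phi>. cblip n \<phi> \<longrightarrow> E1 (\<lambda>\<omega>. \<phi> (X1 \<omega>)) = E2 (\<lambda>\<omega>. \<phi> (X2 \<omega>)))"

definition same_law_proc :: "nat \<Rightarrow> (('a \<Rightarrow> real) \<Rightarrow> real) \<Rightarrow> (real \<Rightarrow> 'a \<Rightarrow> real list) \<Rightarrow>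
    (('b \<Rightarrow> real) \<Rightarrow> real) \<Rightarrow> (real \<Rightarrow> 'b \<Rightarrow> real list) \<Rightarrow> bool" where
  "same_law_proc d E1 X1 E2 X2 \<longleftrightarrow> (\<forall>ts. (\<forall>t\<in>set ts. t \<ge> 0) \<longrightarrow>
     same_law (length ts * d) E1 (fdv X1 ts) E2 (fdv X2 ts))"

definition stat_incr :: "(('w \<Rightarrow> real) \<Rightarrow> real) \<Rightarrow> nat \<Rightarrow> (real \<Rightarrow> 'w \<Rightarrow> real list) \<Rightarrow> bool" where
  "stat_incr E d X \<longleftrightarrow> (\<forall>t s. t \<ge> 0 \<and> s \<ge> 0 \<longrightarrow>
     same_law d E (\<lambda>\<omega>. vsub (X (t + s) \<omega>) (X s \<omega>)) E (X t))"

end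

theory Submission
  imports Defs
begin

text \<open>On the grid of width \<open>1/n\<close> let the joint increments be given by applying \<open>E2\<close> to the increment of
  \<open>N\<close> and then \<open>E1\<close> to the increment of \<open>M\<close>, and let successive increments be independent. This chain has
  independent increments, and its marginals are \<open>M\<close> and \<open>N\<close> at grid times. Independence is not symmetric,
  so these joint laws depend on the grid, and one passes to the limit along a filter on which every bounded
  sequence converges. Continuity (A)(2) recovers \<open>M\<close> and \<open>N\<close> at all times as well as stationarity, for
  which the rounding of times to the grid matters only by one step.

  Independence survives the limit if the joint laws at fixed times are uniformly tight. Since the dominating
  expectations need not have independent increments, composing them step by step gives no such bound. Instead
  one shows: if \<open>\<Phi> \<le> \<Psi> + f(M)\<close> on paths then the joint chain separates \<open>\<Phi>\<close> and \<open>\<Psi>\<close> by no more than the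
  supremum over \<open>\<psi>\<close> and \<open>q\<close> of \<open>q (E1[\<psi>(M) + f(M)/q] - E1[\<psi>(M)])\<close>, which the dominating expectation of \<open>f(M)\<close>
  bounds. In each step an almost optimal \<open>\<psi>\<close> has to be selected continuously in the present increment.\<close>

section \<open>Functions of real lists\<close>

text \<open>Domination bounds the moment of one increment by a quantity that tends to 0 with the
  mesh, but the sum over all steps may diverge, as it does for Brownian motion. So the moment of a
  path value has to be taken for the whole path at once, and the joint chain, which comes with no
  dominating expectation for its paths, must inherit it from the marginals. The supremum over
  \<open>\<psi>\<close> and \<open>q\<close> can be inherited because it is intrinsic to a chain: it
  is the least c such that adding \<open>f / q\<close> to any base function raises the expectation
  by at most \<open>c / q\<close>. A dominating sublinear expectation bounds it but does not enter
  its definition. It also composes: with the present increment x frozen, the tail has its own least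
  constant g(x), and the constant of g under the law of x is at most that of f under the composed
  law. This inequality is the core. Its proof needs a base function that is nearly extremal for all
  x in a large ball and still jointly Lipschitz, while near-extremality is known only at finitely
  many x.\<close>

definition l1 :: "real list \<Rightarrow> real" where
  "l1 xs = (\<Sum>x\<leftarrow>xs. \<bar>x\<bar>)"

text \<open>The 1-norm replaces the Euclidean norm because it is additive under concatenation, so
  that Lipschitz estimates split along blocks. On lists of fixed length the two norms are comparable
  by \<open>lnorm_le_l1\<close> and \<open>l1_le_lnorm\<close>.\<close>

abbreviation ld :: "real list \<Rightarrow> real list \<Rightarrow> real" where
  "ld x y \<equiv> l1 (vsub x y)"

lemma l1_simps [simp]: "l1 [] = 0" "l1 (x # xs) = \<bar>x\<bar> + l1 xs" "l1 (xs @ ys) = l1 xs + l1 ys"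
  by (simp_all add: l1_def)

lemma l1_nonneg [simp]: "0 \<le> l1 xs"
  by (induction xs) auto

lemma length_vsub [simp]: "length (vsub x y) = min (length x) (length y)"
  by (simp add: vsub_def)

lemma vsub_simps [simp]: "vsub [] y = []" "vsub x [] = []" "vsub (a # x) (b # y) = (a - b) # vsub x y"
  by (simp_all add: vsub_def)

lemma nth_vsub [simp]: "i < length x \<Longrightarrow> i < length y \<Longrightarrow> vsub x y ! i = x ! i - y ! i"
  by (simp add: vsub_def)

lemma vsub_append [simp]: "length x = length y \<Longrightarrow> vsub (x @ x') (y @ y') = vsub x y @ vsub x' y'"
  by (simp add: vsub_def)

lemma ld_self [simp]: "ld x x = 0"
  by (induction x) auto

lemma ld_sym: "ld x y = ld y x"
proof (induction x arbitrary: y)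
  case (Cons a x) then show ?case by (cases y) (auto simp: abs_minus_commute)
qed simp

lemma ld_triangle: "length x = length y \<Longrightarrow> length y = length z \<Longrightarrow> ld x z \<le> ld x y + ld y z"
  by (induction x y z rule: list_induct3) auto

lemma l1_le_ld: "length x = length y \<Longrightarrow> l1 x \<le> ld x y + l1 y"
  by (induction x y rule: list_induct2) auto

lemma ld_take_drop:
  "length x = length y \<Longrightarrow> ld x y = ld (take p x) (take p y) + ld (drop p x) (drop p y)"
proof -
  assume a: "length x = length y"
  have "ld x y = ld (take p x @ drop p x) (take p y @ drop p y)" by simp
  also have "\<dots> = ld (take p x) (take p y) + ld (drop p x) (drop p y)"
    using a by (subst vsub_append) auto
  finally show ?thesis .
qed

lemma ld_take_le: "length x = length y \<Longrightarrow> ld (take p x) (take p y) \<le> ld x y"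
  using ld_take_drop[of x y p] l1_nonneg[of "vsub (drop p x) (drop p y)"] by linarith

lemma ld_drop_le: "length x = length y \<Longrightarrow> ld (drop p x) (drop p y) \<le> ld x y"
  using ld_take_drop[of x y p] l1_nonneg[of "vsub (take p x) (take p y)"] by linarith

lemma lnorm_nonneg [simp]: "0 \<le> lnorm xs"
  unfolding lnorm_def by (intro real_sqrt_ge_zero sum_list_nonneg) auto

lemma lnorm_le_l1: "lnorm xs \<le> l1 xs"
proof -
  have "(\<Sum>x\<leftarrow>xs. x ^ 2) \<le> (l1 xs)\<^sup>2"
  proof (induction xs)
    case (Cons x xs)
    then show ?case by (simp add: power2_sum add_increasing2)
  qed simp
  then show ?thesis by (simp add: lnorm_def real_le_lsqrt)
qed

lemma lnorm_Cons: "\<bar>x\<bar> \<le> lnorm (x # xs)" "lnorm xs \<le> lnorm (x # xs)"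
proof -
  have "0 \<le> (\<Sum>x\<leftarrow>xs. x ^ 2)" by (intro sum_list_nonneg) auto
  then show "\<bar>x\<bar> \<le> lnorm (x # xs)"
    using real_sqrt_le_mono[of "x\<^sup>2" "x\<^sup>2 + (\<Sum>x\<leftarrow>xs. x ^ 2)"] by (simp add: lnorm_def)
  show "lnorm xs \<le> lnorm (x # xs)" by (simp add: lnorm_def)
qed

lemma l1_le_lnorm: "l1 xs \<le> real (length xs) * lnorm xs"
proof (induction xs)
  case (Cons x xs)
  have "real (length xs) * lnorm xs \<le> real (length xs) * lnorm (x # xs)"
    by (intro mult_left_mono lnorm_Cons) auto
  then show ?case using Cons lnorm_Cons(1)[of x xs] by (simp add: algebra_simps)
qed simp

section \<open>Closure properties of bounded Lipschitz functions\<close>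

lemma cblipI:
  assumes "\<And>x. length x = n \<Longrightarrow> \<bar>\<phi> x\<bar> \<le> C"
    and "\<And>x y. length x = n \<Longrightarrow> length y = n \<Longrightarrow> \<phi> x - \<phi> y \<le> L * ld x y"
  shows "cblip n \<phi>"
proof -
  have "\<bar>\<phi> x - \<phi> y\<bar> \<le> (\<bar>L\<bar> * real n) * lnorm (vsub x y)" if "length x = n" "length y = n" for x y
  proof -
    have "\<bar>\<phi> x - \<phi> y\<bar> \<le> L * ld x y"
      using assms(2)[OF that] assms(2)[OF that(2,1)] by (simp add: ld_sym[of y x])
    also have "\<dots> \<le> \<bar>L\<bar> * ld x y" by (intro mult_right_mono) auto
    also have "\<dots> \<le> \<bar>L\<bar> * (real n * lnorm (vsub x y))"
      using l1_le_lnorm[of "vsub x y"] that by (intro mult_left_mono) auto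
    finally show ?thesis by (simp add: mult.assoc)
  qed
  then show ?thesis unfolding cblip_def using assms(1) by blast
qed

lemma cblipE:
  assumes "cblip n \<phi>"
  obtains C L where "0 \<le> C" "0 \<le> L" "\<And>x. length x = n \<Longrightarrow> \<bar>\<phi> x\<bar> \<le> C"
    "\<And>x y. length x = n \<Longrightarrow> length y = n \<Longrightarrow> \<bar>\<phi> x - \<phi> y\<bar> \<le> L * ld x y"
proof -
  obtain C L where C: "\<And>x. length x = n \<Longrightarrow> \<bar>\<phi> x\<bar> \<le> C"
    and L: "\<And>x y. length x = n \<Longrightarrow> length y = n \<Longrightarrow> \<bar>\<phi> x - \<phi> y\<bar> \<le> L * lnorm (vsub x y)"
    using assms unfolding cblip_def by blast
  have "0 \<le> C" using C[of "replicate n 0"] by simp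
  moreover have "\<bar>\<phi> x - \<phi> y\<bar> \<le> \<bar>L\<bar> * ld x y" if "length x = n" "length y = n" for x y
  proof -
    have "\<bar>\<phi> x - \<phi> y\<bar> \<le> L * lnorm (vsub x y)" using L that by blast
    also have "\<dots> \<le> \<bar>L\<bar> * lnorm (vsub x y)" by (intro mult_right_mono) auto
    also have "\<dots> \<le> \<bar>L\<bar> * ld x y" by (intro mult_left_mono lnorm_le_l1) auto
    finally show ?thesis .
  qed
  ultimately show ?thesis using that[of C "\<bar>L\<bar>"] C by simp
qed

lemma cblip_comp:
  assumes "cblip m \<phi>" "\<And>x. length x = n \<Longrightarrow> length (g x) = m"
    and "\<And>x y. length x = n \<Longrightarrow> length y = n \<Longrightarrow> ld (g x) (g y) \<le> K * ld x y"
  shows "cblip n (\<lambda>x. \<phi> (g x))"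
proof -
  obtain C L where *: "0 \<le> L" "\<And>x. length x = m \<Longrightarrow> \<bar>\<phi> x\<bar> \<le> C"
    "\<And>x y. length x = m \<Longrightarrow> length y = m \<Longrightarrow> \<bar>\<phi> x - \<phi> y\<bar> \<le> L * ld x y"
    using cblipE[OF assms(1)] by metis
  have "\<phi> (g x) - \<phi> (g y) \<le> (L * K) * ld x y" if "length x = n" "length y = n" for x y
  proof -
    have "\<phi> (g x) - \<phi> (g y) \<le> L * ld (g x) (g y)"
      using *(3)[of "g x" "g y"] assms(2) that by fastforce
    also have "\<dots> \<le> L * (K * ld x y)" using assms(3) that *(1) by (intro mult_left_mono) auto
    finally show ?thesis by (simp add: mult.assoc)
  qed
  then show ?thesis using *(2) assms(2) by (intro cblipI) auto
qed

lemma cblip_cong: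
  assumes "cblip n \<phi>" "\<And>x. length x = n \<Longrightarrow> \<phi> x = \<psi> x"
  shows "cblip n \<psi>"
  using assms unfolding cblip_def by auto

lemma cblip_const [simp, intro]: "cblip n (\<lambda>_. c)"
  by (rule cblipI[of _ _ "\<bar>c\<bar>" 0]) auto

lemma cblip_add [intro]:
  assumes "cblip n \<phi>" "cblip n \<psi>" shows "cblip n (\<lambda>x. \<phi> x + \<psi> x)"
proof -
  obtain C L C' L' where *: "\<And>x. length x = n \<Longrightarrow> \<bar>\<phi> x\<bar> \<le> C"
    "\<And>x y. length x = n \<Longrightarrow> length y = n \<Longrightarrow> \<bar>\<phi> x - \<phi> y\<bar> \<le> L * ld x y"
    "\<And>x. length x = n \<Longrightarrow> \<bar>\<psi> x\<bar> \<le> C'"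
    "\<And>x y. length x = n \<Longrightarrow> length y = n \<Longrightarrow> \<bar>\<psi> x - \<psi> y\<bar> \<le> L' * ld x y"
    by (metis assms cblipE)
  have "\<phi> x + \<psi> x - (\<phi> y + \<psi> y) \<le> (L + L') * ld x y"
    if "length x = n" "length y = n" for x y
    using *(2,4)[OF that] by (simp add: distrib_right abs_le_iff)
  moreover have "\<bar>\<phi> x + \<psi> x\<bar> \<le> C + C'" if "length x = n" for x
    using *(1,3)[OF that] by (simp add: abs_le_iff)
  ultimately show ?thesis by (rule cblipI[rotated])
qed

lemma cblip_cmult [intro]:
  assumes "cblip n \<phi>" shows "cblip n (\<lambda>x. c * \<phi> x)"
proof -
  obtain C L where *: "\<And>x. length x = n \<Longrightarrow> \<bar>\<phi> x\<bar> \<le> C"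
    "\<And>x y. length x = n \<Longrightarrow> length y = n \<Longrightarrow> \<bar>\<phi> x - \<phi> y\<bar> \<le> L * ld x y"
    by (metis assms cblipE)
  have "c * \<phi> x - c * \<phi> y \<le> (\<bar>c\<bar> * L) * ld x y" if "length x = n" "length y = n" for x y
  proof -
    have "c * \<phi> x - c * \<phi> y \<le> \<bar>c * (\<phi> x - \<phi> y)\<bar>" by (simp add: algebra_simps)
    also have "\<dots> \<le> \<bar>c\<bar> * (L * ld x y)"
      unfolding abs_mult using *(2)[OF that] by (intro mult_left_mono) auto
    finally show ?thesis by (simp add: mult.assoc)
  qed
  then show ?thesis
    using *(1) by (intro cblipI[of _ _ "\<bar>c\<bar> * C"]) (auto simp: abs_mult intro: mult_left_mono)
qed

lemma cblip_diff [intro]: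
  assumes "cblip n \<phi>" "cblip n \<psi>" shows "cblip n (\<lambda>x. \<phi> x - \<psi> x)"
  using cblip_add[OF assms(1) cblip_cmult[OF assms(2), of "-1"]] by simp

lemma cblip_divide [intro]: "cblip n \<phi> \<Longrightarrow> cblip n (\<lambda>x. \<phi> x / c)"
  using cblip_cmult[of n \<phi> "1/c"] by simp

lemma cblip_mult [intro]:
  assumes "cblip n \<phi>" "cblip n \<psi>" shows "cblip n (\<lambda>x. \<phi> x * \<psi> x)"
proof -
  obtain C L where *: "0 \<le> C" "0 \<le> L" "\<And>x. length x = n \<Longrightarrow> \<bar>\<phi> x\<bar> \<le> C"
    "\<And>x y. length x = n \<Longrightarrow> length y = n \<Longrightarrow> \<bar>\<phi> x - \<phi> y\<bar> \<le> L * ld x y"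
    by (metis assms(1) cblipE)
  obtain C' L' where **: "0 \<le> C'" "0 \<le> L'" "\<And>x. length x = n \<Longrightarrow> \<bar>\<psi> x\<bar> \<le> C'"
    "\<And>x y. length x = n \<Longrightarrow> length y = n \<Longrightarrow> \<bar>\<psi> x - \<psi> y\<bar> \<le> L' * ld x y"
    by (metis assms(2) cblipE)
  have "\<phi> x * \<psi> x - \<phi> y * \<psi> y \<le> (C * L' + L * C') * ld x y"
    if xy: "length x = n" "length y = n" for x y
  proof -
    have "\<phi> x * \<psi> x - \<phi> y * \<psi> y \<le> \<bar>\<phi> x * (\<psi> x - \<psi> y) + (\<phi> x - \<phi> y) * \<psi> y\<bar>"
      by (simp add: algebra_simps)
    also have "\<dots> \<le> \<bar>\<phi> x\<bar> * \<bar>\<psi> x - \<psi> y\<bar> + \<bar>\<phi> x - \<phi> y\<bar> * \<bar>\<psi> y\<bar>"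
      by (metis abs_mult abs_triangle_ineq)
    also have "\<dots> \<le> C * (L' * ld x y) + (L * ld x y) * C'"
      using * ** xy by (intro add_mono mult_mono) auto
    finally show ?thesis by (simp add: algebra_simps)
  qed
  moreover have "\<bar>\<phi> x * \<psi> x\<bar> \<le> C * C'" if "length x = n" for x
    unfolding abs_mult using * ** that by (intro mult_mono) auto
  ultimately show ?thesis by (rule cblipI[rotated])
qed

lemma cblip_sum [intro]:
  assumes "\<And>i. i \<in> I \<Longrightarrow> cblip n (\<phi> i)" shows "cblip n (\<lambda>x. \<Sum>i\<in>I. \<phi> i x)"
  using assms by (induction I rule: infinite_finite_induct) auto

lemma cblip_section: "cblip (p + k) \<phi> \<Longrightarrow> length x = p \<Longrightarrow> cblip k (\<lambda>z. \<phi> (x @ z))"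
  by (rule cblip_comp[where K = 1]) auto

lemma cblip_take: "cblip p \<phi> \<Longrightarrow> cblip (p + k) (\<lambda>xs. \<phi> (take p xs))"
  by (rule cblip_comp[where K = 1]) (auto intro: ld_take_le)

lemma cblip_drop: "cblip k \<phi> \<Longrightarrow> cblip (p + k) (\<lambda>xs. \<phi> (drop p xs))"
  by (rule cblip_comp[where K = 1]) (auto intro: ld_drop_le)

text \<open>Laws of random vectors are functionals on functions of real lists.\<close>

definition nexp :: "nat \<Rightarrow> ((real list \<Rightarrow> real) \<Rightarrow> real) \<Rightarrow> bool" where
  "nexp n T \<longleftrightarrow> (\<forall>c. T (\<lambda>_. c) = c) \<and>
     (\<forall>\<phi> \<psi> a. cblip n \<phi> \<longrightarrow> cblip n \<psi> \<longrightarrow> (\<forall>x. length x = n \<longrightarrow> \<phi> x \<le> \<psi> x + a) \<longrightarrow>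
        T \<phi> \<le> T \<psi> + a)"

text \<open>The constant \<open>K\<close> plays the role of the first absolute moment under a dominating
  sublinear expectation.\<close>

definition nlaw :: "nat \<Rightarrow> real \<Rightarrow> ((real list \<Rightarrow> real) \<Rightarrow> real) \<Rightarrow> bool" where
  "nlaw n K T \<longleftrightarrow> (\<forall>c. T (\<lambda>_. c) = c) \<and>
     (\<forall>\<phi> \<psi> a b. 0 \<le> b \<longrightarrow> cblip n \<phi> \<longrightarrow> cblip n \<psi> \<longrightarrow>
        (\<forall>x. length x = n \<longrightarrow> \<phi> x \<le> \<psi> x + a + b * l1 x) \<longrightarrow> T \<phi> \<le> T \<psi> + a + b * K)"

definition slaw :: "nat \<Rightarrow> ((real list \<Rightarrow> real) \<Rightarrow> real) \<Rightarrow> bool" where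
  "slaw n T \<longleftrightarrow> (\<forall>\<phi> \<psi>. cblip n \<phi> \<longrightarrow> cblip n \<psi> \<longrightarrow> T (\<lambda>x. \<phi> x + \<psi> x) \<le> T \<phi> + T \<psi>) \<and>
     (\<forall>\<phi> c. cblip n \<phi> \<longrightarrow> 0 \<le> c \<longrightarrow> T (\<lambda>x. c * \<phi> x) = c * T \<phi>)"

lemma nlawD:
  assumes "nlaw n K T" "0 \<le> b" "cblip n \<phi>" "cblip n \<psi>"
    "\<And>x. length x = n \<Longrightarrow> \<phi> x \<le> \<psi> x + a + b * l1 x"
  shows "T \<phi> \<le> T \<psi> + a + b * K"
  using assms unfolding nlaw_def by blast

lemma nlaw_nexp: "nlaw n K T \<Longrightarrow> nexp n T"
  unfolding nexp_def
proof (intro conjI allI impI)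
  fix \<phi> \<psi> :: "real list \<Rightarrow> real" and a
  assume "nlaw n K T" "cblip n \<phi>" "cblip n \<psi>" "\<forall>x. length x = n \<longrightarrow> \<phi> x \<le> \<psi> x + a"
  then show "T \<phi> \<le> T \<psi> + a" using nlawD[of n K T 0 \<phi> \<psi> a] by simp
qed (simp add: nlaw_def)

lemma nexp_const: "nexp n T \<Longrightarrow> T (\<lambda>_. c) = c"
  unfolding nexp_def by blast

lemma nexp_le:
  assumes "nexp n T" "cblip n \<phi>" "cblip n \<psi>" "\<And>x. length x = n \<Longrightarrow> \<phi> x \<le> \<psi> x + a"
  shows "T \<phi> \<le> T \<psi> + a"
  using assms unfolding nexp_def by blast

lemma nexp_mono:
  assumes "nexp n T" "cblip n \<phi>" "cblip n \<psi>" "\<And>x. length x = n \<Longrightarrow> \<phi> x \<le> \<psi> x"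
  shows "T \<phi> \<le> T \<psi>"
  using nexp_le[OF assms(1-3), of 0] assms(4) by simp

lemma nexp_cong:
  assumes "nexp n T" "cblip n \<phi>" "\<And>x. length x = n \<Longrightarrow> \<phi> x = \<psi> x"
  shows "T \<phi> = T \<psi>"
proof -
  have "cblip n \<psi>" using assms(2,3) by (rule cblip_cong)
  then show ?thesis using assms by (intro antisym nexp_mono[OF assms(1)]) auto
qed

lemma nexp_shift:
  assumes "nexp n T" "cblip n \<phi>" shows "T (\<lambda>x. \<phi> x + c) = T \<phi> + c"
proof -
  have "T (\<lambda>x. \<phi> x + c) \<le> T \<phi> + c" using assms by (intro nexp_le[OF assms(1)]) auto
  moreover have "T \<phi> \<le> T (\<lambda>x. \<phi> x + c) + (- c)" using assms by (intro nexp_le[OF assms(1)]) auto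
  ultimately show ?thesis by simp
qed

lemma nexp_abs_diff:
  assumes "nexp n T" "cblip n \<phi>" "cblip n \<psi>" "\<And>x. length x = n \<Longrightarrow> \<bar>\<phi> x - \<psi> x\<bar> \<le> a"
  shows "\<bar>T \<phi> - T \<psi>\<bar> \<le> a"
proof -
  have "T \<phi> \<le> T \<psi> + a" "T \<psi> \<le> T \<phi> + a"
    by (rule nexp_le[OF assms(1)]; use assms(2-) in \<open>force simp: abs_le_iff\<close>)+
  then show ?thesis by auto
qed

lemma nexp_bound:
  assumes "nexp n T" "cblip n \<phi>" "\<And>x. length x = n \<Longrightarrow> \<bar>\<phi> x\<bar> \<le> C"
  shows "\<bar>T \<phi>\<bar> \<le> C"
  using nexp_abs_diff[OF assms(1,2), of "\<lambda>_. 0" C] assms nexp_const[OF assms(1), of 0] by simp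

text \<open>A law is 1-Lipschitz for the supremum norm (\<open>nexp_abs_diff\<close>), so
  integrating out the last block preserves both the bound and the Lipschitz constant. This keeps
  iterated laws inside the class of functions on which they are controlled.\<close>

lemma cblip_partial:
  assumes T: "nexp k T" and \<phi>: "cblip (p + k) \<phi>"
  shows "cblip p (\<lambda>x. T (\<lambda>z. \<phi> (x @ z)))"
proof -
  obtain C L where *: "\<And>x. length x = p + k \<Longrightarrow> \<bar>\<phi> x\<bar> \<le> C"
    "\<And>x y. length x = p + k \<Longrightarrow> length y = p + k \<Longrightarrow> \<bar>\<phi> x - \<phi> y\<bar> \<le> L * ld x y"
    by (metis \<phi> cblipE)
  have "T (\<lambda>z. \<phi> (x @ z)) - T (\<lambda>z. \<phi> (y @ z)) \<le> L * ld x y"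
    if "length x = p" "length y = p" for x y
    using nexp_abs_diff[OF T cblip_section[OF \<phi> that(1)] cblip_section[OF \<phi> that(2)], of "L * ld x y"]
      *(2)[of "x @ _" "y @ _"] that by fastforce
  moreover have "\<bar>T (\<lambda>z. \<phi> (x @ z))\<bar> \<le> C" if "length x = p" for x
    using * that by (intro nexp_bound[OF T cblip_section[OF \<phi> that]]) auto
  ultimately show ?thesis by (rule cblipI[rotated])
qed

section \<open>Composition and iteration of laws\<close>

definition comp_law :: "((real list \<Rightarrow> real) \<Rightarrow> real) \<Rightarrow> ((real list \<Rightarrow> real) \<Rightarrow> real) \<Rightarrow> (real list \<Rightarrow> real) \<Rightarrow> real" where
  "comp_law A B \<phi> = A (\<lambda>x. B (\<lambda>y. \<phi> (x @ y)))"

lemma slaw_comp_law: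
  assumes A: "nexp p A" "slaw p A" and B: "nexp q B" "slaw q B"
  shows "slaw (p + q) (comp_law A B)"
  unfolding slaw_def
proof (intro conjI allI impI)
  note part = cblip_partial[OF B(1)]
  fix \<phi> \<psi> :: "real list \<Rightarrow> real"
  assume c: "cblip (p + q) \<phi>" "cblip (p + q) \<psi>"
  have "comp_law A B (\<lambda>x. \<phi> x + \<psi> x) \<le> A (\<lambda>x. B (\<lambda>y. \<phi> (x @ y)) + B (\<lambda>y. \<psi> (x @ y)))"
    unfolding comp_law_def using B(2) cblip_section[OF c(1)] cblip_section[OF c(2)]
    by (intro nexp_mono[OF A(1)] part cblip_add c) (auto simp: slaw_def)
  also have "\<dots> \<le> comp_law A B \<phi> + comp_law A B \<psi>"
    using A(2) part[OF c(1)] part[OF c(2)] by (simp add: slaw_def comp_law_def)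
  finally show "comp_law A B (\<lambda>x. \<phi> x + \<psi> x) \<le> comp_law A B \<phi> + comp_law A B \<psi>" .
next
  note part = cblip_partial[OF B(1)]
  fix \<phi> :: "real list \<Rightarrow> real" and b :: real
  assume c: "cblip (p + q) \<phi>" and b: "0 \<le> b"
  have "comp_law A B (\<lambda>x. b * \<phi> x) = A (\<lambda>x. b * B (\<lambda>y. \<phi> (x @ y)))"
    unfolding comp_law_def using B(2) cblip_section[OF c] b
    by (intro nexp_cong[OF A(1)] part cblip_cmult c) (auto simp: slaw_def)
  also have "\<dots> = b * comp_law A B \<phi>" using A(2) part[OF c] b by (simp add: slaw_def comp_law_def)
  finally show "comp_law A B (\<lambda>x. b * \<phi> x) = b * comp_law A B \<phi>" .
qed

text \<open>The head is the law of the earliest increment and is applied last, after the later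
  increments have been integrated for its frozen value. This is the order in \<open>indep\<close>,
  where the later vector is integrated first.\<close>

fun iter :: "((real list \<Rightarrow> real) \<Rightarrow> real) list \<Rightarrow> (real list \<Rightarrow> real) \<Rightarrow> real" where
  "iter [] \<phi> = \<phi> []"
| "iter (T # Ts) \<phi> = T (\<lambda>x. iter Ts (\<lambda>xs. \<phi> (x @ xs)))"

lemma iter_append: "iter (Ts @ Us) \<phi> = iter Ts (\<lambda>xs. iter Us (\<lambda>ys. \<phi> (xs @ ys)))"
  by (induction Ts arbitrary: \<phi>) auto

lemma iter_nexp: "(\<And>T. T \<in> set Ts \<Longrightarrow> nexp p T) \<Longrightarrow> nexp (length Ts * p) (iter Ts)"
proof (induction Ts)
  case Nil
  show ?case by (auto simp: nexp_def)
next
  case (Cons T Ts)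
  have T: "nexp p T" and Ts: "nexp (length Ts * p) (iter Ts)" using Cons by auto
  show ?case
    unfolding nexp_def
  proof (intro conjI allI impI)
    fix c show "iter (T # Ts) (\<lambda>_. c) = c" by (simp add: nexp_const[OF T] nexp_const[OF Ts])
  next
    fix \<phi> \<psi> :: "real list \<Rightarrow> real" and a
    assume "cblip (length (T # Ts) * p) \<phi>" "cblip (length (T # Ts) * p) \<psi>"
      and le: "\<forall>x. length x = length (T # Ts) * p \<longrightarrow> \<phi> x \<le> \<psi> x + a"
    then have c: "cblip (p + length Ts * p) \<phi>" "cblip (p + length Ts * p) \<psi>" by auto
    show "iter (T # Ts) \<phi> \<le> iter (T # Ts) \<psi> + a"
      unfolding iter.simps
      by (intro nexp_le[OF T] nexp_le[OF Ts] cblip_partial[OF Ts] cblip_section c) (simp_all add: le c)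
  qed
qed

lemma iter_slaw:
  "(\<And>T. T \<in> set Ts \<Longrightarrow> nexp p T) \<Longrightarrow> (\<And>T. T \<in> set Ts \<Longrightarrow> slaw p T) \<Longrightarrow>
    slaw (length Ts * p) (iter Ts)"
proof (induction Ts)
  case (Cons T Ts)
  have "iter (T # Ts) = comp_law T (iter Ts)" by (simp add: comp_law_def fun_eq_iff)
  then show ?case using Cons by (auto intro!: slaw_comp_law iter_nexp)
qed (auto simp: slaw_def)

section \<open>Moments of a marginal chain\<close>

definition slope :: "((real list \<Rightarrow> real) \<Rightarrow> real) \<Rightarrow> (real list \<Rightarrow> real) \<Rightarrow> nat \<Rightarrow> (real list \<Rightarrow> real) \<Rightarrow> real" where
  "slope T f q \<psi> = real q * (T (\<lambda>z. \<psi> z + f z / real q) - T \<psi>)"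

text \<open>For bounded Lipschitz \<open>f\<close> this is the least c with
  \<open>T (\<psi> + f / q) \<le> T \<psi> + c / q\<close> for all base functions and all
  \<open>q \<ge> 1\<close>. Steps are reciprocals of natural numbers, so that finitely many of them
  can be brought to a common one by a common multiple.\<close>

definition maxslope :: "nat \<Rightarrow> ((real list \<Rightarrow> real) \<Rightarrow> real) \<Rightarrow> (real list \<Rightarrow> real) \<Rightarrow> real" where
  "maxslope k T f = (SUP (q, \<psi>) \<in> {1..} \<times> Collect (cblip k). slope T f q \<psi>)"

lemma slope_nonneg:
  assumes "nexp k T" "cblip k f" "cblip k \<psi>" "\<And>z. length z = k \<Longrightarrow> 0 \<le> f z"
  shows "0 \<le> slope T f q \<psi>"
  unfolding slope_def
  using assms by (auto intro!: mult_nonneg_nonneg nexp_mono[OF assms(1)] cblip_add cblip_divide)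

lemma slope_le_slope:
  assumes "nexp k T" "cblip k f" "cblip k f'" "cblip k \<psi>" "1 \<le> q"
    and "\<And>z. length z = k \<Longrightarrow> f z \<le> f' z + a"
  shows "slope T f q \<psi> \<le> slope T f' q \<psi> + a"
proof -
  have "T (\<lambda>z. \<psi> z + f z / real q) \<le> T (\<lambda>z. \<psi> z + f' z / real q) + a / real q"
    using assms by (intro nexp_le[OF assms(1)])
      (auto simp: add_divide_distrib[symmetric] intro!: divide_right_mono)
  then have "real q * T (\<lambda>z. \<psi> z + f z / real q)
      \<le> real q * (T (\<lambda>z. \<psi> z + f' z / real q) + a / real q)"
    by (intro mult_left_mono) auto
  then show ?thesis using assms(5) by (simp add: slope_def algebra_simps)
qed

lemma slope_le:
  assumes "nexp k T" "cblip k f" "cblip k \<psi>" "1 \<le> q" "\<And>z. length z = k \<Longrightarrow> f z \<le> a"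
  shows "slope T f q \<psi> \<le> a"
  using slope_le_slope[OF assms(1,2) cblip_const[of k 0] assms(3,4), of a] assms(5)
  by (simp add: slope_def)

lemma slope_bdd:
  assumes "nexp k T" "cblip k f"
  shows "bdd_above ((\<lambda>(q, \<psi>). slope T f q \<psi>) ` ({1..} \<times> Collect (cblip k)))"
proof -
  obtain C where "\<And>x. length x = k \<Longrightarrow> \<bar>f x\<bar> \<le> C" using cblipE[OF assms(2)] by metis
  then show ?thesis using slope_le[OF assms(1,2)]
    by (intro bdd_aboveI[of _ C]) (force simp: abs_le_iff)
qed

lemma slope_le_maxslope:
  assumes "nexp k T" "cblip k f" "cblip k \<psi>" "1 \<le> q"
  shows "slope T f q \<psi> \<le> maxslope k T f"
  unfolding maxslope_def
  using cSUP_upper[OF _ slope_bdd[OF assms(1,2)], of "(q, \<psi>)"] assms by simp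

lemma maxslope_least:
  assumes "\<And>q \<psi>. 1 \<le> q \<Longrightarrow> cblip k \<psi> \<Longrightarrow> slope T f q \<psi> \<le> a"
  shows "maxslope k T f \<le> a"
  unfolding maxslope_def using assms by (intro cSUP_least) (auto intro: exI[of _ "\<lambda>_. 0"])

lemma maxslope_le_maxslope:
  assumes "nexp k T" "cblip k f" "cblip k f'" "\<And>z. length z = k \<Longrightarrow> f z \<le> f' z + a"
  shows "maxslope k T f \<le> maxslope k T f' + a"
  using slope_le_slope[OF assms(1-3) _ _ assms(4)] slope_le_maxslope[OF assms(1,3)]
  by (intro maxslope_least) force

lemma maxslope_bounds:
  assumes "nexp k T" "cblip k f" "\<And>z. length z = k \<Longrightarrow> 0 \<le> f z" "\<And>z. length z = k \<Longrightarrow> f z \<le> C"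
  shows "0 \<le> maxslope k T f" "maxslope k T f \<le> C"
proof -
  show "maxslope k T f \<le> C" using assms by (intro maxslope_least slope_le)
  have "0 \<le> slope T f 1 (\<lambda>_. 0)" using assms by (intro slope_nonneg) auto
  also have "\<dots> \<le> maxslope k T f" using assms by (intro slope_le_maxslope) auto
  finally show "0 \<le> maxslope k T f" .
qed

lemma maxslope_attained:
  assumes "nexp k T" "cblip k f" "0 < e"
  obtains q \<psi> where "1 \<le> q" "cblip k \<psi>" "maxslope k T f \<le> slope T f q \<psi> + e"
proof (rule ccontr)
  assume "\<not> thesis"
  then have "\<And>q \<psi>. 1 \<le> q \<Longrightarrow> cblip k \<psi> \<Longrightarrow> slope T f q \<psi> \<le> maxslope k T f - e"
    using that by force
  then show False using maxslope_least[of k T f "maxslope k T f - e"] assms(3) by force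
qed

text \<open>\<open>maxslope\<close> is 1-Lipschitz in its direction for the supremum norm, so the
  Lipschitz constant of \<open>f\<close> in x carries over.\<close>

lemma cblip_maxslope:
  assumes T: "nexp k T" and f: "cblip (p + k) f"
    and f0: "\<And>xs. length xs = p + k \<Longrightarrow> 0 \<le> f xs"
  shows "cblip p (\<lambda>x. maxslope k T (\<lambda>z. f (x @ z)))"
proof -
  obtain C L where CL: "\<And>x. length x = p + k \<Longrightarrow> \<bar>f x\<bar> \<le> C"
    "\<And>x y. length x = p + k \<Longrightarrow> length y = p + k \<Longrightarrow> \<bar>f x - f y\<bar> \<le> L * ld x y"
    using cblipE[OF f] by metis
  note sec = cblip_section[OF f]
  show ?thesis
  proof (rule cblipI)
    fix x :: "real list" assume x: "length x = p"
    have "0 \<le> f (x @ z)" "f (x @ z) \<le> C" if "length z = k" for z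
      using f0[of "x @ z"] CL(1)[of "x @ z"] x that by (auto simp: abs_le_iff)
    from maxslope_bounds[OF T sec[OF x] this]
    show "\<bar>maxslope k T (\<lambda>z. f (x @ z))\<bar> \<le> C" by auto
  next
    fix x y :: "real list" assume xy: "length x = p" "length y = p"
    have "f (x @ z) \<le> f (y @ z) + L * ld x y" if "length z = k" for z
      using CL(2)[of "x @ z" "y @ z"] xy that by (simp add: abs_le_iff)
    from maxslope_le_maxslope[OF T sec[OF xy(1)] sec[OF xy(2)] this]
    show "maxslope k T (\<lambda>z. f (x @ z)) - maxslope k T (\<lambda>z. f (y @ z)) \<le> L * ld x y" by simp
  qed
qed

text \<open>Subdividing the segment from \<open>\<psi>\<close> to \<open>\<psi> + f / q\<close>, one of the pieces has at least the
  average slope.\<close>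

lemma slope_refine:
  assumes "1 \<le> q" "1 \<le> s" "cblip k f" "cblip k \<psi>"
  obtains \<psi>' where "cblip k \<psi>'" "slope T f q \<psi> \<le> slope T f (q * s) \<psi>'"
proof -
  define \<theta> where "\<theta> i = (\<lambda>z. \<psi> z + real i * (f z / real (q * s)))" for i
  have \<theta>: "cblip k (\<theta> i)" for i unfolding \<theta>_def by (intro cblip_add cblip_cmult cblip_divide assms)
  have tele: "(\<Sum>i<s. T (\<theta> (Suc i)) - T (\<theta> i)) = T (\<theta> s) - T (\<theta> 0)"
    using sum_lessThan_telescope[of "\<lambda>i. T (\<theta> i)" s] .
  have "\<exists>i<s. (T (\<theta> s) - T (\<theta> 0)) / real s \<le> T (\<theta> (Suc i)) - T (\<theta> i)"
  proof (rule ccontr)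
    assume "\<not> ?thesis"
    then have "(\<Sum>i<s. T (\<theta> (Suc i)) - T (\<theta> i)) < (\<Sum>i<s. (T (\<theta> s) - T (\<theta> 0)) / real s)"
      using assms(2) by (intro sum_strict_mono) (auto simp: lessThan_empty_iff)
    then show False using assms(2) by (simp add: tele lessThan_empty_iff)
  qed
  then obtain i where i: "(T (\<theta> s) - T (\<theta> 0)) / real s \<le> T (\<theta> (Suc i)) - T (\<theta> i)" by blast
  have ends: "\<theta> 0 = \<psi>" "\<theta> s = (\<lambda>z. \<psi> z + f z / real q)" "\<theta> (Suc i) = (\<lambda>z. \<theta> i z + f z / real (q * s))"
    unfolding \<theta>_def using assms(1,2) by (auto simp: fun_eq_iff field_simps)
  have "slope T f q \<psi> = real (q * s) * ((T (\<theta> s) - T (\<theta> 0)) / real s)"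
    unfolding slope_def ends using assms(2) by simp
  also have "\<dots> \<le> slope T f (q * s) (\<theta> i)"
    unfolding slope_def using i ends(3) by (intro mult_left_mono) auto
  finally show ?thesis using that \<theta> by blast
qed

section \<open>Gluing of functions and finite nets\<close>

definition cut :: "real \<Rightarrow> real \<Rightarrow> real \<Rightarrow> real" where
  "cut a w u = max 0 (min 1 ((a + w - u) / w))"

lemma cut_bounds: "0 \<le> cut a w u" "cut a w u \<le> 1"
  by (auto simp: cut_def)

lemma cut_simps: "0 < w \<Longrightarrow> u \<le> a \<Longrightarrow> cut a w u = 1" "0 < w \<Longrightarrow> a + w \<le> u \<Longrightarrow> cut a w u = 0"
  by (auto simp: cut_def divide_simps)

lemma cut_lipschitz: "0 < w \<Longrightarrow> cut a w u - cut a w v \<le> \<bar>u - v\<bar> / w"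
  unfolding cut_def by (auto simp: max_def min_def divide_simps)

text \<open>Uses the function attached to the first base point within distance \<open>a\<close> of \<open>x\<close>, provided
  that no base point has its distance in the transition zone between \<open>a\<close> and \<open>a + w\<close>.\<close>

fun glue :: "real \<Rightarrow> real \<Rightarrow> (real list \<times> (real list \<Rightarrow> real)) list \<Rightarrow> real list \<Rightarrow> real list \<Rightarrow> real" where
  "glue a w [] x z = 0"
| "glue a w ((y, \<psi>) # ps) x z = cut a w (ld x y) * \<psi> z + (1 - cut a w (ld x y)) * glue a w ps x z"

lemma cblip_glue:
  assumes "0 < w" "\<And>y \<psi>. (y, \<psi>) \<in> set ps \<Longrightarrow> length y = p \<and> cblip k \<psi>"
  shows "cblip (p + k) (\<lambda>xs. glue a w ps (take p xs) (drop p xs))"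
  using assms(2)
proof (induction ps)
  case (Cons e ps)
  obtain y \<psi> where e: "e = (y, \<psi>)" by (cases e)
  have y: "length y = p" "cblip k \<psi>" using Cons.prems e by auto
  have "cblip p (\<lambda>x. cut a w (ld x y))"
  proof (rule cblipI[where C = 1 and L = "1 / w"])
    fix x x' :: "real list" assume x: "length x = p" "length x' = p"
    have "\<bar>ld x y - ld x' y\<bar> \<le> ld x x'"
      using ld_triangle[of x x' y] ld_triangle[of x' x y] x y by (simp add: ld_sym[of x' x])
    then have "\<bar>ld x y - ld x' y\<bar> / w \<le> ld x x' / w"
      using assms(1) by (intro divide_right_mono) auto
    then show "cut a w (ld x y) - cut a w (ld x' y) \<le> 1 / w * ld x x'"
      using cut_lipschitz[OF assms(1), of a "ld x y" "ld x' y"] by simp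
  qed (use cut_bounds in \<open>simp add: abs_le_iff\<close>)
  then have "cblip (p + k) (\<lambda>xs. cut a w (ld (take p xs) y))" by (rule cblip_take)
  then show ?case using Cons y unfolding e glue.simps
    by (intro cblip_add cblip_mult cblip_diff cblip_const cblip_drop[OF y(2)]) auto
qed simp

lemma glue_eq:
  assumes "0 < w" "\<And>y \<psi>. (y, \<psi>) \<in> set ps \<Longrightarrow> ld x y \<le> a \<or> a + w \<le> ld x y"
    and "\<exists>(y, \<psi>) \<in> set ps. ld x y \<le> a"
  shows "\<exists>(y, \<psi>) \<in> set ps. ld x y \<le> a \<and> glue a w ps x = \<psi>"
  using assms(2,3)
proof (induction ps)
  case (Cons e ps)
  obtain y \<psi> where e: "e = (y, \<psi>)" by (cases e)
  show ?case
  proof (cases "ld x y \<le> a")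
    case True
    then have "glue a w (e # ps) x = \<psi>" unfolding e by (auto simp: cut_simps assms(1))
    then show ?thesis using True e by auto
  next
    case False
    then have "a + w \<le> ld x y" using Cons.prems(1)[of y \<psi>] e by auto
    then have "glue a w (e # ps) x = glue a w ps x" unfolding e by (auto simp: cut_simps assms(1))
    moreover have "\<exists>(y, \<psi>) \<in> set ps. ld x y \<le> a \<and> glue a w ps x = \<psi>"
      using Cons False e by (intro Cons.IH) auto
    ultimately show ?thesis by auto
  qed
qed simp

lemma abs_le_l1: "v \<in> set x \<Longrightarrow> \<bar>v\<bar> \<le> l1 x"
proof (induction x)
  case (Cons a x)
  then consider "v = a" | "v \<in> set x" by auto
  then show ?case by cases (use Cons l1_nonneg[of x] in auto)
qed simp

lemma finite_net:
  assumes "0 < r"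
  obtains Y where "finite Y" "\<And>y. y \<in> Y \<Longrightarrow> length y = p"
    "\<And>x. length x = p \<Longrightarrow> l1 x \<le> R \<Longrightarrow> \<exists>y\<in>Y. ld x y \<le> r"
proof -
  \<comment> \<open>Rounding down to multiples of \<open>\<eta>\<close> moves each of the p
    coordinates by at most \<open>\<eta>\<close>, hence the list by at most r; \<open>p + 1\<close>
    covers the case \<open>p = 0\<close>.\<close>
  define \<eta> where "\<eta> = r / (real p + 1)"
  have \<eta>: "0 < \<eta>" using assms by (simp add: \<eta>_def)
  define I where "I = {- \<lceil>R / \<eta>\<rceil> - 1 .. \<lceil>R / \<eta>\<rceil> + 1}"
  define Y where "Y = {ys. set ys \<subseteq> (\<lambda>i. \<eta> * of_int i) ` I \<and> length ys = p}"
  define rnd where "rnd v = \<eta> * of_int \<lfloor>v / \<eta>\<rfloor>" for v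
  have rnd: "\<bar>v - rnd v\<bar> \<le> \<eta>" for v
  proof -
    have *: "i * \<eta> \<le> v \<and> v \<le> i * \<eta> + \<eta>" if "i \<le> v / \<eta>" "v / \<eta> \<le> i + 1" for i
      using that \<eta> by (simp add: field_simps)
    have "of_int \<lfloor>v / \<eta>\<rfloor> * \<eta> \<le> v \<and> v \<le> of_int \<lfloor>v / \<eta>\<rfloor> * \<eta> + \<eta>"
      by (rule *) linarith+
    then show ?thesis unfolding rnd_def abs_le_iff mult.commute[of \<eta>] by linarith
  qed
  have ld: "ld x (map rnd x) \<le> real (length x) * \<eta>" for x
  proof (induction x)
    case (Cons v x)
    then show ?case using rnd[of v] by (simp add: distrib_right)
  qed simp
  have "finite Y" unfolding Y_def I_def by (intro finite_lists_length_eq) simp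
  moreover have "length y = p" if "y \<in> Y" for y using that by (simp add: Y_def)
  moreover have "\<exists>y\<in>Y. ld x y \<le> r" if x: "length x = p" "l1 x \<le> R" for x
  proof (rule bexI)
    have "(real p + 1) * \<eta> = r" by (simp add: \<eta>_def)
    then have "real p * \<eta> \<le> r" using \<eta> by (simp add: distrib_right)
    then show "ld x (map rnd x) \<le> r" using ld[of x] x by simp
    have "rnd v \<in> (\<lambda>i. \<eta> * of_int i) ` I" if v: "v \<in> set x" for v
    proof -
      have "\<bar>v\<bar> \<le> l1 x" using v by (rule abs_le_l1)
      then have "v / \<eta> \<le> R / \<eta>" "- (R / \<eta>) \<le> v / \<eta>"
        using x(2) divide_right_mono[of v R \<eta>] divide_right_mono[of "- R" v \<eta>] \<eta> by simp_all
      then have "\<lfloor>v / \<eta>\<rfloor> \<in> I"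
        unfolding I_def atLeastAtMost_iff by (intro conjI; linarith)
      then show ?thesis unfolding rnd_def by (rule imageI)
    qed
    then show "map rnd x \<in> Y" unfolding Y_def using x(1) by (simp add: image_subset_iff)
  qed
  ultimately show ?thesis by (rule that)
qed

text \<open>The open intervals for different l are disjoint, so each u lies in at most one of them.
  With U the set of distances from x to the base points, all but \<open>card U\<close> of the
  gluings at x avoid their transition zone.\<close>

lemma card_transition_zones:
  fixes U :: "real set"
  assumes "0 < w" and that: "finite U"
  shows "card {l. l < q \<and> (\<exists>u \<in> U. a + real l * w < u \<and> u < a + real l * w + w)} \<le> card U"
proof -
  define Z where "Z u = {l. l < q \<and> a + real l * w < u \<and> u < a + real l * w + w}" for u
  have "card (Z u) \<le> 1" for u
  proof -
    have "l = l'" if "l \<in> Z u" "l' \<in> Z u" for l l'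
    proof (rule ccontr)
      assume "l \<noteq> l'"
      then consider "real l + 1 \<le> real l'" | "real l' + 1 \<le> real l" by linarith
      then show False
      proof cases
        case 1
        then have "(real l + 1) * w \<le> real l' * w" using assms by (intro mult_right_mono) auto
        then show False using that by (auto simp: Z_def algebra_simps)
      next
        case 2
        then have "(real l' + 1) * w \<le> real l * w" using assms by (intro mult_right_mono) auto
        then show False using that by (auto simp: Z_def algebra_simps)
      qed
    qed
    moreover have "finite (Z u)" by (simp add: Z_def)
    ultimately show ?thesis using card_le_Suc0_iff_eq[of "Z u"] by auto
  qed
  have "{l. l < q \<and> (\<exists>u \<in> U. a + real l * w < u \<and> u < a + real l * w + w)} = (\<Union>u\<in>U. Z u)"
    by (auto simp: Z_def)
  then show ?thesis
    using card_UN_le[OF that, of Z] sum_mono[of U "\<lambda>u. card (Z u)" "\<lambda>_. 1"] \<open>\<And>u. card (Z u) \<le> 1\<close>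
    by simp
qed

text \<open>The bound for one step holds at every base function, so it still applies after the
  preceding steps have been added.\<close>

lemma telescope_steps:
  assumes "1 \<le> q" "cblip p \<kappa>" "\<And>l. l < q \<Longrightarrow> cblip p (h l)"
    and "\<And>l \<kappa>. l < q \<Longrightarrow> cblip p \<kappa> \<Longrightarrow> A (\<lambda>x. \<kappa> x + h l x / real q) \<le> A \<kappa> + c / real q"
  shows "A (\<lambda>x. \<kappa> x + (\<Sum>l<q. h l x / real q)) \<le> A \<kappa> + c"
proof -
  have *: "A (\<lambda>x. \<kappa> x + (\<Sum>l<j. h l x / real q)) \<le> A \<kappa> + real j * (c / real q)" if "j \<le> q" for j
    using that
  proof (induction j)
    case (Suc j)
    have "cblip p (\<lambda>x. \<kappa> x + (\<Sum>l<j. h l x / real q))"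
      using Suc.prems by (intro cblip_add assms(2) cblip_sum cblip_divide assms(3)) auto
    then have "A (\<lambda>x. (\<kappa> x + (\<Sum>l<j. h l x / real q)) + h j x / real q)
        \<le> A (\<lambda>x. \<kappa> x + (\<Sum>l<j. h l x / real q)) + c / real q"
      using Suc.prems by (intro assms(4)) auto
    moreover have "real (Suc j) * (c / real q) = real j * (c / real q) + c / real q"
      by (simp add: distrib_right del: times_divide_eq_right)
    moreover have "(\<lambda>x. \<kappa> x + (\<Sum>l<Suc j. h l x / real q))
        = (\<lambda>x. (\<kappa> x + (\<Sum>l<j. h l x / real q)) + h j x / real q)"
      by (simp add: add.assoc)
    ultimately show ?case using Suc by simp
  qed simp
  show ?thesis using *[of q] assms(1) by simp
qed

text \<open>Near-optimal perturbations \<open>\<psi>\<close> can be chosen only locally in \<open>x\<close>, and a continuous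
  interpolation between them is useless in the transition zones. Therefore \<open>q\<close> different gluings
  with disjoint transition zones are used in turn, each of them for one \<open>q\<close>-th of the step, so
  that the zones do not matter on average.\<close>

lemma maxslope_selection:
  assumes A: "nlaw p K A" and T: "nexp k T" and f: "cblip (p + k) f"
    and f0: "\<And>xs. length xs = p + k \<Longrightarrow> 0 \<le> f xs"
    and c: "\<And>\<psi> q. cblip (p + k) \<psi> \<Longrightarrow> 1 \<le> q \<Longrightarrow>
        A (\<lambda>x. T (\<lambda>z. \<psi> (x @ z) + f (x @ z) / real q)) \<le> A (\<lambda>x. T (\<lambda>z. \<psi> (x @ z))) + c / real q"
    and \<kappa>: "cblip p \<kappa>"
  shows "A (\<lambda>x. \<kappa> x + maxslope k T (\<lambda>z. f (x @ z))) \<le> A \<kappa> + c"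
proof (rule field_le_epsilon)
  fix e0 :: real assume "0 < e0"
  obtain C L where CL: "0 \<le> C" "0 \<le> L" "\<And>x. length x = p + k \<Longrightarrow> \<bar>f x\<bar> \<le> C"
    "\<And>x y. length x = p + k \<Longrightarrow> length y = p + k \<Longrightarrow> \<bar>f x - f y\<bar> \<le> L * ld x y"
    using cblipE[OF f] by metis
  define g where "g x = maxslope k T (\<lambda>z. f (x @ z))" for x
  note sec = cblip_section[OF f]
  have A': "nexp p A" using A by (rule nlaw_nexp)
  have g_bounds: "0 \<le> g x" "g x \<le> C" if "length x = p" for x
    using maxslope_bounds[OF T sec[OF that], of C] f0 CL(3) that by (auto simp: g_def abs_le_iff)
  have g_lip: "g x \<le> g y + L * ld x y" if "length x = p" "length y = p" for x y
    unfolding g_def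
  proof (rule maxslope_le_maxslope[OF T sec sec])
    fix z :: "real list" assume "length z = k"
    then show "f (x @ z) \<le> f (y @ z) + L * ld x y"
      using CL(4)[of "x @ z" "y @ z"] that by (simp add: abs_le_iff)
  qed (use that in auto)
  have g_cblip: "cblip p g"
    using cblip_maxslope[OF T f f0] by (simp add: g_def[abs_def])

  \<comment> \<open>The losses are \<open>2 * e\<close> from the selection, \<open>e\<close> from
    the transition zones and \<open>e * K\<close> from the tail; together they must not exceed
    \<open>e0\<close>.\<close>
  define e where "e = e0 / (4 + \<bar>K\<bar>)"
  have e: "0 < e" using \<open>0 < e0\<close> by (simp add: e_def add_pos_nonneg)
  \<comment> \<open>Outside this ball \<open>g \<le> C \<le> e * l1 x\<close>, so the tail is
    charged to the first moment \<open>K\<close>.\<close>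
  define R where "R = C / e"
  \<comment> \<open>The base point used at x is at distance at most \<open>2 * r\<close>. Replacing
    x by it costs \<open>L * (2 * r)\<close> once in \<open>g\<close> and once in the slope,
    together at most \<open>e\<close>.\<close>
  define r where "r = e / (4 * (L + 1))"
  have r: "0 < r" "4 * L * r \<le> e" using e CL(2) by (auto simp: r_def field_simps)
  obtain Y where Y: "finite Y" "\<And>y. y \<in> Y \<Longrightarrow> length y = p"
    "\<And>x. length x = p \<Longrightarrow> l1 x \<le> R \<Longrightarrow> \<exists>y\<in>Y. ld x y \<le> r"
    using finite_net[OF r(1)] by metis
  have "\<exists>q \<psi>. 1 \<le> q \<and> cblip k \<psi> \<and> g y \<le> slope T (\<lambda>z. f (y @ z)) q \<psi> + e" if "y \<in> Y" for y
    using maxslope_attained[OF T sec[OF Y(2)[OF that]] e] unfolding g_def by metis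
  then obtain qq \<psi>\<psi> where qq: "\<And>y. y \<in> Y \<Longrightarrow> 1 \<le> qq y" "\<And>y. y \<in> Y \<Longrightarrow> cblip k (\<psi>\<psi> y)"
    "\<And>y. y \<in> Y \<Longrightarrow> g y \<le> slope T (\<lambda>z. f (y @ z)) (qq y) (\<psi>\<psi> y) + e"
    by metis
  \<comment> \<open>The step number \<open>q\<close> has to be a multiple of every
    \<open>qq y\<close>, so that one step size serves all base points. It also has to be at least
    \<open>C * card Y / e\<close>, so that the at most \<open>card Y\<close> spoiled gluings cost no
    more than \<open>e\<close> on average; the factor \<open>s\<close> ensures the latter.\<close>
  define s where "s = nat \<lceil>C * real (card Y) / e\<rceil> + 1"
  define q where "q = (\<Prod>y\<in>Y. qq y) * s"
  have prod1: "1 \<le> (\<Prod>y\<in>Y'. qq y)" if "Y' \<subseteq> Y" for Y'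
    using that qq(1) by (intro prod_ge_1) auto
  have "C * real (card Y) / e \<le> real s" by (simp add: s_def) linarith
  also have "real s \<le> real q"
    unfolding q_def using mult_right_mono[OF prod1[OF order_refl], of s] by (simp flip: of_nat_mult)
  finally have q_large: "C * real (card Y) \<le> e * real q" using e by (simp add: field_simps)
  have q1: "1 \<le> q" unfolding q_def using prod1[OF order_refl] by (simp add: s_def)
  have "\<exists>\<psi>. cblip k \<psi> \<and> g y \<le> slope T (\<lambda>z. f (y @ z)) q \<psi> + e" if y: "y \<in> Y" for y
  proof -
    define s' where "s' = (\<Prod>y\<in>Y - {y}. qq y) * s"
    have "q = qq y * s'" unfolding q_def s'_def using prod.remove[OF Y(1) y, of qq] by simp
    moreover have "1 \<le> s'" unfolding s'_def using prod1[of "Y - {y}"] by (simp add: s_def)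
    ultimately show ?thesis
      using slope_refine[OF qq(1)[OF y] _ sec[OF Y(2)[OF y]] qq(2)[OF y], of s' T] qq(3)[OF y]
      by (metis add.commute add_left_mono order_trans)
  qed
  then obtain \<psi> where \<psi>: "\<And>y. y \<in> Y \<Longrightarrow> cblip k (\<psi> y)"
    "\<And>y. y \<in> Y \<Longrightarrow> g y \<le> slope T (\<lambda>z. f (y @ z)) q (\<psi> y) + e"
    by metis

  obtain ys where ys: "set ys = Y" using finite_list[OF Y(1)] by blast
  define ps where "ps = map (\<lambda>y. (y, \<psi> y)) ys"
  \<comment> \<open>All q thresholds \<open>r + l * w\<close>, with the zones above them, fit
    between \<open>r\<close> and \<open>2 * r\<close>.\<close>
  define w where "w = r / real q"
  have w: "0 < w" "real q * w = r" using r(1) q1 by (auto simp: w_def)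
  define \<gamma> where "\<gamma> l = glue (r + real l * w) w ps" for l
  define h where "h l x = slope T (\<lambda>z. f (x @ z)) q (\<gamma> l x)" for l x
  have \<gamma>: "cblip (p + k) (\<lambda>xs. \<gamma> l (take p xs) (drop p xs))" for l
    unfolding \<gamma>_def using w(1) by (rule cblip_glue) (auto simp: ps_def ys Y(2) \<psi>(1))
  have \<gamma>_sec: "cblip k (\<gamma> l x)" if "length x = p" for l x
    using cblip_section[OF \<gamma>[of l] that] that by simp
  have T\<gamma>: "cblip p (\<lambda>x. T (\<gamma> l x))" for l
    by (rule cblip_cong[OF cblip_partial[OF T \<gamma>[of l]]]) simp
  have T\<gamma>f: "cblip p (\<lambda>x. T (\<lambda>z. \<gamma> l x z + f (x @ z) / real q))" for l
    by (rule cblip_cong[OF cblip_partial[OF T cblip_add[OF \<gamma>[of l] cblip_divide[OF f, of "real q"]]]]) simp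
  have h: "cblip p (h l)" for l
    unfolding h_def slope_def by (intro cblip_cmult cblip_diff T\<gamma> T\<gamma>f)
  have h_step: "A (\<lambda>x. \<kappa> x + h l x / real q) \<le> A \<kappa> + c / real q" if \<kappa>: "cblip p \<kappa>" for l \<kappa>
  proof -
    \<comment> \<open>The hypothesis concerns functions of both blocks. Shifting the glued function
      by a function of x alone makes its integral under \<open>T\<close> equal to
      \<open>\<kappa> x\<close> and leaves its slope unchanged, by translation invariance; so the
      hypothesis becomes a statement about \<open>A\<close>.\<close>
    define \<psi>' where "\<psi>' xs = \<gamma> l (take p xs) (drop p xs) + (\<kappa> (take p xs) - T (\<gamma> l (take p xs)))" for xs
    have \<psi>': "cblip (p + k) \<psi>'"
      unfolding \<psi>'_def by (intro cblip_add \<gamma> cblip_take[OF cblip_diff[OF \<kappa> T\<gamma>]])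
    have a: "T (\<lambda>z. \<psi>' (x @ z)) = \<kappa> x" if "length x = p" for x
      using nexp_shift[OF T \<gamma>_sec[OF that], of l "\<kappa> x - T (\<gamma> l x)"] that by (simp add: \<psi>'_def)
    have b: "T (\<lambda>z. \<psi>' (x @ z) + f (x @ z) / real q) = \<kappa> x + h l x / real q" if "length x = p" for x
    proof -
      have "T (\<lambda>z. (\<gamma> l x z + f (x @ z) / real q) + (\<kappa> x - T (\<gamma> l x)))
          = T (\<lambda>z. \<gamma> l x z + f (x @ z) / real q) + (\<kappa> x - T (\<gamma> l x))"
        by (intro nexp_shift[OF T] cblip_add cblip_divide \<gamma>_sec sec that)
      moreover have "h l x / real q = T (\<lambda>z. \<gamma> l x z + f (x @ z) / real q) - T (\<gamma> l x)"
        using q1 by (simp add: h_def slope_def)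
      ultimately show ?thesis using that by (simp add: \<psi>'_def algebra_simps)
    qed
    have "A (\<lambda>x. \<kappa> x + h l x / real q) = A (\<lambda>x. T (\<lambda>z. \<psi>' (x @ z) + f (x @ z) / real q))"
      by (rule nexp_cong[OF A']) (use b in \<open>auto intro!: cblip_add \<kappa> cblip_divide h\<close>)
    also have "\<dots> \<le> A (\<lambda>x. T (\<lambda>z. \<psi>' (x @ z))) + c / real q" by (rule c[OF \<psi>' q1])
    also have "A (\<lambda>x. T (\<lambda>z. \<psi>' (x @ z))) = A \<kappa>"
      by (rule nexp_cong[OF A', symmetric]) (use a \<kappa> in auto)
    finally show ?thesis .
  qed
  have h_nonneg: "0 \<le> h l x" if "length x = p" for l x
    unfolding h_def using that f0 by (intro slope_nonneg[OF T sec \<gamma>_sec]) auto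

  have h_large: "g x \<le> h l x + 2 * e"
    if x: "length x = p" "l1 x \<le> R" and l: "l < q"
      and nz: "\<not> (\<exists>u\<in>ld x ` Y. r + real l * w < u \<and> u < r + real l * w + w)" for x l
  proof -
    have "\<exists>(y, \<psi>') \<in> set ps. ld x y \<le> r + real l * w \<and> \<gamma> l x = \<psi>'"
      unfolding \<gamma>_def
    proof (rule glue_eq[OF w(1)])
      obtain y where "y \<in> Y" "ld x y \<le> r" using Y(3)[OF x] by blast
      then show "\<exists>(y, \<psi>') \<in> set ps. ld x y \<le> r + real l * w"
        using mult_nonneg_nonneg[OF of_nat_0_le_iff[of l] less_imp_le[OF w(1)]]
        by (intro bexI[of _ "(y, \<psi> y)"]) (auto simp: ps_def ys simp del: mult_nonneg_nonneg)
    qed (use nz in \<open>force simp: ps_def ys not_less\<close>)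
    then obtain y where y: "y \<in> Y" "ld x y \<le> r + real l * w" "\<gamma> l x = \<psi> y"
      by (auto simp: ps_def ys)
    have "real l * w \<le> real q * w" using l w(1) by (intro mult_right_mono) auto
    then have "ld x y \<le> 2 * r" using y(2) w(2) by linarith
    then have Ld: "L * ld x y \<le> L * (2 * r)" using CL(2) by (intro mult_left_mono) auto
    have len: "length y = p" using Y(2) y(1) by blast
    have "slope T (\<lambda>z. f (y @ z)) q (\<psi> y) \<le> slope T (\<lambda>z. f (x @ z)) q (\<psi> y) + L * ld x y"
    proof (rule slope_le_slope[OF T sec[OF len] sec[OF x(1)] \<psi>(1)[OF y(1)] q1])
      fix z :: "real list" assume "length z = k"
      then show "f (y @ z) \<le> f (x @ z) + L * ld x y"
        using CL(4)[of "x @ z" "y @ z"] x(1) len by (simp add: abs_le_iff)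
    qed
    then show ?thesis
      using g_lip[OF x(1) len] \<psi>(2)[OF y(1)] Ld r(2) y(3) by (simp add: h_def)
  qed
  have avg: "g x \<le> (\<Sum>l<q. h l x / real q) + 3 * e + e * l1 x" if x: "length x = p" for x
  proof (cases "l1 x \<le> R")
    case False
    then have "C \<le> e * l1 x" using e by (simp add: R_def field_simps)
    moreover have "0 \<le> (\<Sum>l<q. h l x / real q)" using h_nonneg[OF x] by (intro sum_nonneg) auto
    ultimately show ?thesis using g_bounds[OF x] e by simp
  next
    case True
    define Z where "Z = {l. l < q \<and> (\<exists>u\<in>ld x ` Y. r + real l * w < u \<and> u < r + real l * w + w)}"
    have "card Z \<le> card (ld x ` Y)"
      unfolding Z_def by (rule card_transition_zones) (use w Y in auto)
    also have "\<dots> \<le> card Y" using Y(1) by (rule card_image_le)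
    finally have cZ: "card Z \<le> card Y" .
    have "real q * g x = (\<Sum>l<q. g x)" by simp
    also have "\<dots> \<le> (\<Sum>l<q. h l x + 2 * e + (if l \<in> Z then C else 0))"
    proof (rule sum_mono)
      fix l assume "l \<in> {..<q}"
      then show "g x \<le> h l x + 2 * e + (if l \<in> Z then C else 0)"
        using h_large[OF x True, of l] h_nonneg[OF x, of l] g_bounds[OF x] e
        by (cases "l \<in> Z") (auto simp: Z_def)
    qed
    also have "\<dots> = (\<Sum>l<q. h l x) + real q * (2 * e) + real (card Z) * C"
    proof -
      have "{..<q} \<inter> Z = Z" by (auto simp: Z_def)
      then show ?thesis by (simp add: sum.distrib flip: sum.inter_restrict)
    qed
    also have "real (card Z) * C \<le> e * real q"
      using mult_right_mono[of "real (card Z)" "real (card Y)" C] cZ CL(1) q_large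
      by (simp add: mult.commute)
    finally have "real q * g x \<le> real q * ((\<Sum>l<q. h l x / real q) + 3 * e)"
      using q1 by (simp add: sum_divide_distrib[symmetric] algebra_simps)
    then have "g x \<le> (\<Sum>l<q. h l x / real q) + 3 * e" using q1 by simp
    then show ?thesis using e by (simp add: add_increasing2)
  qed
  have "A (\<lambda>x. \<kappa> x + g x) \<le> A (\<lambda>x. \<kappa> x + (\<Sum>l<q. h l x / real q)) + 3 * e + e * K"
    using e avg by (intro nlawD[OF A] cblip_add \<kappa> g_cblip cblip_sum cblip_divide h) (auto simp: algebra_simps)
  moreover have "A (\<lambda>x. \<kappa> x + (\<Sum>l<q. h l x / real q)) \<le> A \<kappa> + c"
    by (intro telescope_steps[where A = A and p = p and h = h] q1 \<kappa> h h_step)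
  moreover have "3 * e + e * K \<le> e0"
  proof -
    have "3 * e + e * K = e * (3 + K)" by (simp add: algebra_simps)
    also have "\<dots> \<le> e * (4 + \<bar>K\<bar>)" using e by (intro mult_left_mono) auto
    also have "\<dots> = e0" by (simp add: e_def)
    finally show ?thesis .
  qed
  ultimately show "A (\<lambda>x. \<kappa> x + maxslope k T (\<lambda>z. f (x @ z))) \<le> A \<kappa> + c + e0"
    by (simp add: g_def)
qed

text \<open>If c bounds the cost of the direction g under A at every base function, then c also
  bounds the effect on G of a perturbation that depends on the marginal only. Two functions related
  by an inequality are compared, rather than a function and its exact perturbation, because iterated
  integrals of the tail are known only up to an inequality.\<close>

definition marg_dom :: "(real list \<Rightarrow> real list) \<Rightarrow> nat \<Rightarrow> ((real list \<Rightarrow> real) \<Rightarrow> real) \<Rightarrow>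
    nat \<Rightarrow> ((real list \<Rightarrow> real) \<Rightarrow> real) \<Rightarrow> bool" where
  "marg_dom pr p A P G \<longleftrightarrow> (\<forall>u u' g c. cblip P u \<longrightarrow> cblip P u' \<longrightarrow> cblip p g \<longrightarrow>
     (\<forall>x. length x = P \<longrightarrow> u x \<le> u' x + g (pr x)) \<longrightarrow>
     (\<forall>\<kappa>. cblip p \<kappa> \<longrightarrow> A (\<lambda>x. \<kappa> x + g x) \<le> A \<kappa> + c) \<longrightarrow> G u \<le> G u' + c)"

fun blockmap :: "(real list \<Rightarrow> real list) \<Rightarrow> nat \<Rightarrow> nat \<Rightarrow> real list \<Rightarrow> real list" where
  "blockmap pr P 0 zs = []"
| "blockmap pr P (Suc m) zs = pr (take P zs) @ blockmap pr P m (drop P zs)"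

text \<open>A dominating sublinear expectation need not have independent increments. So the moments of
  a marginal under the joint chain cannot be computed step by step from such an expectation; they
  are controlled through perturbations of the marginal chain as a whole.\<close>

theorem iter_marg_dom:
  assumes pr: "\<And>x. length x = P \<Longrightarrow> length (pr x) = p"
    and "list_all2 (\<lambda>A G. (\<exists>K. nlaw p K A) \<and> nexp P G \<and> marg_dom pr p A P G) As Gs"
    and "cblip (length Gs * P) \<Phi>" "cblip (length Gs * P) \<Psi>" "cblip (length As * p) f"
    and "\<And>xs. length xs = length As * p \<Longrightarrow> 0 \<le> f xs"
    and "\<And>zs. length zs = length Gs * P \<Longrightarrow> \<Phi> zs \<le> \<Psi> zs + f (blockmap pr P (length Gs) zs)"
    and "\<And>\<psi> q. cblip (length As * p) \<psi> \<Longrightarrow> 1 \<le> q \<Longrightarrow>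
      iter As (\<lambda>xs. \<psi> xs + f xs / real q) \<le> iter As \<psi> + c / real q"
  shows "iter Gs \<Phi> \<le> iter Gs \<Psi> + c"
  using assms(2-)
proof (induction As Gs arbitrary: \<Phi> \<Psi> f c rule: list_all2_induct)
  case Nil
  show ?case using Nil.prems(5)[of "[]"] Nil.prems(6)[of "\<lambda>_. 0" 1] by simp
next
  case (Cons A As G Gs)
  let ?k = "length As * p"
  have len: "length As = length Gs" using Cons.hyps(2) by (rule list_all2_lengthD)
  obtain K where A: "nlaw p K A" and G: "nexp P G" "marg_dom pr p A P G" using Cons.hyps by blast
  have "\<forall>A\<in>set As. nexp p A" "\<forall>G\<in>set Gs. nexp P G"
    using Cons.hyps(2) by (induction rule: list_all2_induct) (auto dest: nlaw_nexp)
  then have T: "nexp ?k (iter As)" and U: "nexp (length Gs * P) (iter Gs)"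
    by (auto intro: iter_nexp)
  have c: "cblip (P + length Gs * P) \<Phi>" "cblip (P + length Gs * P) \<Psi>" "cblip (p + ?k) f"
    using Cons.prems by auto
  have f0: "0 \<le> f xs" if "length xs = p + ?k" for xs using Cons.prems(4) that by simp
  \<comment> \<open>For a frozen first block the induction hypothesis is applied with the least
    constant of the marginal tail. The error is then a function of \<open>pr x\<close> alone, which
    serves as the direction for the first law.\<close>
  have "iter Gs (\<lambda>zs. \<Phi> (x @ zs)) \<le> iter Gs (\<lambda>zs. \<Psi> (x @ zs)) + maxslope ?k (iter As) (\<lambda>z. f (pr x @ z))"
    if x: "length x = P" for x
  proof (rule Cons.IH)
    fix \<psi> and q :: nat assume \<psi>: "cblip ?k \<psi>" and q: "1 \<le> q"
    have "slope (iter As) (\<lambda>z. f (pr x @ z)) q \<psi> \<le> maxslope ?k (iter As) (\<lambda>z. f (pr x @ z))"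
      by (rule slope_le_maxslope[OF T cblip_section[OF c(3) pr[OF x]] \<psi> q])
    then show "iter As (\<lambda>xs. \<psi> xs + f (pr x @ xs) / real q)
        \<le> iter As \<psi> + maxslope ?k (iter As) (\<lambda>z. f (pr x @ z)) / real q"
      using q by (simp add: slope_def field_simps)
  next
    fix zs :: "real list" assume "length zs = length Gs * P"
    then show "\<Phi> (x @ zs) \<le> \<Psi> (x @ zs) + f (pr x @ blockmap pr P (length Gs) zs)"
      using Cons.prems(5)[of "x @ zs"] x by simp
  qed (use pr[OF x] f0 cblip_section[OF c(1) x] cblip_section[OF c(2) x]
      cblip_section[OF c(3) pr[OF x]] in auto)
  \<comment> \<open>Under the marginal law \<open>A\<close> this new direction costs no more than
    \<open>f\<close> does under the whole marginal chain.\<close>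
  moreover have "A (\<lambda>x. \<kappa> x + maxslope ?k (iter As) (\<lambda>z. f (x @ z))) \<le> A \<kappa> + c" if "cblip p \<kappa>" for \<kappa>
    using Cons.prems(6) that by (intro maxslope_selection[OF A T c(3) f0]) auto
  ultimately show ?case
    using G(2) cblip_partial[OF U c(1)] cblip_partial[OF U c(2)] cblip_maxslope[OF T c(3) f0]
    unfolding marg_dom_def iter.simps by blast
qed

section \<open>Processes with independent increments\<close>

lemma l1_zero [simp]: "l1 (replicate n 0) = 0"
  by (induction n) auto

definition vadd :: "real list \<Rightarrow> real list \<Rightarrow> real list" where
  "vadd xs ys = map2 (+) xs ys"

lemma length_vadd [simp]: "length (vadd x y) = min (length x) (length y)"
  by (simp add: vadd_def)

lemma vadd_simps [simp]: "vadd [] y = []" "vadd x [] = []" "vadd (a # x) (b # y) = (a + b) # vadd x y"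
  by (simp_all add: vadd_def)

lemma vadd_take: "take k (vadd x y) = vadd (take k x) (take k y)"
  by (simp add: vadd_def take_map take_zip)

lemma vadd_drop: "drop k (vadd x y) = vadd (drop k x) (drop k y)"
  by (simp add: vadd_def drop_map drop_zip)

lemma vadd_assoc: "vadd (vadd x y) z = vadd x (vadd y z)"
proof (induction x arbitrary: y z)
  case (Cons a x) then show ?case by (cases y; cases z) auto
qed simp

lemma vadd_zero [simp]:
  "length x = n \<Longrightarrow> vadd x (replicate n 0) = x" "length x = n \<Longrightarrow> vadd (replicate n 0) x = x"
  by (induction x arbitrary: n) auto

lemma vsub_zero [simp]: "length x = n \<Longrightarrow> vsub x (replicate n 0) = x"
  by (induction x arbitrary: n) auto

lemma vadd_vsub: "length x = length y \<Longrightarrow> vadd x (vsub y x) = y"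
  by (induction x y rule: list_induct2) auto

lemma vsub_vadd: "length x = length y \<Longrightarrow> vsub (vadd x y) x = y"
  by (induction x y rule: list_induct2) auto

lemma ld_vadd_self: "length x = length y \<Longrightarrow> ld (vadd x y) x = l1 y"
  by (simp add: vsub_vadd)

lemma ld_vadd:
  assumes "length x = n" "length y = n" "length x' = n" "length y' = n"
  shows "ld (vadd x y) (vadd x' y') \<le> ld x x' + ld y y'"
proof -
  have "length x = length y" "length y = length x'" "length x' = length y'" using assms by auto
  then show ?thesis by (induction x y x' y' rule: list_induct4) auto
qed

lemma ld_vsub:
  assumes "length x = n" "length y = n" "length x' = n" "length y' = n"
  shows "ld (vsub x y) (vsub x' y') \<le> ld x x' + ld y y'"
proof -
  have "length x = length y" "length y = length x'" "length x' = length y'" using assms by auto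
  then show ?thesis by (induction x y x' y' rule: list_induct4) auto
qed

text \<open>Turns a vector of increments, in blocks of length p, back into the path value after j
  steps.\<close>

fun bsum :: "nat \<Rightarrow> nat \<Rightarrow> real list \<Rightarrow> real list" where
  "bsum p 0 zs = replicate p 0"
| "bsum p (Suc j) zs = vadd (take p zs) (bsum p j (drop p zs))"

lemma length_bsum [simp]: "j * p \<le> length zs \<Longrightarrow> length (bsum p j zs) = p"
  by (induction j arbitrary: zs) auto

lemma bsum_append:
  "length xs = i * p \<Longrightarrow> j * p \<le> length ys \<Longrightarrow> bsum p (i + j) (xs @ ys) = vadd (bsum p i xs) (bsum p j ys)"
proof (induction i arbitrary: xs)
  case (Suc i)
  then have "bsum p (i + j) (drop p xs @ ys) = vadd (bsum p i (drop p xs)) (bsum p j ys)"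
    by (intro Suc.IH) auto
  then show ?case using Suc.prems by (simp add: vadd_assoc)
qed simp

lemma bsum_append1: "i * p \<le> length xs \<Longrightarrow> bsum p i (xs @ ys) = bsum p i xs"
  by (induction i arbitrary: xs) (auto simp: not_le)

lemma ld_bsum:
  "length xs = length ys \<Longrightarrow> j * p \<le> length xs \<Longrightarrow> ld (bsum p j xs) (bsum p j ys) \<le> ld xs ys"
proof (induction j arbitrary: xs ys)
  case (Suc j)
  have "ld (bsum p (Suc j) xs) (bsum p (Suc j) ys)
      \<le> ld (take p xs) (take p ys) + ld (bsum p j (drop p xs)) (bsum p j (drop p ys))"
    unfolding bsum.simps using Suc.prems by (intro ld_vadd[of _ p]) auto
  also have "\<dots> \<le> ld (take p xs) (take p ys) + ld (drop p xs) (drop p ys)"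
    using Suc.prems by (intro add_left_mono Suc.IH) auto
  also have "\<dots> = ld xs ys" using ld_take_drop[OF Suc.prems(1), of p] by simp
  finally show ?case .
qed simp

lemma cblip_bsum: "cblip p \<phi> \<Longrightarrow> j * p \<le> n \<Longrightarrow> cblip n (\<lambda>zs. \<phi> (bsum p j zs))"
  by (rule cblip_comp[where K = 1]) (auto intro: ld_bsum)

lemma rvec_length: "rvec H n Y \<Longrightarrow> length (Y w) = n"
  by (simp add: rvec_def)

lemma rvec_append:
  assumes "rvec H m Y" "rvec H n Z" shows "rvec H (m + n) (\<lambda>w. Y w @ Z w)"
  unfolding rvec_def
proof (intro conjI allI impI)
  fix i assume "i < m + n"
  then show "(\<lambda>w. (Y w @ Z w) ! i) \<in> H"
    using assms by (cases "i < m") (auto simp: rvec_def nth_append)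
qed (use assms in \<open>auto simp: rvec_def\<close>)

lemma rvec_fdv:
  "(\<And>t. t \<in> set ts \<Longrightarrow> rvec H d (X t)) \<Longrightarrow> rvec H (length ts * d) (fdv X ts)"
proof (induction ts)
  case Nil show ?case by (simp add: rvec_def fdv_def)
next
  case (Cons t ts)
  then have "rvec H (d + length ts * d) (\<lambda>w. X t w @ fdv X ts w)" by (intro rvec_append) auto
  then show ?case by (simp add: fdv_def)
qed

lemma lin_space_add: "lin_space H \<Longrightarrow> f \<in> H \<Longrightarrow> g \<in> H \<Longrightarrow> (\<lambda>w. f w + g w) \<in> H"
  by (simp add: lin_space_def)

lemma lin_space_cmult: "lin_space H \<Longrightarrow> f \<in> H \<Longrightarrow> (\<lambda>w. c * f w) \<in> H"
  by (simp add: lin_space_def)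

lemma lin_space_diff: "lin_space H \<Longrightarrow> f \<in> H \<Longrightarrow> g \<in> H \<Longrightarrow> (\<lambda>w. f w - g w) \<in> H"
  using lin_space_add[of H f "\<lambda>w. (-1) * g w"] lin_space_cmult[of H g "-1"] by simp

lemma lin_space_comp: "lin_space H \<Longrightarrow> rvec H n Y \<Longrightarrow> cblip n \<phi> \<Longrightarrow> (\<lambda>w. \<phi> (Y w)) \<in> H"
  unfolding lin_space_def by blast

lemma lin_space_const: "lin_space H \<Longrightarrow> (\<lambda>_. c) \<in> H"
  using lin_space_comp[of H 0 "\<lambda>_. []" "\<lambda>_. c"] by (simp add: rvec_def)

lemma lin_space_sum_list:
  "lin_space H \<Longrightarrow> (\<And>t. t \<in> set ts \<Longrightarrow> f t \<in> H) \<Longrightarrow> (\<lambda>w. \<Sum>t\<leftarrow>ts. f t w) \<in> H"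
  by (induction ts) (auto intro: lin_space_const lin_space_add)

section \<open>Moments and continuity from a dominating sublinear expectation\<close>

locale incr_process =
  fixes H :: "('w \<Rightarrow> real) set" and E Et :: "('w \<Rightarrow> real) \<Rightarrow> real" and d :: nat
    and X :: "real \<Rightarrow> 'w \<Rightarrow> real list"
  assumes lin: "lin_space H" and E: "nl_expectation H E" and Et: "sl_expectation H Et"
    and dom: "dominates H Et E" and proc: "process H d X" and ind: "indep_incr E d X"
    and norm_mem: "0 \<le> s \<Longrightarrow> 0 \<le> t \<Longrightarrow> (\<lambda>w. lnorm (vsub (X s w) (X t w))) \<in> H"
    and norm_cont: "0 \<le> t \<Longrightarrow>
      ((\<lambda>s. Et (\<lambda>w. lnorm (vsub (X s w) (X t w)))) \<longlongrightarrow> 0) (at t within {0..})"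
begin

definition nm :: "real \<Rightarrow> real \<Rightarrow> real" where
  "nm s t = Et (\<lambda>w. lnorm (vsub (X s w) (X t w)))"

definition inc :: "real \<Rightarrow> real \<Rightarrow> (real list \<Rightarrow> real) \<Rightarrow> real" where
  "inc s t \<phi> = E (\<lambda>w. \<phi> (vsub (X t w) (X s w)))"

lemma rvec_X: "0 \<le> t \<Longrightarrow> rvec H d (X t)"
  using proc by (simp add: process_def)

lemma length_X [simp]: "0 \<le> t \<Longrightarrow> length (X t w) = d"
  using rvec_X by (rule rvec_length)

lemma X_0 [simp]: "X 0 w = replicate d 0"
  using proc by (simp add: process_def)

lemma rvec_vsub: "0 \<le> s \<Longrightarrow> 0 \<le> t \<Longrightarrow> rvec H d (\<lambda>w. vsub (X t w) (X s w))"
  using rvec_X[of s] rvec_X[of t] unfolding rvec_def by (auto intro!: lin_space_diff[OF lin])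

lemma E_const: "E (\<lambda>_. c) = c"
  using E by (simp add: nl_expectation_def)

lemma Et_mono: "f \<in> H \<Longrightarrow> g \<in> H \<Longrightarrow> (\<And>w. f w \<le> g w) \<Longrightarrow> Et f \<le> Et g"
  using Et by (simp add: sl_expectation_def nl_expectation_def)

lemma Et_add: "f \<in> H \<Longrightarrow> g \<in> H \<Longrightarrow> Et (\<lambda>w. f w + g w) \<le> Et f + Et g"
  using Et by (simp add: sl_expectation_def)

lemma Et_cmult: "f \<in> H \<Longrightarrow> 0 \<le> c \<Longrightarrow> Et (\<lambda>w. c * f w) = c * Et f"
  using Et by (simp add: sl_expectation_def)

lemma Et_const: "Et (\<lambda>_. c) = c"
  using Et by (simp add: sl_expectation_def nl_expectation_def)

lemma Et_sum_list:
  "(\<And>t. t \<in> set ts \<Longrightarrow> f t \<in> H) \<Longrightarrow> Et (\<lambda>w. \<Sum>t\<leftarrow>ts. f t w) \<le> (\<Sum>t\<leftarrow>ts. Et (f t))"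
proof (induction ts)
  case (Cons t ts)
  have "Et (\<lambda>w. f t w + (\<Sum>t\<leftarrow>ts. f t w)) \<le> Et (f t) + Et (\<lambda>w. \<Sum>t\<leftarrow>ts. f t w)"
    using Cons.prems by (intro Et_add lin_space_sum_list[OF lin]) auto
  then show ?case using Cons by force
qed (simp add: Et_const)

text \<open>A nonlinear expectation is only monotone and constant preserving. That it respects added
  constants and varies little under perturbations of small moment comes from domination:
  \<open>E f - E g\<close> is at most \<open>Et (f - g)\<close>, to which monotonicity and
  sublinearity of \<open>Et\<close> apply.\<close>

lemma E_le:
  assumes "f \<in> H" "g \<in> H" "h \<in> H" "0 \<le> b" "\<And>w. f w \<le> g w + a + b * h w"
  shows "E f \<le> E g + a + b * Et h"
proof -
  have "E f - E g \<le> Et (\<lambda>w. f w - g w)" using dom assms(1,2) by (simp add: dominates_def)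
  also have "\<dots> \<le> Et (\<lambda>w. a + b * h w)"
    using assms(5) by (intro Et_mono lin_space_add[OF lin] lin_space_diff[OF lin] lin_space_const[OF lin]
        lin_space_cmult[OF lin] assms(1-3)) (simp add: algebra_simps)
  also have "\<dots> \<le> Et (\<lambda>_. a) + Et (\<lambda>w. b * h w)"
    by (intro Et_add lin_space_const[OF lin] lin_space_cmult[OF lin] assms(3))
  also have "\<dots> = a + b * Et h" using assms(3,4) by (simp add: Et_const Et_cmult)
  finally show ?thesis by simp
qed

lemma nm_nonneg: "0 \<le> s \<Longrightarrow> 0 \<le> t \<Longrightarrow> 0 \<le> nm s t"
  using Et_mono[OF lin_space_const[OF lin, of 0] norm_mem[of s t]] by (simp add: nm_def Et_const)

lemma nm_sym: "nm s t = nm t s"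
proof -
  have "lnorm (vsub x y) = lnorm (vsub y x)" for x y
    unfolding lnorm_def
  proof (induction x arbitrary: y)
    case (Cons a x)
    then show ?case by (cases y) (auto simp: power2_commute)
  qed simp
  then show ?thesis by (simp add: nm_def)
qed

lemma nm_self: "0 \<le> t \<Longrightarrow> nm t t = 0"
proof -
  assume "0 \<le> t"
  have "lnorm (vsub x x) = 0" for x
    using lnorm_le_l1[of "vsub x x"] lnorm_nonneg[of "vsub x x"] by simp
  then show ?thesis by (simp add: nm_def Et_const)
qed

lemma ld_X_le: "0 \<le> s \<Longrightarrow> 0 \<le> t \<Longrightarrow> ld (X s w) (X t w) \<le> real d * lnorm (vsub (X s w) (X t w))"
  using l1_le_lnorm[of "vsub (X s w) (X t w)"] by simp

text \<open>Domination supplies the moment constant; the factor d converts the Euclidean norm of the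
  continuity assumption into the 1-norm used in \<open>nlaw\<close>.\<close>

lemma nlaw_inc: "0 \<le> s \<Longrightarrow> 0 \<le> t \<Longrightarrow> nlaw d (real d * nm s t) (inc s t)"
  unfolding nlaw_def
proof (intro conjI allI impI)
  fix c show "inc s t (\<lambda>_. c) = c" by (simp add: inc_def E_const)
next
  fix \<phi> \<psi> :: "real list \<Rightarrow> real" and a b :: real
  assume st: "0 \<le> s" "0 \<le> t" and b: "0 \<le> b" and c: "cblip d \<phi>" "cblip d \<psi>"
    and le: "\<forall>x. length x = d \<longrightarrow> \<phi> x \<le> \<psi> x + a + b * l1 x"
  have "inc s t \<phi> \<le> inc s t \<psi> + a + (b * real d) * nm t s"
    unfolding inc_def nm_def
  proof (rule E_le[OF lin_space_comp[OF lin rvec_vsub c(1)] lin_space_comp[OF lin rvec_vsub c(2)] norm_mem])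
    fix w
    have "\<phi> (vsub (X t w) (X s w)) \<le> \<psi> (vsub (X t w) (X s w)) + a + b * ld (X t w) (X s w)"
      using le st by simp
    moreover have "b * ld (X t w) (X s w) \<le> b * (real d * lnorm (vsub (X t w) (X s w)))"
      using ld_X_le[of t s w] st b by (intro mult_left_mono) auto
    ultimately show "\<phi> (vsub (X t w) (X s w)) \<le> \<psi> (vsub (X t w) (X s w)) + a
        + b * real d * lnorm (vsub (X t w) (X s w))" by (simp add: mult.assoc)
  qed (use st b in auto)
  then show "inc s t \<phi> \<le> inc s t \<psi> + a + b * (real d * nm s t)" by (simp add: nm_sym mult.assoc)
qed

lemma slaw_inc:
  assumes "sl_expectation H E" "0 \<le> s" "0 \<le> t"
  shows "slaw d (inc s t)"
  using assms lin_space_comp[OF lin rvec_vsub[of s t]]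
  by (simp add: slaw_def inc_def sl_expectation_def)

lemma nm_tendsto:
  assumes "0 \<le> t" "\<And>n. 0 \<le> s n" "(s \<longlongrightarrow> t) F"
  shows "((\<lambda>n. nm (s n) t) \<longlongrightarrow> 0) F"
proof -
  \<comment> \<open>The limit in the assumption excludes the point t itself.
    \<open>nm t t = 0\<close> closes this gap, so that the approximating times may coincide with t,
    as rounded times do.\<close>
  have "continuous (at t within {0..}) (\<lambda>s. nm s t)"
    using norm_cont[OF assms(1)] by (simp add: continuous_within nm_self[OF assms(1)] flip: nm_def)
  then have "((\<lambda>n. nm (s n) t) \<longlongrightarrow> nm t t) F"
    by (rule continuous_within_tendsto_compose) (use assms(2,3) in simp_all)
  then show ?thesis using nm_self[OF assms(1)] by simp
qed

text \<open>The triangle inequality is taken in the 1-norm; the factor d is the price of returning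
  to the Euclidean norm.\<close>

lemma nm_le: "0 \<le> r \<Longrightarrow> 0 \<le> s \<Longrightarrow> 0 \<le> t \<Longrightarrow> nm r t \<le> real d * (nm r s + nm s t)"
proof -
  assume a: "0 \<le> r" "0 \<le> s" "0 \<le> t"
  let ?n = "\<lambda>s t w. lnorm (vsub (X s w) (X t w))"
  have "nm r t \<le> Et (\<lambda>w. real d * (?n r s w + ?n s t w))"
    unfolding nm_def
  proof (rule Et_mono)
    fix w
    have "?n r t w \<le> ld (X r w) (X t w)" by (rule lnorm_le_l1)
    also have "\<dots> \<le> ld (X r w) (X s w) + ld (X s w) (X t w)" using a by (intro ld_triangle) auto
    also have "\<dots> \<le> real d * (?n r s w + ?n s t w)"
      using ld_X_le[of r s w] ld_X_le[of s t w] a by (simp add: distrib_left)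
    finally show "?n r t w \<le> real d * (?n r s w + ?n s t w)" .
  qed (use a in \<open>auto intro!: lin_space_cmult[OF lin] lin_space_add[OF lin] norm_mem\<close>)
  also have "\<dots> = real d * Et (\<lambda>w. ?n r s w + ?n s t w)"
    using a by (intro Et_cmult lin_space_add[OF lin] norm_mem) auto
  also have "\<dots> \<le> real d * (nm r s + nm s t)"
    unfolding nm_def using a by (intro mult_left_mono Et_add norm_mem) auto
  finally show ?thesis .
qed

lemma nm_tendsto2:
  assumes "0 \<le> t" "\<And>n. 0 \<le> r n" "\<And>n. 0 \<le> s n" "(r \<longlongrightarrow> t) F" "(s \<longlongrightarrow> t) F"
  shows "((\<lambda>n. nm (r n) (s n)) \<longlongrightarrow> 0) F"
proof (rule tendsto_sandwich[OF always_eventually always_eventually tendsto_const])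
  show "((\<lambda>n. real d * (nm (r n) t + nm (s n) t)) \<longlongrightarrow> 0) F"
    by (intro tendsto_mult_right_zero tendsto_add_zero nm_tendsto assms)
qed (use nm_nonneg[OF assms(2,3)] nm_le[OF assms(2,1,3)] nm_sym in auto)

text \<open>Writing the increments as a path vector minus its shift shows them as a Lipschitz
  function of path values, and \<open>indep_incr\<close> states independence relative to path
  values.\<close>

definition incs :: "real \<Rightarrow> nat \<Rightarrow> 'w \<Rightarrow> real list" where
  "incs \<delta> m w = vsub (fdv X (map (\<lambda>i. real i * \<delta>) [1..<Suc m]) w) (fdv X (map (\<lambda>i. real i * \<delta>) [0..<m]) w)"

definition incl :: "real \<Rightarrow> nat \<Rightarrow> ((real list \<Rightarrow> real) \<Rightarrow> real) list" where
  "incl \<delta> m = map (\<lambda>i. inc (real i * \<delta>) (real (Suc i) * \<delta>)) [0..<m]"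

lemma length_fdv: "(\<And>t. t \<in> set ts \<Longrightarrow> 0 \<le> t) \<Longrightarrow> length (fdv X ts w) = length ts * d"
  by (rule rvec_length[OF rvec_fdv[OF rvec_X]])

lemma fdv_append: "fdv X (ts @ us) w = fdv X ts w @ fdv X us w"
  by (simp add: fdv_def)

lemma fdv_single: "fdv X [t] w = X t w"
  by (simp add: fdv_def)

lemma length_grid: "0 \<le> \<delta> \<Longrightarrow> length (fdv X (map (\<lambda>i. real i * \<delta>) [a..<b]) w) = (b - a) * d"
  by (subst length_fdv) auto

lemma incs_0 [simp]: "incs \<delta> 0 w = []"
  by (simp add: incs_def fdv_def)

lemma length_incs: "0 \<le> \<delta> \<Longrightarrow> length (incs \<delta> m w) = m * d"
  unfolding incs_def by (simp add: length_grid del: upt_Suc)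

lemma incs_Suc:
  assumes "0 \<le> \<delta>"
  shows "incs \<delta> (Suc m) w = incs \<delta> m w @ vsub (X (real (Suc m) * \<delta>) w) (X (real m * \<delta>) w)"
proof -
  have "[1..<Suc (Suc m)] = [1..<Suc m] @ [Suc m]" "[0..<Suc m] = [0..<m] @ [m]" by auto
  then have "incs \<delta> (Suc m) w = vsub
      (fdv X (map (\<lambda>i. real i * \<delta>) [1..<Suc m]) w @ X (real (Suc m) * \<delta>) w)
      (fdv X (map (\<lambda>i. real i * \<delta>) [0..<m]) w @ X (real m * \<delta>) w)"
    unfolding incs_def by (simp only: map_append fdv_append list.map fdv_single)
  also have "\<dots> = incs \<delta> m w @ vsub (X (real (Suc m) * \<delta>) w) (X (real m * \<delta>) w)"
    unfolding incs_def using assms by (intro vsub_append) (simp add: length_grid del: upt_Suc)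
  finally show ?thesis .
qed

lemma rvec_incs:
  assumes "0 \<le> \<delta>" shows "rvec H (m * d) (incs \<delta> m)"
proof (induction m)
  case 0 show ?case by (simp add: rvec_def)
next
  case (Suc m)
  have "rvec H (m * d + d) (incs \<delta> (Suc m))"
    unfolding incs_Suc[OF assms, abs_def] using assms by (intro rvec_append Suc rvec_vsub) auto
  then show ?case by (simp add: add.commute)
qed

lemma bsum_incs:
  assumes "0 \<le> \<delta>" "j \<le> m"
  shows "bsum d j (incs \<delta> m w) = X (real j * \<delta>) w"
proof -
  have "bsum d m (incs \<delta> m w) = X (real m * \<delta>) w" for m
  proof (induction m)
    case (Suc m)
    let ?x = "X (real (Suc m) * \<delta>) w" and ?y = "X (real m * \<delta>) w"
    have "0 \<le> real m * \<delta>" "0 \<le> real (Suc m) * \<delta>" using assms by auto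
    then have len: "length ?x = d" "length ?y = d" by (auto simp del: of_nat_Suc)
    have "bsum d (m + 1) (incs \<delta> m w @ vsub ?x ?y)
        = vadd (bsum d m (incs \<delta> m w)) (bsum d 1 (vsub ?x ?y))"
      using assms len by (intro bsum_append length_incs) auto
    also have "\<dots> = vadd ?y (vsub ?x ?y)" using len Suc by simp
    also have "\<dots> = ?x" using len by (intro vadd_vsub) simp
    finally show ?case using assms(1) by (simp add: incs_Suc)
  qed simp
  moreover have "\<exists>ys. incs \<delta> m w = incs \<delta> j w @ ys"
    using assms(2) by (induction m rule: dec_induct) (auto simp: incs_Suc[OF assms(1)])
  ultimately show ?thesis using bsum_append1[of j d "incs \<delta> j w"] length_incs[OF assms(1)] by force
qed

lemma length_incl [simp]: "length (incl \<delta> m) = m"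
  by (simp add: incl_def)

text \<open>The last increment is independent from the path values at the earlier grid times, hence
  from the earlier increments, which are a Lipschitz function of those values; then one inducts on
  the number of steps.\<close>

lemma iter_incl:
  assumes "0 < \<delta>" "cblip (m * d) \<phi>"
  shows "iter (incl \<delta> m) \<phi> = E (\<lambda>w. \<phi> (incs \<delta> m w))"
  using assms(2)
proof (induction m arbitrary: \<phi>)
  case 0
  show ?case by (simp add: incl_def E_const)
next
  case (Suc m)
  let ?\<tau> = "\<lambda>i. real i * \<delta>"
  define Y where "Y w = vsub (X (?\<tau> (Suc m)) w) (X (?\<tau> m) w)" for w
  define V where "V = fdv X (map ?\<tau> [0..<Suc m])"
  have \<delta>: "0 \<le> \<delta>" using assms(1) by simp
  have c: "cblip (m * d + d) \<phi>" using Suc.prems by (simp add: add.commute)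
  have law: "nexp d (inc (?\<tau> m) (?\<tau> (Suc m)))"
    using \<delta> by (intro nlaw_nexp[OF nlaw_inc]) auto
  have "iter (incl \<delta> (Suc m)) \<phi> = iter (incl \<delta> m) (\<lambda>xs. inc (?\<tau> m) (?\<tau> (Suc m)) (\<lambda>x. \<phi> (xs @ x)))"
    by (simp add: incl_def iter_append)
  also have "\<dots> = E (\<lambda>w. inc (?\<tau> m) (?\<tau> (Suc m)) (\<lambda>x. \<phi> (incs \<delta> m w @ x)))"
    by (rule Suc.IH[OF cblip_partial[OF law c]])
  also have "\<dots> = E (\<lambda>w. E (\<lambda>w'. \<phi> (incs \<delta> m w @ Y w')))"
    by (simp add: inc_def Y_def)
  also have "\<dots> = E (\<lambda>w. \<phi> (incs \<delta> m w @ Y w))"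
  proof -
    \<comment> \<open>\<open>F\<close> recovers the increments from the values at the times
      \<open>0, ..., m * \<delta>\<close>: the vector without its first block minus the vector
      without its last.\<close>
    define F where "F v = vsub (drop d v) (take (m * d) v)" for v :: "real list"
    have lenF: "length (F v) = m * d" if "length v = Suc m * d" for v using that by (simp add: F_def)
    have V: "length (V w) = Suc m * d" for w unfolding V_def using \<delta> by (simp add: length_grid del: upt_Suc)
    have FV: "F (V w) = incs \<delta> m w" for w
    proof -
      have "V w = X 0 w @ fdv X (map ?\<tau> [1..<Suc m]) w"
        unfolding V_def by (subst upt_conv_Cons) (simp_all add: fdv_def del: upt_Suc X_0)
      moreover have "V w = fdv X (map ?\<tau> [0..<m]) w @ X (?\<tau> m) w"
        unfolding V_def by (simp add: fdv_append fdv_single)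
      moreover have "length (X 0 w) = d" "length (fdv X (map ?\<tau> [0..<m]) w) = m * d"
        using length_grid[OF \<delta>, of 0 m w] by simp_all
      ultimately have "drop d (V w) = fdv X (map ?\<tau> [1..<Suc m]) w"
        "take (m * d) (V w) = fdv X (map ?\<tau> [0..<m]) w"
        by (metis append_eq_conv_conj)+
      then show ?thesis by (simp add: F_def incs_def)
    qed
    define \<phi>' where "\<phi>' v = \<phi> (F (take (Suc m * d) v) @ drop (Suc m * d) v)" for v
    have "cblip (Suc m * d + d) \<phi>'"
      unfolding \<phi>'_def
    proof (rule cblip_comp[OF c, where K = 3])
      fix x y :: "real list" assume xy: "length x = Suc m * d + d" "length y = Suc m * d + d"
      let ?n = "Suc m * d"
      have "ld (F (take ?n x)) (F (take ?n y)) \<le> ld (take ?n x) (take ?n y) + ld (take ?n x) (take ?n y)"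
        unfolding F_def using xy
        by (intro order_trans[OF ld_vsub[of _ "m * d"]] add_mono ld_drop_le ld_take_le) auto
      moreover have "ld x y = ld (take ?n x) (take ?n y) + ld (drop ?n x) (drop ?n y)"
        using xy by (intro ld_take_drop) simp
      moreover have "ld (F (take ?n x) @ drop ?n x) (F (take ?n y) @ drop ?n y)
          = ld (F (take ?n x)) (F (take ?n y)) + ld (drop ?n x) (drop ?n y)"
        using xy lenF[of "take ?n x"] lenF[of "take ?n y"] by (subst vsub_append) auto
      moreover have "0 \<le> ld (drop ?n x) (drop ?n y)" by simp
      ultimately show "ld (F (take ?n x) @ drop ?n x) (F (take ?n y) @ drop ?n y) \<le> 3 * ld x y"
        using l1_nonneg[of "vsub (take ?n x) (take ?n y)"] by argo
    next
      fix x :: "real list" assume "length x = Suc m * d + d"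
      then show "length (F (take (Suc m * d) x) @ drop (Suc m * d) x) = m * d + d"
        using lenF[of "take (Suc m * d) x"] by simp
    qed
    moreover have "indep E (Suc m * d) V d Y"
    proof -
      \<comment> \<open>Starting at time 0 gives at least two times even for \<open>m = 0\<close>,
        as the definition of independent increments requires.\<close>
      define ts where "ts = map ?\<tau> [0..<Suc (Suc m)]"
      have "sorted_wrt (<) ts"
        unfolding ts_def using assms(1) by (simp add: sorted_wrt_iff_nth_less del: upt_Suc)
      moreover have "2 \<le> length ts" "0 \<le> hd ts" by (simp_all add: ts_def hd_map upt_conv_Cons del: upt_Suc)
      ultimately have "indep E ((length ts - 1) * d) (fdv X (butlast ts)) d
          (\<lambda>w. vsub (X (last ts) w) (X (last (butlast ts)) w))"
        using ind unfolding indep_incr_def by blast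
      moreover have "butlast ts = map ?\<tau> [0..<Suc m]" "last ts = ?\<tau> (Suc m)" "length ts - 1 = Suc m"
        by (simp_all add: ts_def butlast_append)
      ultimately show ?thesis unfolding V_def Y_def[abs_def] by simp
    qed
    ultimately have "E (\<lambda>w. \<phi>' (V w @ Y w)) = E (\<lambda>w. E (\<lambda>w'. \<phi>' (V w @ Y w')))"
      unfolding indep_def by blast
    then show ?thesis by (simp add: \<phi>'_def V FV)
  qed
  also have "\<dots> = E (\<lambda>w. \<phi> (incs \<delta> (Suc m) w))" using \<delta> by (simp add: incs_Suc Y_def)
  finally show ?case .
qed

text \<open>The constant \<open>Et h\<close> is the same for every base function and every q, so it
  bounds the maximal slope of the marginal chain. Domination is applied to the whole path at once;
  no independence under \<open>Et\<close> is involved.\<close>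

lemma iter_incl_perturb:
  assumes "0 < \<delta>" "cblip (m * d) f" "cblip (m * d) \<psi>" "1 \<le> q" "h \<in> H"
    and "\<And>w. f (incs \<delta> m w) \<le> h w"
  shows "iter (incl \<delta> m) (\<lambda>xs. \<psi> xs + f xs / real q) \<le> iter (incl \<delta> m) \<psi> + Et h / real q"
proof -
  have \<delta>: "0 \<le> \<delta>" using assms(1) by simp
  have c: "cblip (m * d) (\<lambda>xs. \<psi> xs + f xs / real q)" using assms by (intro cblip_add cblip_divide)
  have "E (\<lambda>w. \<psi> (incs \<delta> m w) + f (incs \<delta> m w) / real q)
      \<le> E (\<lambda>w. \<psi> (incs \<delta> m w)) + 0 + (1 / real q) * Et h"
    using lin_space_comp[OF lin rvec_incs[OF \<delta>] c] lin_space_comp[OF lin rvec_incs[OF \<delta>] assms(3)] assms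
    by (intro E_le) (auto intro: divide_right_mono)
  then show ?thesis using assms(1,3) c by (simp add: iter_incl)
qed

text \<open>By domination the difference of the expectations is at most a constant times the sum of
  the \<open>nm (r n t) t\<close>, which vanishes by continuity.\<close>

lemma fdv_tendsto:
  assumes "\<And>t. t \<in> set ts \<Longrightarrow> 0 \<le> t" "\<And>n t. 0 \<le> t \<Longrightarrow> 0 \<le> r n t"
    and "\<And>t. t \<in> set ts \<Longrightarrow> ((\<lambda>n. r n t) \<longlongrightarrow> t) F" "cblip (length ts * d) \<phi>"
  shows "((\<lambda>n. E (\<lambda>w. \<phi> (fdv X (map (r n) ts) w))) \<longlongrightarrow> E (\<lambda>w. \<phi> (fdv X ts w))) F"
proof -
  obtain L where L: "0 \<le> L" "\<And>x y. length x = length ts * d \<Longrightarrow> length y = length ts * d \<Longrightarrow>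
      \<bar>\<phi> x - \<phi> y\<bar> \<le> L * ld x y"
    using cblipE[OF assms(4)] by metis
  define h where "h n w = (\<Sum>t\<leftarrow>ts. lnorm (vsub (X (r n t) w) (X t w)))" for n w
  have h: "h n \<in> H" for n
    unfolding h_def using assms(1,2) by (intro lin_space_sum_list[OF lin] norm_mem) auto
  have ld: "ld (fdv X (map (r n) ts) w) (fdv X ts w) \<le> real d * h n w" for n w
    unfolding h_def using assms(1)
  proof (induction ts)
    case (Cons t ts)
    have t: "0 \<le> t" "0 \<le> r n t" using Cons.prems assms(2) by auto
    have "ld (fdv X (map (r n) (t # ts)) w) (fdv X (t # ts) w)
        = ld (X (r n t) w) (X t w) + ld (fdv X (map (r n) ts) w) (fdv X ts w)"
      using t by (simp add: fdv_def)
    also have "\<dots> \<le> real d * lnorm (vsub (X (r n t) w) (X t w))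
        + real d * (\<Sum>t\<leftarrow>ts. lnorm (vsub (X (r n t) w) (X t w)))"
      using t Cons by (intro add_mono ld_X_le) auto
    finally show ?case by (simp add: distrib_left)
  qed (simp add: fdv_def)
  have mem: "(\<lambda>w. \<phi> (fdv X us w)) \<in> H" if "length us = length ts" "\<And>t. t \<in> set us \<Longrightarrow> 0 \<le> t" for us
    using rvec_fdv[of us H d X] rvec_X that assms(4) by (intro lin_space_comp[OF lin]) auto
  have close: "\<bar>E (\<lambda>w. \<phi> (fdv X (map (r n) ts) w)) - E (\<lambda>w. \<phi> (fdv X ts w))\<bar>
      \<le> (L * real d) * (\<Sum>t\<leftarrow>ts. nm (r n t) t)" for n
  proof -
    have le: "\<bar>\<phi> (fdv X (map (r n) ts) w) - \<phi> (fdv X ts w)\<bar> \<le> (L * real d) * h n w" for w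
    proof -
      have "\<bar>\<phi> (fdv X (map (r n) ts) w) - \<phi> (fdv X ts w)\<bar>
          \<le> L * ld (fdv X (map (r n) ts) w) (fdv X ts w)"
        using assms(1,2) length_fdv[of "map (r n) ts" w] length_fdv[of ts w] by (intro L(2)) auto
      also have "\<dots> \<le> L * (real d * h n w)" by (intro mult_left_mono ld L)
      finally show ?thesis by (simp add: mult.assoc)
    qed
    have "E (\<lambda>w. \<phi> (fdv X (map (r n) ts) w)) \<le> E (\<lambda>w. \<phi> (fdv X ts w)) + 0 + (L * real d) * Et (h n)"
      using assms(1,2) L(1) le h by (intro E_le mem) (auto simp: abs_le_iff algebra_simps)
    moreover have "E (\<lambda>w. \<phi> (fdv X ts w)) \<le> E (\<lambda>w. \<phi> (fdv X (map (r n) ts) w)) + 0 + (L * real d) * Et (h n)"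
      using assms(1,2) L(1) le h by (intro E_le mem) (auto simp: abs_le_iff algebra_simps)
    moreover have "(L * real d) * Et (h n) \<le> (L * real d) * (\<Sum>t\<leftarrow>ts. nm (r n t) t)"
      unfolding h_def nm_def using assms(1,2) L(1) by (intro mult_left_mono Et_sum_list norm_mem) auto
    ultimately show ?thesis by (simp add: abs_le_iff)
  qed
  have "((\<lambda>n. \<Sum>t\<leftarrow>ts. nm (r n t) t) \<longlongrightarrow> (\<Sum>t\<leftarrow>ts. 0)) F"
    using assms(1,3)
  proof (induction ts)
    case (Cons t ts)
    have "((\<lambda>n. nm (r n t) t + (\<Sum>t\<leftarrow>ts. nm (r n t) t)) \<longlongrightarrow> 0 + (\<Sum>t\<leftarrow>ts. 0)) F"
      using Cons assms(2) by (intro tendsto_add nm_tendsto) auto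
    then show ?case by simp
  qed simp
  then have "((\<lambda>n. (L * real d) * (\<Sum>t\<leftarrow>ts. nm (r n t) t)) \<longlongrightarrow> 0) F"
    by (intro tendsto_mult_right_zero) (simp add: sum_list_triv)
  then have "((\<lambda>n. E (\<lambda>w. \<phi> (fdv X (map (r n) ts) w)) - E (\<lambda>w. \<phi> (fdv X ts w))) \<longlongrightarrow> 0) F"
    by (rule Lim_null_comparison[rotated]) (simp add: close always_eventually)
  then show ?thesis by (rule LIM_zero_cancel)
qed

text \<open>The path value at a grid time is the displacement from \<open>X 0 = 0\<close>. Its
  moment depends on the time \<open>j * \<delta>\<close>, not on the number of steps taken to reach
  it.\<close>

lemma iter_incl_moment:
  assumes "0 < \<delta>" "\<And>j. j \<in> set js \<Longrightarrow> j \<le> m" "0 \<le> b" "cblip (m * d) \<psi>" "1 \<le> q"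
    and K: "(\<Sum>j\<leftarrow>js. real d * nm (real j * \<delta>) 0) \<le> K"
    and f: "cblip (m * d) f" "\<And>xs. f xs \<le> b * (\<Sum>j\<leftarrow>js. l1 (bsum d j xs))"
  shows "iter (incl \<delta> m) (\<lambda>xs. \<psi> xs + f xs / real q) \<le> iter (incl \<delta> m) \<psi> + b * K / real q"
proof -
  have \<delta>: "0 \<le> \<delta>" using assms(1) by simp
  define h where "h w = b * (\<Sum>j\<leftarrow>js. real d * lnorm (vsub (X (real j * \<delta>) w) (X 0 w)))" for w
  have mem: "(\<lambda>w. real d * lnorm (vsub (X (real j * \<delta>) w) (X 0 w))) \<in> H" for j
    using \<delta> by (intro lin_space_cmult[OF lin] norm_mem) auto
  have h: "h \<in> H"
    unfolding h_def by (intro lin_space_cmult[OF lin] lin_space_sum_list[OF lin] mem)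
  have "f (incs \<delta> m w) \<le> h w" for w
  proof -
    have "l1 (bsum d j (incs \<delta> m w)) \<le> real d * lnorm (vsub (X (real j * \<delta>) w) (X 0 w))"
      if "j \<in> set js" for j
      using that ld_X_le[of "real j * \<delta>" 0 w] \<delta> assms(2) by (simp add: bsum_incs)
    then have "b * (\<Sum>j\<leftarrow>js. l1 (bsum d j (incs \<delta> m w))) \<le> h w"
      unfolding h_def using assms(3) by (intro mult_left_mono sum_list_mono) auto
    then show ?thesis using f(2)[of "incs \<delta> m w"] by simp
  qed
  from iter_incl_perturb[OF assms(1) f(1) assms(4,5) h this]
  have "iter (incl \<delta> m) (\<lambda>xs. \<psi> xs + f xs / real q) \<le> iter (incl \<delta> m) \<psi> + Et h / real q" .
  also have "Et h \<le> b * K"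
  proof -
    have "Et h = b * Et (\<lambda>w. \<Sum>j\<leftarrow>js. real d * lnorm (vsub (X (real j * \<delta>) w) (X 0 w)))"
      unfolding h_def by (intro Et_cmult lin_space_sum_list[OF lin] mem assms(3))
    also have "\<dots> \<le> b * (\<Sum>j\<leftarrow>js. Et (\<lambda>w. real d * lnorm (vsub (X (real j * \<delta>) w) (X 0 w))))"
      by (intro mult_left_mono Et_sum_list mem assms(3))
    also have "\<dots> = b * (\<Sum>j\<leftarrow>js. real d * nm (real j * \<delta>) 0)"
      unfolding nm_def using \<delta> by (subst Et_cmult) (auto intro!: norm_mem simp del: X_0)
    also have "\<dots> \<le> b * K" by (intro mult_left_mono K assms(3))
    finally show ?thesis .
  qed
  finally show ?thesis by (simp add: divide_right_mono)
qed

lemma moment_bounded: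
  assumes "\<And>t. t \<in> set ts \<Longrightarrow> 0 \<le> t" "\<And>n t. 0 \<le> t \<Longrightarrow> 0 \<le> r n t"
    and "\<And>t. 0 \<le> t \<Longrightarrow> ((\<lambda>n. r n t) \<longlongrightarrow> t) F"
  obtains K where "0 \<le> K" "\<forall>\<^sub>F n in F. (\<Sum>t\<leftarrow>ts. real d * nm (r n t) 0) \<le> K"
proof -
  have one: "\<forall>\<^sub>F n in F. real d * nm (r n t) 0 \<le> real d * (real d * (1 + nm t 0))" if "0 \<le> t" for t
  proof -
    have "\<forall>\<^sub>F n in F. nm (r n t) t < 1"
      by (rule order_tendstoD(2)[OF nm_tendsto]) (use that assms(2,3) in auto)
    then show ?thesis
    proof eventually_elim
      case (elim n)
      have "nm (r n t) 0 \<le> real d * (nm (r n t) t + nm t 0)" using that assms(2) by (intro nm_le) auto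
      also have "\<dots> \<le> real d * (1 + nm t 0)" using elim by (intro mult_left_mono) auto
      finally show ?case by (intro mult_left_mono) auto
    qed
  qed
  have "\<forall>\<^sub>F n in F. \<forall>t\<in>set ts. real d * nm (r n t) 0 \<le> real d * (real d * (1 + nm t 0))"
    using one assms(1) by (intro eventually_ball_finite) auto
  then have "\<forall>\<^sub>F n in F. (\<Sum>t\<leftarrow>ts. real d * nm (r n t) 0) \<le> (\<Sum>t\<leftarrow>ts. real d * (real d * (1 + nm t 0)))"
    by eventually_elim (auto intro: sum_list_mono)
  moreover have "0 \<le> (\<Sum>t\<leftarrow>ts. real d * (real d * (1 + nm t 0)))"
    using assms(1) nm_nonneg[of _ 0] by (intro sum_list_nonneg) auto
  ultimately show ?thesis using that by blast
qed

lemma stat_inc: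
  assumes "stat_incr E d X" "0 \<le> s" "s \<le> t" "cblip d \<phi>"
  shows "inc s t \<phi> = inc 0 (t - s) \<phi>"
proof -
  have "same_law d E (\<lambda>w. vsub (X (t - s + s) w) (X s w)) E (X (t - s))"
    using assms unfolding stat_incr_def by (meson diff_ge_0_iff_ge)
  then have "E (\<lambda>w. \<phi> (vsub (X t w) (X s w))) = E (\<lambda>w. \<phi> (X (t - s) w))"
    using assms(4) by (simp add: same_law_def)
  then show ?thesis using assms by (simp add: inc_def)
qed

end

section \<open>The joint chain on a grid\<close>

text \<open>By compactness of a product of intervals, the points listing the n-th terms of all
  sequences have a cluster point. Pulling back its neighbourhoods gives a filter along which all
  bounded sequences converge at once; it refines \<open>sequentially\<close>, so ordinary limits and
  eventual properties persist.\<close>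

lemma ex_limit_filter:
  "\<exists>F :: nat filter. F \<noteq> bot \<and> F \<le> sequentially \<and>
     (\<forall>(a :: nat \<Rightarrow> real) C. (\<forall>\<^sub>F n in sequentially. \<bar>a n\<bar> \<le> C) \<longrightarrow> (\<exists>l. (a \<longlongrightarrow> l) F))"
proof -
  \<comment> \<open>Every pair of a sequence and a bound is a coordinate; truncating at the bound
    puts all points into one compact box and changes nothing for sequences that eventually respect
    their bound.\<close>
  define g :: "nat \<Rightarrow> (nat \<Rightarrow> real) \<times> real \<Rightarrow> real"
    where "g n = (\<lambda>(a, C). max (- \<bar>C\<bar>) (min \<bar>C\<bar> (a n)))" for n
  define K where "K = PiE UNIV (\<lambda>(a :: nat \<Rightarrow> real, C :: real). {- \<bar>C\<bar> .. \<bar>C\<bar>})"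
  have "compactin (product_topology (\<lambda>_. euclidean) UNIV) K"
    unfolding K_def compactin_PiE by (auto simp: compactin_euclidean_iff)
  then have "compact K" by (simp add: euclidean_product_topology)
  moreover have "eventually (\<lambda>x. x \<in> K) (filtermap g sequentially)"
    unfolding eventually_filtermap by (rule always_eventually) (auto simp: K_def g_def PiE_def)
  moreover have "filtermap g sequentially \<noteq> bot" by (simp add: filtermap_bot_iff)
  ultimately obtain x where x: "inf (nhds x) (filtermap g sequentially) \<noteq> bot"
    unfolding compact_filter by blast
  define F where "F = inf sequentially (filtercomap g (nhds x))"
  have F: "F \<noteq> bot"
  proof
    assume "F = bot"
    then have "eventually (\<lambda>_. False) F" by simp
    then obtain P R where P: "eventually P sequentially" and R: "eventually R (nhds x)"
      and PR: "\<And>n. P n \<Longrightarrow> \<not> R (g n)"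
      unfolding F_def eventually_inf eventually_filtercomap by blast
    have "eventually (\<lambda>y. \<not> R y) (filtermap g sequentially)"
      unfolding eventually_filtermap using P PR by (auto elim: eventually_mono)
    then have "eventually (\<lambda>_. False) (inf (nhds x) (filtermap g sequentially))"
      unfolding eventually_inf using R by blast
    then show False using x by (simp add: trivial_limit_def)
  qed
  have Fle: "F \<le> sequentially" by (simp add: F_def)
  have "filterlim g (nhds x) (filtercomap g (nhds x))" by (rule filterlim_filtercomap)
  then have lim: "filterlim g (nhds x) F" unfolding F_def by (rule filterlim_mono) auto
  have "\<exists>l. (a \<longlongrightarrow> l) F" if aC: "\<forall>\<^sub>F n in sequentially. \<bar>a n\<bar> \<le> C" for a :: "nat \<Rightarrow> real" and C
  proof -
    have "((\<lambda>n. g n (a, C)) \<longlongrightarrow> x (a, C)) F"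
      by (rule continuous_on_tendsto_compose[OF continuous_on_product_coordinates lim]) auto
    moreover have "\<forall>\<^sub>F n in F. g n (a, C) = a n"
    proof -
      have "\<forall>\<^sub>F n in F. \<bar>a n\<bar> \<le> C" using aC Fle by (simp add: le_filter_def)
      then show ?thesis by eventually_elim (auto simp: g_def)
    qed
    ultimately have "(a \<longlongrightarrow> x (a, C)) F" by (rule Lim_transform_eventually)
    then show ?thesis by blast
  qed
  then show ?thesis using F Fle by blast
qed

lemma nlaw_comp_law:
  assumes A: "nlaw p K A" and B: "nlaw q K' B"
  shows "nlaw (p + q) (K + K') (comp_law A B)"
  unfolding nlaw_def
proof (intro conjI allI impI)
  fix c show "comp_law A B (\<lambda>_. c) = c"
    using nexp_const[OF nlaw_nexp[OF A]] nexp_const[OF nlaw_nexp[OF B]] by (simp add: comp_law_def)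
next
  fix \<phi> \<psi> :: "real list \<Rightarrow> real" and a b :: real
  assume b: "0 \<le> b" and c: "cblip (p + q) \<phi>" "cblip (p + q) \<psi>"
    and le: "\<forall>x. length x = p + q \<longrightarrow> \<phi> x \<le> \<psi> x + a + b * l1 x"
  note part = cblip_partial[OF nlaw_nexp[OF B]]
  have "B (\<lambda>y. \<phi> (x @ y)) \<le> B (\<lambda>y. \<psi> (x @ y)) + (a + b * K') + b * l1 x" if x: "length x = p" for x
  proof -
    have "B (\<lambda>y. \<phi> (x @ y)) \<le> B (\<lambda>y. \<psi> (x @ y)) + (a + b * l1 x) + b * K'"
    proof (rule nlawD[OF B b cblip_section[OF c(1) x] cblip_section[OF c(2) x]])
      fix y :: "real list" assume "length y = q"
      then show "\<phi> (x @ y) \<le> \<psi> (x @ y) + (a + b * l1 x) + b * l1 y"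
        using le[rule_format, of "x @ y"] x by (simp add: distrib_left)
    qed
    then show ?thesis by simp
  qed
  from nlawD[OF A b part[OF c(1)] part[OF c(2)] this]
  show "comp_law A B \<phi> \<le> comp_law A B \<psi> + a + b * (K + K')"
    by (simp add: comp_law_def algebra_simps)
qed

text \<open>The perturbation depends on the outer variable only: for frozen x it passes through
  \<open>B\<close> as a constant and meets \<open>A\<close> at the base function obtained by
  integrating \<open>u'\<close> under \<open>B\<close>.\<close>

lemma marg_dom_fst:
  assumes A: "nexp p A" and B: "nexp q B"
  shows "marg_dom (take p) p A (p + q) (comp_law A B)"
  unfolding marg_dom_def comp_law_def
proof (intro allI impI)
  fix u u' g :: "real list \<Rightarrow> real" and c
  assume u: "cblip (p + q) u" "cblip (p + q) u'" and g: "cblip p g"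
    and le: "\<forall>x. length x = p + q \<longrightarrow> u x \<le> u' x + g (take p x)"
    and c: "\<forall>\<kappa>. cblip p \<kappa> \<longrightarrow> A (\<lambda>x. \<kappa> x + g x) \<le> A \<kappa> + c"
  note part = cblip_partial[OF B]
  have "A (\<lambda>x. B (\<lambda>y. u (x @ y))) \<le> A (\<lambda>x. B (\<lambda>y. u' (x @ y)) + g x)"
  proof (rule nexp_mono[OF A part[OF u(1)] cblip_add[OF part[OF u(2)] g]])
    fix x :: "real list" assume x: "length x = p"
    have "u (x @ y) \<le> u' (x @ y) + g x" if "length y = q" for y
      using le[rule_format, of "x @ y"] x that by simp
    then show "B (\<lambda>y. u (x @ y)) \<le> B (\<lambda>y. u' (x @ y)) + g x"
      by (intro nexp_le[OF B] cblip_section[OF u(1) x] cblip_section[OF u(2) x]) auto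
  qed
  then show "A (\<lambda>x. B (\<lambda>y. u (x @ y))) \<le> A (\<lambda>x. B (\<lambda>y. u' (x @ y))) + c"
    using c part[OF u(2)] by fastforce
qed

text \<open>The perturbation sits in the inner integral. The bound is applied there to the section
  of \<open>u'\<close> at x, a base function that varies with x, and the constant c then passes
  through \<open>A\<close>.\<close>

lemma marg_dom_snd:
  assumes A: "nexp p A" and B: "nexp q B"
  shows "marg_dom (drop p) q B (p + q) (comp_law A B)"
  unfolding marg_dom_def comp_law_def
proof (intro allI impI)
  fix u u' g :: "real list \<Rightarrow> real" and c
  assume u: "cblip (p + q) u" "cblip (p + q) u'" and g: "cblip q g"
    and le: "\<forall>x. length x = p + q \<longrightarrow> u x \<le> u' x + g (drop p x)"
    and c: "\<forall>\<kappa>. cblip q \<kappa> \<longrightarrow> B (\<lambda>x. \<kappa> x + g x) \<le> B \<kappa> + c"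
  note part = cblip_partial[OF B]
  show "A (\<lambda>x. B (\<lambda>y. u (x @ y))) \<le> A (\<lambda>x. B (\<lambda>y. u' (x @ y))) + c"
  proof (rule nexp_le[OF A part[OF u(1)] part[OF u(2)]])
    fix x :: "real list" assume x: "length x = p"
    have "u (x @ y) \<le> u' (x @ y) + g y" if "length y = q" for y
      using le[rule_format, of "x @ y"] x that by simp
    then have "B (\<lambda>y. u (x @ y)) \<le> B (\<lambda>y. u' (x @ y) + g y)"
      by (intro nexp_mono[OF B] cblip_add cblip_section[OF u(1) x] cblip_section[OF u(2) x] g) auto
    then show "B (\<lambda>y. u (x @ y)) \<le> B (\<lambda>y. u' (x @ y)) + c"
      using c cblip_section[OF u(2) x] by fastforce
  qed
qed

text \<open>The common properties of \<open>take d\<close> and \<open>drop d\<close> on blocks of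
  length \<open>d + d\<close>, so that both marginals are handled by one argument. Compatibility
  with \<open>vadd\<close> lets the projection commute with partial sums.\<close>

definition coord_proj :: "(real list \<Rightarrow> real list) \<Rightarrow> nat \<Rightarrow> nat \<Rightarrow> bool" where
  "coord_proj pr P p \<longleftrightarrow> (\<forall>x. length x = P \<longrightarrow> length (pr x) = p) \<and> pr (replicate P 0) = replicate p 0 \<and>
     (\<forall>x y. pr (vadd x y) = vadd (pr x) (pr y)) \<and>
     (\<forall>x y. length x = P \<longrightarrow> length y = P \<longrightarrow> ld (pr x) (pr y) \<le> ld x y)"

lemma coord_proj_take: "coord_proj (take p) (p + q) p"
  by (auto simp: coord_proj_def vadd_take ld_take_le)

lemma coord_proj_drop: "coord_proj (drop p) (p + q) q"
  by (auto simp: coord_proj_def vadd_drop ld_drop_le)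

lemma length_blockmap: "coord_proj pr P p \<Longrightarrow> length zs = m * P \<Longrightarrow> length (blockmap pr P m zs) = m * p"
  by (induction m arbitrary: zs) (auto simp: coord_proj_def)

lemma ld_blockmap:
  "coord_proj pr P p \<Longrightarrow> length zs = m * P \<Longrightarrow> length zs' = m * P \<Longrightarrow>
    ld (blockmap pr P m zs) (blockmap pr P m zs') \<le> ld zs zs'"
proof (induction m arbitrary: zs zs')
  case (Suc m)
  have len: "length (pr (take P zs)) = length (pr (take P zs'))"
    using Suc.prems by (simp add: coord_proj_def)
  have "ld (pr (take P zs)) (pr (take P zs')) \<le> ld (take P zs) (take P zs')"
    using Suc.prems by (simp add: coord_proj_def)
  moreover have "ld (blockmap pr P m (drop P zs)) (blockmap pr P m (drop P zs')) \<le> ld (drop P zs) (drop P zs')"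
    using Suc.prems by (intro Suc.IH) auto
  ultimately show ?case using ld_take_drop[of zs zs' P] Suc.prems len by simp
qed simp

lemma bsum_blockmap:
  "coord_proj pr P p \<Longrightarrow> length zs = m * P \<Longrightarrow> j \<le> m \<Longrightarrow>
    bsum p j (blockmap pr P m zs) = pr (bsum P j zs)"
proof (induction j arbitrary: zs m)
  case 0
  then show ?case by (simp add: coord_proj_def)
next
  case (Suc j)
  then obtain m' where m: "m = Suc m'" "j \<le> m'" by (cases m) auto
  have len: "length (pr (take P zs)) = p" using Suc.prems m by (simp add: coord_proj_def)
  have "bsum p j (blockmap pr P m' (drop P zs)) = pr (bsum P j (drop P zs))"
    using Suc.prems m by (intro Suc.IH) auto
  then show ?case using Suc.prems(1) len m(1) by (simp add: coord_proj_def)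
qed

text \<open>For a frozen first block x the remaining integral depends on x only through
  \<open>pr x\<close>, so each joint law is evaluated on a function of its marginal.\<close>

lemma iter_marginal:
  assumes pr: "coord_proj pr P p"
    and "list_all2 (\<lambda>A G. nexp p A \<and> nexp P G \<and> (\<forall>\<phi>. cblip p \<phi> \<longrightarrow> G (\<lambda>x. \<phi> (pr x)) = A \<phi>)) As Gs"
    and "cblip (length As * p) \<phi>"
  shows "iter Gs (\<lambda>zs. \<phi> (blockmap pr P (length Gs) zs)) = iter As \<phi>"
  using assms(2,3)
proof (induction As Gs arbitrary: \<phi> rule: list_all2_induct)
  case (Cons A As G Gs)
  have A: "nexp p A" and G: "nexp P G" "\<And>\<phi>. cblip p \<phi> \<Longrightarrow> G (\<lambda>x. \<phi> (pr x)) = A \<phi>"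
    using Cons.hyps by auto
  have len: "length As = length Gs" using Cons.hyps(2) by (rule list_all2_lengthD)
  have "\<forall>A\<in>set As. nexp p A" "\<forall>G\<in>set Gs. nexp P G"
    using Cons.hyps(2) by (induction rule: list_all2_induct) auto
  then have T: "nexp (length As * p) (iter As)" and U: "nexp (length Gs * P) (iter Gs)"
    by (auto intro: iter_nexp)
  have c: "cblip (p + length As * p) \<phi>" using Cons.prems by simp
  have lenpr: "length (pr x) = p" if "length x = P" for x using pr that by (simp add: coord_proj_def)
  have big: "cblip (P + length Gs * P) (\<lambda>zs. \<phi> (blockmap pr P (length (G # Gs)) zs))"
    by (rule cblip_comp[OF c, where K = 1])
      (use ld_blockmap[OF pr, of _ "Suc (length Gs)"] length_blockmap[OF pr, of _ "Suc (length Gs)"] len in auto)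
  have "iter (G # Gs) (\<lambda>zs. \<phi> (blockmap pr P (length (G # Gs)) zs))
      = G (\<lambda>x. iter As (\<lambda>xs. \<phi> (pr x @ xs)))"
    unfolding iter.simps
  proof (rule nexp_cong[OF G(1) cblip_partial[OF U big]])
    fix x :: "real list" assume x: "length x = P"
    then have "iter Gs (\<lambda>xs. \<phi> (blockmap pr P (length (G # Gs)) (x @ xs)))
        = iter Gs (\<lambda>xs. \<phi> (pr x @ blockmap pr P (length Gs) xs))" by simp
    also have "\<dots> = iter As (\<lambda>xs. \<phi> (pr x @ xs))"
      by (rule Cons.IH[OF cblip_section[OF c lenpr[OF x]]])
    finally show "iter Gs (\<lambda>xs. \<phi> (blockmap pr P (length (G # Gs)) (x @ xs))) = iter As (\<lambda>xs. \<phi> (pr x @ xs))" .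
  qed
  also have "\<dots> = iter (A # As) \<phi>" using G(2)[OF cblip_partial[OF T c]] by simp
  finally show ?case .
qed simp

lemma comp_law_fst:
  assumes "nexp p A" "nexp q B" "cblip p \<phi>"
  shows "comp_law A B (\<lambda>x. \<phi> (take p x)) = A \<phi>"
  unfolding comp_law_def
  by (rule nexp_cong[OF assms(1), symmetric]) (use assms nexp_const[OF assms(2)] in auto)

lemma comp_law_snd:
  assumes "nexp p A" "nexp q B" "cblip q \<phi>"
  shows "comp_law A B (\<lambda>x. \<phi> (drop p x)) = B \<phi>"
proof -
  have "comp_law A B (\<lambda>x. \<phi> (drop p x)) = A (\<lambda>_. B \<phi>)"
    unfolding comp_law_def by (rule nexp_cong[OF assms(1), symmetric]) auto
  then show ?thesis using nexp_const[OF assms(1)] by simp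
qed

section \<open>Grid times and rounding\<close>

definition stp :: "nat \<Rightarrow> real" where
  "stp n = 1 / real (Suc n)"

text \<open>This many steps of length \<open>1 / (n + 1)\<close> reach time \<open>n + 1\<close>:
  the mesh shrinks while the horizon grows, so every fixed time is eventually covered.\<close>

definition num :: "nat \<Rightarrow> nat" where
  "num n = Suc n * Suc n"

definition pos :: "nat \<Rightarrow> real \<Rightarrow> nat" where
  "pos n t = nat \<lfloor>t * real (Suc n)\<rfloor>"

definition rnd :: "nat \<Rightarrow> real \<Rightarrow> real" where
  "rnd n t = real (pos n t) * stp n"

lemma stp_pos: "0 < stp n" "0 \<le> stp n"
  by (simp_all add: stp_def)

lemma stp_tendsto: "stp \<longlonglongrightarrow> 0"
  unfolding stp_def using LIMSEQ_inverse_real_of_nat by (simp add: inverse_eq_divide)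

lemma rnd_nonneg: "0 \<le> rnd n t"
  by (simp add: rnd_def stp_def)

lemma pos_mono: "s \<le> t \<Longrightarrow> pos n s \<le> pos n t"
  unfolding pos_def by (intro nat_mono floor_mono mult_right_mono) auto

lemma pos_0 [simp]: "pos n 0 = 0"
  by (simp add: pos_def)

lemma pos_bounds: "0 \<le> t \<Longrightarrow> real (pos n t) \<le> t * real (Suc n)" "t * real (Suc n) < real (pos n t) + 1"
proof -
  show "t * real (Suc n) < real (pos n t) + 1" unfolding pos_def by linarith
  assume "0 \<le> t"
  then have "0 \<le> t * real (Suc n)" by simp
  then show "real (pos n t) \<le> t * real (Suc n)" unfolding pos_def by linarith
qed

lemma rnd_bounds: "0 \<le> t \<Longrightarrow> rnd n t \<le> t" "t < rnd n t + stp n"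
  using pos_bounds[of t n] by (simp_all add: rnd_def stp_def divide_simps)

lemma rnd_tendsto: "0 \<le> t \<Longrightarrow> (\<lambda>n. rnd n t) \<longlonglongrightarrow> t"
proof -
  assume t: "0 \<le> t"
  have "(\<lambda>n. t - stp n) \<longlonglongrightarrow> t - 0" by (intro tendsto_intros stp_tendsto)
  then show ?thesis
    using rnd_bounds[of t] t
    by (intro tendsto_sandwich[of "\<lambda>n. t - stp n" "\<lambda>n. rnd n t" sequentially "\<lambda>_. t" t] always_eventually)
      (auto simp: less_imp_le algebra_simps)
qed

lemma pos_le_num:
  assumes "0 \<le> t" "t \<le> real n" shows "pos n t \<le> num n"
proof -
  have "t * real (Suc n) \<le> real (Suc n) * real (Suc n)" using assms by (intro mult_right_mono) auto
  then have "real (pos n t) \<le> real (num n)"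
    using pos_bounds(1)[OF assms(1), of n] unfolding num_def of_nat_mult by linarith
  then show ?thesis by simp
qed

lemma eventually_pos_le_num:
  "(\<And>t. t \<in> set ts \<Longrightarrow> 0 \<le> t) \<Longrightarrow> \<forall>\<^sub>F n in sequentially. \<forall>t\<in>set ts. pos n t \<le> num n"
proof (intro eventually_ball_finite ballI)
  fix t assume "\<And>t. t \<in> set ts \<Longrightarrow> 0 \<le> t" "t \<in> set ts"
  then have "0 \<le> t" by blast
  have "\<forall>\<^sub>F n in sequentially. t \<le> real n"
    using eventually_ge_at_top[of "nat \<lceil>t\<rceil>"] by eventually_elim linarith
  then show "\<forall>\<^sub>F n in sequentially. pos n t \<le> num n"
    by eventually_elim (rule pos_le_num[OF \<open>0 \<le> t\<close>])
qed simp

text \<open>Counterpart of \<open>fdv\<close> for a vector of increments: the path values at the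
  times in \<open>ts\<close>, rounded down to the grid.\<close>

definition sv :: "nat \<Rightarrow> nat \<Rightarrow> real list \<Rightarrow> real list \<Rightarrow> real list" where
  "sv p n ts zs = concat (map (\<lambda>t. bsum p (pos n t) zs) ts)"

lemma length_sv:
  "(\<And>t. t \<in> set ts \<Longrightarrow> pos n t * p \<le> length zs) \<Longrightarrow> length (sv p n ts zs) = length ts * p"
  by (induction ts) (auto simp: sv_def)

lemma ld_sv:
  assumes "length zs = length zs'"
  shows "(\<And>t. t \<in> set ts \<Longrightarrow> pos n t * p \<le> length zs) \<Longrightarrow>
    ld (sv p n ts zs) (sv p n ts zs') \<le> real (length ts) * ld zs zs'"
proof (induction ts)
  case (Cons t ts)
  have t: "pos n t * p \<le> length zs" using Cons.prems by simp
  have "ld (sv p n (t # ts) zs) (sv p n (t # ts) zs')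
      = ld (bsum p (pos n t) zs) (bsum p (pos n t) zs') + ld (sv p n ts zs) (sv p n ts zs')"
    using t assms by (simp add: sv_def)
  also have "\<dots> \<le> ld zs zs' + real (length ts) * ld zs zs'"
    using Cons ld_bsum[OF assms t] by (intro add_mono) auto
  finally show ?case by (simp add: distrib_right)
qed (simp add: sv_def)

lemma cblip_sv:
  assumes "cblip (length ts * p) \<phi>" "\<And>t. t \<in> set ts \<Longrightarrow> pos n t \<le> m"
  shows "cblip (m * p) (\<lambda>zs. \<phi> (sv p n ts zs))"
proof (rule cblip_comp[OF assms(1)])
  have le: "pos n t * p \<le> m * p" if "t \<in> set ts" for t using assms(2)[OF that] by simp
  show "length (sv p n ts zs) = length ts * p" if "length zs = m * p" for zs
    using that le by (intro length_sv) auto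
  show "ld (sv p n ts zs) (sv p n ts zs') \<le> real (length ts) * ld zs zs'"
    if "length zs = m * p" "length zs' = m * p" for zs zs'
    using that le by (intro ld_sv) auto
qed

lemma l1_sv: "l1 (sv p n ts zs) = (\<Sum>t\<leftarrow>ts. l1 (bsum p (pos n t) zs))"
  by (induction ts) (auto simp: sv_def)

lemma sv_blockmap:
  assumes "coord_proj pr P p" "length zs = m * P" "\<And>t. t \<in> set ts \<Longrightarrow> pos n t \<le> m"
  shows "sv p n ts (blockmap pr P m zs) = concat (map (\<lambda>t. pr (bsum P (pos n t) zs)) ts)"
  unfolding sv_def using bsum_blockmap[OF assms(1,2)] assms(3)
  by (intro arg_cong[where f = concat] map_cong) auto

lemma (in incr_process) sv_incs:
  assumes "\<And>t. t \<in> set ts \<Longrightarrow> pos n t \<le> num n"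
  shows "sv d n ts (incs (stp n) (num n) \<omega>) = fdv X (map (rnd n) ts) \<omega>"
  unfolding sv_def fdv_def map_map o_def rnd_def using assms
  by (intro arg_cong[where f = concat] map_cong refl bsum_incs stp_pos) auto

section \<open>Joint increments, their marginals and tightness\<close>

locale coupled = M: incr_process H1 E1 Et1 d M + N: incr_process H2 E2 Et2 d N
  for H1 :: "('a \<Rightarrow> real) set" and E1 Et1 and H2 :: "('b \<Rightarrow> real) set" and E2 Et2 and d
    and M :: "real \<Rightarrow> 'a \<Rightarrow> real list" and N :: "real \<Rightarrow> 'b \<Rightarrow> real list"
begin

definition jinc :: "real \<Rightarrow> real \<Rightarrow> (real list \<Rightarrow> real) \<Rightarrow> real" where
  "jinc s t = comp_law (M.inc s t) (N.inc s t)"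

definition jincl :: "real \<Rightarrow> nat \<Rightarrow> nat \<Rightarrow> ((real list \<Rightarrow> real) \<Rightarrow> real) list" where
  "jincl \<delta> a b = map (\<lambda>i. jinc (real i * \<delta>) (real (Suc i) * \<delta>)) [a..<b]"

lemma length_jincl [simp]: "length (jincl \<delta> a b) = b - a"
  by (simp add: jincl_def)

lemma nlaw_jinc: "0 \<le> s \<Longrightarrow> 0 \<le> t \<Longrightarrow> nlaw (d + d) (real d * M.nm s t + real d * N.nm s t) (jinc s t)"
  unfolding jinc_def by (intro nlaw_comp_law M.nlaw_inc N.nlaw_inc)

lemma step_laws:
  assumes "0 \<le> \<delta>"
  shows "\<exists>K. nlaw d K (M.inc (real i * \<delta>) (real (Suc i) * \<delta>))"
    and "\<exists>K. nlaw d K (N.inc (real i * \<delta>) (real (Suc i) * \<delta>))"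
    and "nexp d (M.inc (real i * \<delta>) (real (Suc i) * \<delta>))"
    and "nexp d (N.inc (real i * \<delta>) (real (Suc i) * \<delta>))"
    and "nexp (d + d) (jinc (real i * \<delta>) (real (Suc i) * \<delta>))"
proof -
  have "0 \<le> real i * \<delta>" "0 \<le> real (Suc i) * \<delta>" using assms by auto
  note M.nlaw_inc[OF this] N.nlaw_inc[OF this] nlaw_jinc[OF this]
  then show "\<exists>K. nlaw d K (M.inc (real i * \<delta>) (real (Suc i) * \<delta>))"
    "\<exists>K. nlaw d K (N.inc (real i * \<delta>) (real (Suc i) * \<delta>))"
    "nexp d (M.inc (real i * \<delta>) (real (Suc i) * \<delta>))"
    "nexp d (N.inc (real i * \<delta>) (real (Suc i) * \<delta>))"
    "nexp (d + d) (jinc (real i * \<delta>) (real (Suc i) * \<delta>))"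
    by (blast intro: nlaw_nexp)+
qed

lemma nexp_jincl: "0 \<le> \<delta> \<Longrightarrow> nexp ((b - a) * (d + d)) (iter (jincl \<delta> a b))"
proof -
  assume "0 \<le> \<delta>"
  then have "nexp (d + d) T" if "T \<in> set (jincl \<delta> a b)" for T
    using that step_laws(5) by (auto simp: jincl_def simp del: of_nat_Suc)
  from iter_nexp[of "jincl \<delta> a b", OF this] show ?thesis by simp
qed

lemma iter_jincl_fst:
  assumes "0 \<le> \<delta>" "cblip (m * d) \<phi>"
  shows "iter (jincl \<delta> 0 m) (\<lambda>zs. \<phi> (blockmap (take d) (d + d) m zs)) = iter (M.incl \<delta> m) \<phi>"
proof -
  have "list_all2 (\<lambda>A G. nexp d A \<and> nexp (d + d) G \<and> (\<forall>\<phi>. cblip d \<phi> \<longrightarrow> G (\<lambda>x. \<phi> (take d x)) = A \<phi>))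
      (M.incl \<delta> m) (jincl \<delta> 0 m)"
    unfolding list_all2_conv_all_nth using step_laws[OF assms(1)]
      comp_law_fst[OF step_laws(3)[OF assms(1)] step_laws(4)[OF assms(1)]]
    by (simp add: M.incl_def jincl_def jinc_def del: of_nat_Suc)
  from iter_marginal[OF coord_proj_take this, of \<phi>] show ?thesis using assms(2) by simp
qed

lemma iter_jincl_snd:
  assumes "0 \<le> \<delta>" "cblip (m * d) \<phi>"
  shows "iter (jincl \<delta> 0 m) (\<lambda>zs. \<phi> (blockmap (drop d) (d + d) m zs)) = iter (N.incl \<delta> m) \<phi>"
proof -
  have "list_all2 (\<lambda>A G. nexp d A \<and> nexp (d + d) G \<and> (\<forall>\<phi>. cblip d \<phi> \<longrightarrow> G (\<lambda>x. \<phi> (drop d x)) = A \<phi>))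
      (N.incl \<delta> m) (jincl \<delta> 0 m)"
    unfolding list_all2_conv_all_nth using step_laws[OF assms(1)]
      comp_law_snd[OF step_laws(3)[OF assms(1)] step_laws(4)[OF assms(1)]]
    by (simp add: N.incl_def jincl_def jinc_def del: of_nat_Suc)
  from iter_marginal[OF coord_proj_drop this, of \<phi>] show ?thesis using assms(2) by simp
qed

lemma iter_jincl_dom_fst:
  assumes "0 \<le> \<delta>" "cblip (m * (d + d)) \<Phi>" "cblip (m * (d + d)) \<Psi>" "cblip (m * d) f"
    and "\<And>xs. length xs = m * d \<Longrightarrow> 0 \<le> f xs"
    and "\<And>zs. length zs = m * (d + d) \<Longrightarrow> \<Phi> zs \<le> \<Psi> zs + f (blockmap (take d) (d + d) m zs)"
    and "\<And>\<psi> q. cblip (m * d) \<psi> \<Longrightarrow> 1 \<le> q \<Longrightarrow>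
      iter (M.incl \<delta> m) (\<lambda>xs. \<psi> xs + f xs / real q) \<le> iter (M.incl \<delta> m) \<psi> + c / real q"
  shows "iter (jincl \<delta> 0 m) \<Phi> \<le> iter (jincl \<delta> 0 m) \<Psi> + c"
proof -
  have "list_all2 (\<lambda>A G. (\<exists>K. nlaw d K A) \<and> nexp (d + d) G \<and> marg_dom (take d) d A (d + d) G)
      (M.incl \<delta> m) (jincl \<delta> 0 m)"
    unfolding list_all2_conv_all_nth using step_laws[OF assms(1)] marg_dom_fst
    by (simp add: M.incl_def jincl_def jinc_def del: of_nat_Suc)
  then show ?thesis by (rule iter_marg_dom[where f = f, rotated]) (use assms in auto)
qed

lemma iter_jincl_dom_snd:
  assumes "0 \<le> \<delta>" "cblip (m * (d + d)) \<Phi>" "cblip (m * (d + d)) \<Psi>" "cblip (m * d) f"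
    and "\<And>xs. length xs = m * d \<Longrightarrow> 0 \<le> f xs"
    and "\<And>zs. length zs = m * (d + d) \<Longrightarrow> \<Phi> zs \<le> \<Psi> zs + f (blockmap (drop d) (d + d) m zs)"
    and "\<And>\<psi> q. cblip (m * d) \<psi> \<Longrightarrow> 1 \<le> q \<Longrightarrow>
      iter (N.incl \<delta> m) (\<lambda>xs. \<psi> xs + f xs / real q) \<le> iter (N.incl \<delta> m) \<psi> + c / real q"
  shows "iter (jincl \<delta> 0 m) \<Phi> \<le> iter (jincl \<delta> 0 m) \<Psi> + c"
proof -
  have "list_all2 (\<lambda>A G. (\<exists>K. nlaw d K A) \<and> nexp (d + d) G \<and> marg_dom (drop d) d A (d + d) G)
      (N.incl \<delta> m) (jincl \<delta> 0 m)"
    unfolding list_all2_conv_all_nth using step_laws[OF assms(1)] marg_dom_snd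
    by (simp add: N.incl_def jincl_def jinc_def del: of_nat_Suc)
  then show ?thesis by (rule iter_marg_dom[where f = f, rotated]) (use assms in auto)
qed

abbreviation jn :: "nat \<Rightarrow> (real list \<Rightarrow> real) \<Rightarrow> real" where
  "jn n \<equiv> iter (jincl (stp n) 0 (num n))"

lemma nexp_jn: "nexp (num n * (d + d)) (jn n)"
  using nexp_jincl[OF stp_pos(2), of "num n" 0] by simp

text \<open>The 1-norm of the joint path values is the sum of a part for \<open>M\<close> and a part
  for \<open>N\<close>. Each is a function of one marginal path and is charged to that marginal by
  its domination lemma; the moment bounds of the two processes then give one K for all large
  n.\<close>

lemma jn_tight:
  assumes ts: "\<And>t. t \<in> set ts \<Longrightarrow> 0 \<le> t"
  obtains K where "0 \<le> K" "\<forall>\<^sub>F n in sequentially. \<forall>\<phi> \<psi> a b. 0 \<le> b \<longrightarrow>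
      cblip (length ts * (d + d)) \<phi> \<longrightarrow> cblip (length ts * (d + d)) \<psi> \<longrightarrow>
      (\<forall>x. length x = length ts * (d + d) \<longrightarrow> \<phi> x \<le> \<psi> x + a + b * l1 x) \<longrightarrow>
      jn n (\<lambda>zs. \<phi> (sv (d + d) n ts zs)) \<le> jn n (\<lambda>zs. \<psi> (sv (d + d) n ts zs)) + a + b * K"
proof -
  obtain K1 where K1: "0 \<le> K1" "\<forall>\<^sub>F n in sequentially. (\<Sum>t\<leftarrow>ts. real d * M.nm (rnd n t) 0) \<le> K1"
    using M.moment_bounded[OF ts, of ts rnd sequentially] rnd_nonneg rnd_tendsto by metis
  obtain K2 where K2: "0 \<le> K2" "\<forall>\<^sub>F n in sequentially. (\<Sum>t\<leftarrow>ts. real d * N.nm (rnd n t) 0) \<le> K2"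
    using N.moment_bounded[OF ts, of ts rnd sequentially] rnd_nonneg rnd_tendsto by metis
  let ?P = "d + d"
  have ev: "\<forall>\<^sub>F n in sequentially. \<forall>t\<in>set ts. pos n t \<le> num n"
    by (rule eventually_pos_le_num) (rule ts)
  have "\<forall>\<^sub>F n in sequentially. \<forall>\<phi> \<psi> a b. 0 \<le> b \<longrightarrow>
      cblip (length ts * ?P) \<phi> \<longrightarrow> cblip (length ts * ?P) \<psi> \<longrightarrow>
      (\<forall>x. length x = length ts * ?P \<longrightarrow> \<phi> x \<le> \<psi> x + a + b * l1 x) \<longrightarrow>
      jn n (\<lambda>zs. \<phi> (sv ?P n ts zs)) \<le> jn n (\<lambda>zs. \<psi> (sv ?P n ts zs)) + a + b * (K1 + K2)"
    using K1(2) K2(2) ev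
  proof (eventually_elim, intro allI impI)
    fix n \<phi> \<psi> and a b :: real
    assume k1: "(\<Sum>t\<leftarrow>ts. real d * M.nm (rnd n t) 0) \<le> K1"
      and k2: "(\<Sum>t\<leftarrow>ts. real d * N.nm (rnd n t) 0) \<le> K2"
      and pos: "\<forall>t\<in>set ts. pos n t \<le> num n" and b: "0 \<le> b"
      and c: "cblip (length ts * ?P) \<phi>" "cblip (length ts * ?P) \<psi>"
      and le: "\<forall>x. length x = length ts * ?P \<longrightarrow> \<phi> x \<le> \<psi> x + a + b * l1 x"
    define m where "m = num n"
    define js where "js = map (pos n) ts"
    have js: "j \<le> m" if "j \<in> set js" for j using that pos by (auto simp: js_def m_def)
    obtain C1 where C1: "\<And>x. length x = length ts * ?P \<Longrightarrow> \<bar>\<phi> x\<bar> \<le> C1" using cblipE[OF c(1)] by metis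
    obtain C2 where C2: "\<And>x. length x = length ts * ?P \<Longrightarrow> \<bar>\<psi> x\<bar> \<le> C2" using cblipE[OF c(2)] by metis
    \<comment> \<open>The moment function \<open>g\<close> is unbounded, whereas directions have to
      be bounded. Capping at \<open>C\<close> is harmless because \<open>\<phi> - \<psi> - a\<close>
      never exceeds \<open>C\<close>.\<close>
    define C where "C = \<bar>C1\<bar> + \<bar>C2\<bar> + \<bar>a\<bar>"
    have C: "0 \<le> C" by (simp add: C_def)
    define g where "g xs = b * (\<Sum>j\<leftarrow>js. l1 (bsum d j xs))" for xs
    have g_eq: "g xs = b * l1 (sv d n ts xs)" for xs by (simp add: g_def js_def l1_sv o_def)
    have g0: "0 \<le> g xs" for xs using b by (simp add: g_eq)
    define f where "f xs = min C (g xs)" for xs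
    have f0: "0 \<le> f xs" for xs using C g0 by (simp add: f_def)
    have f: "cblip (m * d) f"
    proof (rule cblipI[where C = C and L = "b * real (length ts)"])
      fix x y :: "real list" assume xy: "length x = m * d" "length y = m * d"
      have sc: "pos n t * d \<le> m * d" if "t \<in> set ts" for t using pos that by (simp add: m_def)
      have "l1 (sv d n ts x) \<le> ld (sv d n ts x) (sv d n ts y) + l1 (sv d n ts y)"
        using xy sc by (intro l1_le_ld) (simp add: length_sv)
      also have "ld (sv d n ts x) (sv d n ts y) \<le> real (length ts) * ld x y"
        using xy sc by (intro ld_sv) auto
      finally have "g x \<le> b * (real (length ts) * ld x y + l1 (sv d n ts y))"
        unfolding g_eq using b by (intro mult_left_mono) auto
      then have "g x \<le> g y + b * real (length ts) * ld x y" by (simp add: g_eq algebra_simps)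
      moreover have "0 \<le> b * real (length ts) * ld x y" using b by simp
      ultimately show "f x - f y \<le> b * real (length ts) * ld x y" unfolding f_def by linarith
    qed (use f0 in \<open>simp add: f_def\<close>)
    have \<delta>: "0 < stp n" "0 \<le> stp n" by (rule stp_pos)+
    have sums: "(\<Sum>j\<leftarrow>js. real d * M.nm (real j * stp n) 0) \<le> K1" "(\<Sum>j\<leftarrow>js. real d * N.nm (real j * stp n) 0) \<le> K2"
      using k1 k2 by (simp_all add: js_def rnd_def o_def)
    note fM = M.iter_incl_moment[OF \<delta>(1) js b _ _ sums(1) f] and fN = N.iter_incl_moment[OF \<delta>(1) js b _ _ sums(2) f]
    have fg: "f xs \<le> b * (\<Sum>j\<leftarrow>js. l1 (bsum d j xs))" for xs by (simp add: f_def g_def)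
    let ?B1 = "blockmap (take d) ?P m" and ?B2 = "blockmap (drop d) ?P m"
    have c\<phi>: "cblip (m * ?P) (\<lambda>zs. \<phi> (sv ?P n ts zs))" and c\<psi>: "cblip (m * ?P) (\<lambda>zs. \<psi> (sv ?P n ts zs))"
      using pos by (auto intro!: cblip_sv c simp: m_def)
    have fB: "cblip (m * ?P) (\<lambda>zs. f (?B2 zs))"
      by (rule cblip_comp[OF f, where K = 1])
        (use ld_blockmap[OF coord_proj_drop] length_blockmap[OF coord_proj_drop] in auto)
    \<comment> \<open>If neither term is capped, their sum is the full moment; otherwise a single
      capped term, equal to \<open>C\<close>, already suffices.\<close>
    have key: "\<phi> (sv ?P n ts zs) \<le> \<psi> (sv ?P n ts zs) + a + f (?B2 zs) + f (?B1 zs)"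
      if zs: "length zs = m * ?P" for zs
    proof -
      have sc: "pos n t * ?P \<le> m * ?P" if "t \<in> set ts" for t using pos that by (simp add: m_def)
      have len: "length (sv ?P n ts zs) = length ts * ?P" using zs sc by (intro length_sv) auto
      have "l1 (sv ?P n ts zs) = (\<Sum>t\<leftarrow>ts. l1 (take d (bsum ?P (pos n t) zs)) + l1 (drop d (bsum ?P (pos n t) zs)))"
        unfolding l1_sv l1_simps(3)[symmetric] by simp
      also have "\<dots> = l1 (concat (map (\<lambda>t. take d (bsum ?P (pos n t) zs)) ts))
          + l1 (concat (map (\<lambda>t. drop d (bsum ?P (pos n t) zs)) ts))"
        by (induction ts) auto
      also have "\<dots> = l1 (sv d n ts (?B1 zs)) + l1 (sv d n ts (?B2 zs))"
        using sv_blockmap[OF coord_proj_take zs] sv_blockmap[OF coord_proj_drop zs] pos by (simp add: m_def)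
      finally have "b * l1 (sv ?P n ts zs) = g (?B1 zs) + g (?B2 zs)" by (simp add: g_eq distrib_left)
      then have "\<phi> (sv ?P n ts zs) \<le> \<psi> (sv ?P n ts zs) + a + (g (?B1 zs) + g (?B2 zs))"
        using le len by metis
      moreover have "\<phi> (sv ?P n ts zs) \<le> \<psi> (sv ?P n ts zs) + a + C"
        using C1[OF len] C2[OF len] by (simp add: C_def)
      ultimately show ?thesis
        using C g0[of "?B1 zs"] g0[of "?B2 zs"] unfolding f_def by linarith
    qed
    have "jn n (\<lambda>zs. \<phi> (sv ?P n ts zs)) \<le> jn n (\<lambda>zs. \<psi> (sv ?P n ts zs) + a + f (?B2 zs)) + b * K1"
      unfolding m_def[symmetric]
      by (rule iter_jincl_dom_fst[OF \<delta>(2) c\<phi> _ f f0 key fM]) (intro cblip_add c\<psi> cblip_const fB fg | assumption)+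
    also have "jn n (\<lambda>zs. \<psi> (sv ?P n ts zs) + a + f (?B2 zs)) \<le> jn n (\<lambda>zs. \<psi> (sv ?P n ts zs) + a) + b * K2"
      unfolding m_def[symmetric]
      by (rule iter_jincl_dom_snd[OF \<delta>(2) _ _ f f0 _ fN]) (intro cblip_add c\<psi> cblip_const fB fg | simp)+
    also have "jn n (\<lambda>zs. \<psi> (sv ?P n ts zs) + a) = jn n (\<lambda>zs. \<psi> (sv ?P n ts zs)) + a"
      using c\<psi> unfolding m_def by (rule nexp_shift[OF nexp_jn])
    finally show "jn n (\<lambda>zs. \<phi> (sv ?P n ts zs)) \<le> jn n (\<lambda>zs. \<psi> (sv ?P n ts zs)) + a + b * (K1 + K2)"
      by (simp add: algebra_simps)
  qed
  moreover have "0 \<le> K1 + K2" using K1(1) K2(1) by simp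
  ultimately show ?thesis using that by blast
qed

end

lemma iter_cong_laws:
  assumes "list_all2 (\<lambda>T U. nexp p T \<and> nexp p U \<and> (\<forall>\<phi>. cblip p \<phi> \<longrightarrow> T \<phi> = U \<phi>)) Ts Us"
    and "cblip (length Ts * p) \<phi>"
  shows "iter Ts \<phi> = iter Us \<phi>"
  using assms
proof (induction Ts Us arbitrary: \<phi> rule: list_all2_induct)
  case (Cons T Ts U Us)
  have T: "nexp p T" and eq: "\<And>\<phi>. cblip p \<phi> \<Longrightarrow> T \<phi> = U \<phi>" using Cons.hyps by auto
  have "\<forall>T\<in>set Ts. nexp p T"
    using Cons.hyps(2) by (induction rule: list_all2_induct) auto
  then have Ts: "nexp (length Ts * p) (iter Ts)" by (auto intro: iter_nexp)
  have c: "cblip (p + length Ts * p) \<phi>" using Cons.prems by simp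
  have U: "nexp p U" using Cons.hyps by auto
  have "iter (T # Ts) \<phi> = U (\<lambda>x. iter Ts (\<lambda>xs. \<phi> (x @ xs)))"
    unfolding iter.simps by (rule eq[OF cblip_partial[OF Ts c]])
  also have "\<dots> = U (\<lambda>x. iter Us (\<lambda>xs. \<phi> (x @ xs)))"
    by (rule nexp_cong[OF U cblip_partial[OF Ts c]]) (rule Cons.IH[OF cblip_section[OF c]])
  finally show ?case by simp
qed simp

section \<open>Increments of the joint chain at a fixed level\<close>

context coupled
begin

text \<open>The increments after step b do not enter \<Phi>, so their laws act on constants and
  disappear.\<close>

lemma iter_jincl_split:
  assumes \<delta>: "0 \<le> \<delta>" and ab: "a \<le> b" "b \<le> m" and \<Phi>: "cblip (m * (d + d)) \<Phi>"
    and eq: "\<And>xs ys ws. length xs = a * (d + d) \<Longrightarrow> length ys = (b - a) * (d + d) \<Longrightarrow>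
      length ws = (m - b) * (d + d) \<Longrightarrow> \<Phi> (xs @ ys @ ws) = \<Psi> xs ys"
  shows "iter (jincl \<delta> 0 m) \<Phi> = iter (jincl \<delta> 0 a) (\<lambda>xs. iter (jincl \<delta> a b) (\<Psi> xs))"
proof -
  let ?P = "d + d"
  have "[0..<m] = [0..<a] @ [a..<b] @ [b..<m]"
    using ab by (metis le_trans le_iff_add upt_add_eq_append zero_le)
  then have "jincl \<delta> 0 m = jincl \<delta> 0 a @ jincl \<delta> a b @ jincl \<delta> b m" by (simp add: jincl_def)
  then have *: "iter (jincl \<delta> 0 m) \<Phi>
      = iter (jincl \<delta> 0 a) (\<lambda>xs. iter (jincl \<delta> a b) (\<lambda>ys. iter (jincl \<delta> b m) (\<lambda>ws. \<Phi> (xs @ ys @ ws))))"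
    by (simp add: iter_append)
  have A: "nexp (a * ?P) (iter (jincl \<delta> 0 a))" and B: "nexp ((b - a) * ?P) (iter (jincl \<delta> a b))"
    and C: "nexp ((m - b) * ?P) (iter (jincl \<delta> b m))"
    using nexp_jincl[OF \<delta>] nexp_jincl[OF \<delta>, of a 0] by simp_all
  have "m * ?P = (a * ?P + (b - a) * ?P) + (m - b) * ?P"
    using ab by (simp flip: distrib_right)
  then have "cblip ((a * ?P + (b - a) * ?P) + (m - b) * ?P) \<Phi>" using \<Phi> by simp
  from cblip_partial[OF C this]
  have c1: "cblip (a * ?P + (b - a) * ?P) (\<lambda>xys. iter (jincl \<delta> b m) (\<lambda>ws. \<Phi> (xys @ ws)))" .
  have c2: "cblip (a * ?P) (\<lambda>xs. iter (jincl \<delta> a b) (\<lambda>ys. iter (jincl \<delta> b m) (\<lambda>ws. \<Phi> (xs @ ys @ ws))))"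
    using cblip_partial[OF B c1] by simp
  show ?thesis
    unfolding *
  proof (rule nexp_cong[OF A c2])
    fix xs :: "real list" assume xs: "length xs = a * ?P"
    show "iter (jincl \<delta> a b) (\<lambda>ys. iter (jincl \<delta> b m) (\<lambda>ws. \<Phi> (xs @ ys @ ws))) = iter (jincl \<delta> a b) (\<Psi> xs)"
    proof (rule nexp_cong[OF B])
      show "cblip ((b - a) * ?P) (\<lambda>ys. iter (jincl \<delta> b m) (\<lambda>ws. \<Phi> (xs @ ys @ ws)))"
        using cblip_section[OF c1 xs] by simp
      fix ys :: "real list" assume ys: "length ys = (b - a) * ?P"
      have "iter (jincl \<delta> b m) (\<lambda>ws. \<Psi> xs ys) = iter (jincl \<delta> b m) (\<lambda>ws. \<Phi> (xs @ ys @ ws))"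
        by (rule nexp_cong[OF C]) (use eq[OF xs ys] in auto)
      then show "iter (jincl \<delta> b m) (\<lambda>ws. \<Phi> (xs @ ys @ ws)) = \<Psi> xs ys"
        using nexp_const[OF C] by simp
    qed
  qed
qed

text \<open>Law at level n of the joint increment between two rounded times. As successive
  increments are independent, it is also the conditional law given the past.\<close>

definition jlaw :: "nat \<Rightarrow> real \<Rightarrow> real \<Rightarrow> (real list \<Rightarrow> real) \<Rightarrow> real" where
  "jlaw n s t \<theta> = iter (jincl (stp n) (pos n s) (pos n t)) (\<lambda>ys. \<theta> (bsum (d + d) (pos n t - pos n s) ys))"

lemma cblip_jlaw_arg:
  "cblip (d + d) \<theta> \<Longrightarrow> cblip (k * (d + d)) (\<lambda>ys. \<theta> (bsum (d + d) k ys))"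
  by (rule cblip_bsum) auto

lemma nexp_jlaw: "nexp (d + d) (jlaw n s t)"
proof -
  have T: "nexp ((pos n t - pos n s) * (d + d)) (iter (jincl (stp n) (pos n s) (pos n t)))"
    by (rule nexp_jincl[OF stp_pos(2)])
  show ?thesis
    unfolding nexp_def
  proof (intro conjI allI impI)
    fix c show "jlaw n s t (\<lambda>_. c) = c" using nexp_const[OF T] by (simp add: jlaw_def)
  next
    fix \<phi> \<psi> :: "real list \<Rightarrow> real" and a
    assume "cblip (d + d) \<phi>" "cblip (d + d) \<psi>" "\<forall>x. length x = d + d \<longrightarrow> \<phi> x \<le> \<psi> x + a"
    then show "jlaw n s t \<phi> \<le> jlaw n s t \<psi> + a"
      unfolding jlaw_def by (intro nexp_le[OF T] cblip_jlaw_arg) auto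
  qed
qed

lemma cblip_sv_incr:
  assumes "\<And>t. t \<in> set ts \<Longrightarrow> pos n t \<le> m" "pos n s \<le> m" "pos n t' \<le> m"
    and "cblip (length ts * p + p) \<phi>"
  shows "cblip (m * p) (\<lambda>zs. \<phi> (sv p n ts zs @ vsub (bsum p (pos n t') zs) (bsum p (pos n s) zs)))"
proof (rule cblip_comp[OF assms(4), where K = "real (length ts) + 2"])
  have sc: "pos n t * p \<le> m * p" if "t \<in> set ts" for t using assms(1)[OF that] by simp
  have sc': "pos n s * p \<le> m * p" "pos n t' * p \<le> m * p" using assms(2,3) by simp_all
  fix x y :: "real list"
  assume x: "length x = m * p"
  then show "length (sv p n ts x @ vsub (bsum p (pos n t') x) (bsum p (pos n s) x)) = length ts * p + p"
    using sc sc' by (simp add: length_sv)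
  assume y: "length y = m * p"
  have "ld (vsub (bsum p (pos n t') x) (bsum p (pos n s) x)) (vsub (bsum p (pos n t') y) (bsum p (pos n s) y))
      \<le> ld (bsum p (pos n t') x) (bsum p (pos n t') y) + ld (bsum p (pos n s) x) (bsum p (pos n s) y)"
    using x y sc' by (intro ld_vsub[of _ p]) auto
  also have "\<dots> \<le> ld x y + ld x y" using x y sc' by (intro add_mono ld_bsum) auto
  finally have "ld (vsub (bsum p (pos n t') x) (bsum p (pos n s) x)) (vsub (bsum p (pos n t') y) (bsum p (pos n s) y))
      \<le> 2 * ld x y" by simp
  moreover have "ld (sv p n ts x) (sv p n ts y) \<le> real (length ts) * ld x y"
    using x y sc by (intro ld_sv) auto
  ultimately show "ld (sv p n ts x @ vsub (bsum p (pos n t') x) (bsum p (pos n s) x))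
      (sv p n ts y @ vsub (bsum p (pos n t') y) (bsum p (pos n s) y)) \<le> (real (length ts) + 2) * ld x y"
    using x y sc by (subst vsub_append) (auto simp: length_sv distrib_right)
qed

lemma sv_append1:
  "(\<And>t. t \<in> set ts \<Longrightarrow> pos n t * p \<le> length xs) \<Longrightarrow> sv p n ts (xs @ ys) = sv p n ts xs"
  by (induction ts) (auto simp: sv_def bsum_append1)

text \<open>Independence is exact on the grid: the values up to time s use the blocks before
  \<open>pos n s\<close>, and the increment is the sum of the blocks from there to
  \<open>pos n t'\<close>.\<close>

lemma jn_incr:
  assumes ts: "\<And>t. t \<in> set ts \<Longrightarrow> t \<le> s" and st: "s \<le> t'" and num: "pos n t' \<le> num n"
    and \<phi>: "cblip (length ts * (d + d) + (d + d)) \<phi>"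
  shows "jn n (\<lambda>zs. \<phi> (sv (d + d) n ts zs @ vsub (bsum (d + d) (pos n t') zs) (bsum (d + d) (pos n s) zs)))
    = jn n (\<lambda>zs. jlaw n s t' (\<lambda>y. \<phi> (sv (d + d) n ts zs @ y)))"
proof -
  let ?P = "d + d" and ?a = "pos n s" and ?b = "pos n t'"
  have ab: "?a \<le> ?b" using st by (rule pos_mono)
  have tsa: "pos n t \<le> ?a" if "t \<in> set ts" for t using ts[OF that] by (rule pos_mono)
  have tsn: "pos n t \<le> num n" if "t \<in> set ts" for t using tsa[OF that] ab num by linarith
  have sva: "sv ?P n ts (xs @ ys) = sv ?P n ts xs" if "length xs = ?a * ?P" for xs ys
    using tsa that by (intro sv_append1) (simp add: mult_le_mono1)
  have c1: "cblip (num n * ?P) (\<lambda>zs. \<phi> (sv ?P n ts zs @ vsub (bsum ?P ?b zs) (bsum ?P ?a zs)))"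
    using tsn ab num \<phi> by (intro cblip_sv_incr) auto
  have "jn n (\<lambda>zs. \<phi> (sv ?P n ts zs @ vsub (bsum ?P ?b zs) (bsum ?P ?a zs)))
      = iter (jincl (stp n) 0 ?a) (\<lambda>xs. iter (jincl (stp n) ?a ?b)
          (\<lambda>ys. \<phi> (sv ?P n ts xs @ bsum ?P (?b - ?a) ys)))"
  proof (rule iter_jincl_split[OF stp_pos(2) ab num c1])
    fix xs ys ws :: "real list"
    assume l: "length xs = ?a * ?P" "length ys = (?b - ?a) * ?P" "length ws = (num n - ?b) * ?P"
    have "bsum ?P ?a (xs @ ys @ ws) = bsum ?P ?a xs" using l by (intro bsum_append1) simp
    moreover have "bsum ?P ?b (xs @ ys @ ws) = vadd (bsum ?P ?a xs) (bsum ?P (?b - ?a) ys)"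
    proof -
      have "bsum ?P (?a + (?b - ?a)) (xs @ (ys @ ws)) = vadd (bsum ?P ?a xs) (bsum ?P (?b - ?a) (ys @ ws))"
        using l by (intro bsum_append) auto
      moreover have "bsum ?P (?b - ?a) (ys @ ws) = bsum ?P (?b - ?a) ys" using l by (intro bsum_append1) simp
      ultimately show ?thesis using ab by simp
    qed
    ultimately show "\<phi> (sv ?P n ts (xs @ ys @ ws) @ vsub (bsum ?P ?b (xs @ ys @ ws)) (bsum ?P ?a (xs @ ys @ ws)))
        = \<phi> (sv ?P n ts xs @ bsum ?P (?b - ?a) ys)"
      using l sva by (simp add: vsub_vadd)
  qed
  \<comment> \<open>The integrand on this side depends on the blocks before \<open>pos n s\<close>
    only, so the same splitting applies with a constant integrand for the middle blocks.\<close>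
  moreover have "jn n (\<lambda>zs. jlaw n s t' (\<lambda>y. \<phi> (sv ?P n ts zs @ y)))
      = iter (jincl (stp n) 0 ?a) (\<lambda>xs. iter (jincl (stp n) ?a ?b) (\<lambda>_. jlaw n s t' (\<lambda>y. \<phi> (sv ?P n ts xs @ y))))"
  proof (rule iter_jincl_split[OF stp_pos(2) ab num])
    show "cblip (num n * ?P) (\<lambda>zs. jlaw n s t' (\<lambda>y. \<phi> (sv ?P n ts zs @ y)))"
      using cblip_partial[OF nexp_jlaw \<phi>] tsn by (intro cblip_sv) auto
  qed (simp add: sva)
  ultimately show ?thesis
    using nexp_const[OF nexp_jincl[OF stp_pos(2)]] by (simp add: jlaw_def)
qed

lemma jn_proj:
  assumes pr: "coord_proj pr (d + d) d" and pos: "\<And>t. t \<in> set ts \<Longrightarrow> pos n t \<le> num n"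
    and c: "cblip (num n * d) (\<lambda>xs. \<phi> (sv d n ts xs))"
  shows "jn n (\<lambda>zs. \<phi> (concat (map (\<lambda>t. pr (bsum (d + d) (pos n t) zs)) ts)))
    = jn n (\<lambda>zs. \<phi> (sv d n ts (blockmap pr (d + d) (num n) zs)))"
proof (rule nexp_cong[OF nexp_jn, symmetric])
  show "cblip (num n * (d + d)) (\<lambda>zs. \<phi> (sv d n ts (blockmap pr (d + d) (num n) zs)))"
    by (rule cblip_comp[OF c, where K = 1]) (use ld_blockmap[OF pr] length_blockmap[OF pr] in auto)
qed (use sv_blockmap[OF pr] pos in auto)

lemma jn_fst:
  assumes "\<And>t. t \<in> set ts \<Longrightarrow> pos n t \<le> num n" "cblip (length ts * d) \<phi>"
  shows "jn n (\<lambda>zs. \<phi> (concat (map (\<lambda>t. take d (bsum (d + d) (pos n t) zs)) ts)))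
    = E1 (\<lambda>\<omega>. \<phi> (fdv M (map (rnd n) ts) \<omega>))"
proof -
  have c: "cblip (num n * d) (\<lambda>xs. \<phi> (sv d n ts xs))" using assms by (intro cblip_sv) auto
  show ?thesis
    using jn_proj[where \<phi> = \<phi>, OF coord_proj_take assms(1) c] iter_jincl_fst[OF stp_pos(2) c] M.iter_incl[OF stp_pos(1) c]
      M.sv_incs[OF assms(1)] by simp
qed

lemma jn_snd:
  assumes "\<And>t. t \<in> set ts \<Longrightarrow> pos n t \<le> num n" "cblip (length ts * d) \<phi>"
  shows "jn n (\<lambda>zs. \<phi> (concat (map (\<lambda>t. drop d (bsum (d + d) (pos n t) zs)) ts)))
    = E2 (\<lambda>\<omega>. \<phi> (fdv N (map (rnd n) ts) \<omega>))"
proof -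
  have c: "cblip (num n * d) (\<lambda>xs. \<phi> (sv d n ts xs))" using assms by (intro cblip_sv) auto
  show ?thesis
    using jn_proj[where \<phi> = \<phi>, OF coord_proj_drop assms(1) c] iter_jincl_snd[OF stp_pos(2) c] N.iter_incl[OF stp_pos(1) c]
      N.sv_incs[OF assms(1)] by simp
qed

lemma iter_jincl_stat:
  assumes st: "stat_incr E1 d M" "stat_incr E2 d N" and \<delta>: "0 \<le> \<delta>" and \<phi>: "cblip (k * (d + d)) \<phi>"
  shows "iter (jincl \<delta> a (a + k)) \<phi> = iter (jincl \<delta> 0 k) \<phi>"
proof -
  have one: "jinc (real i * \<delta>) (real (Suc i) * \<delta>) \<theta> = jinc 0 \<delta> \<theta>" if \<theta>: "cblip (d + d) \<theta>" for i \<theta>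
  proof -
    have i: "0 \<le> real i * \<delta>" "real i * \<delta> \<le> real (Suc i) * \<delta>" "real (Suc i) * \<delta> - real i * \<delta> = \<delta>"
      using \<delta> by (auto simp: algebra_simps)
    have "jinc (real i * \<delta>) (real (Suc i) * \<delta>) \<theta>
        = M.inc (real i * \<delta>) (real (Suc i) * \<delta>) (\<lambda>x. N.inc 0 \<delta> (\<lambda>y. \<theta> (x @ y)))"
      unfolding jinc_def comp_law_def
      using N.stat_inc[OF st(2) i(1,2) cblip_section[OF \<theta>]] unfolding i(3)
      by (intro nexp_cong[OF step_laws(3)[OF \<delta>]] cblip_partial[OF step_laws(4)[OF \<delta>] \<theta>]) auto
    also have "\<dots> = M.inc 0 \<delta> (\<lambda>x. N.inc 0 \<delta> (\<lambda>y. \<theta> (x @ y)))"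
      using M.stat_inc[OF st(1) i(1,2) cblip_partial[OF nlaw_nexp[OF N.nlaw_inc] \<theta>]] \<delta> unfolding i(3) by simp
    finally show ?thesis by (simp add: jinc_def comp_law_def)
  qed
  have "list_all2 (\<lambda>T U. nexp (d + d) T \<and> nexp (d + d) U \<and> (\<forall>\<phi>. cblip (d + d) \<phi> \<longrightarrow> T \<phi> = U \<phi>))
      (jincl \<delta> a (a + k)) (jincl \<delta> 0 k)"
    unfolding list_all2_conv_all_nth using step_laws(5)[OF \<delta>] one
    by (simp add: jincl_def del: of_nat_Suc of_nat_add)
  then show ?thesis by (rule iter_cong_laws) (use \<phi> in simp)
qed

lemma jlaw_stat:
  assumes st: "stat_incr E1 d M" "stat_incr E2 d N" and s: "0 \<le> s" and t: "0 \<le> t" and \<theta>: "cblip (d + d) \<theta>"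
  shows "(\<lambda>n. jlaw n s (t + s) \<theta> - jlaw n 0 t \<theta>) \<longlonglongrightarrow> 0"
proof -
  let ?P = "d + d"
  obtain L where L: "0 \<le> L" "\<And>x y. length x = ?P \<Longrightarrow> length y = ?P \<Longrightarrow> \<bar>\<theta> x - \<theta> y\<bar> \<le> L * ld x y"
    using cblipE[OF \<theta>] by metis
  \<comment> \<open>By stationarity of the one-step laws, \<open>jlaw\<close> depends only on the
    number of steps k between the rounded times.\<close>
  define J where "J n k = iter (jincl (stp n) 0 k) (\<lambda>ys. \<theta> (bsum ?P k ys))" for n k
  have jl: "jlaw n u v \<theta> = J n (pos n v - pos n u)" if "u \<le> v" for n u v
    using iter_jincl_stat[OF st stp_pos(2) cblip_jlaw_arg[OF \<theta>], of n "pos n u" "pos n v - pos n u"]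
      pos_mono[OF that, of n] by (simp add: jlaw_def J_def)
  \<comment> \<open>The grid time one step after \<open>rnd n t\<close>. The increment between the
    two carries the cost of a possible extra step, which vanishes because both times tend to
    t.\<close>
  define r' where "r' n = real (Suc (pos n t)) * stp n" for n
  have r': "r' n = rnd n t + stp n" "0 \<le> r' n" for n
    using stp_pos(2)[of n] by (simp_all add: r'_def rnd_def algebra_simps)
  define \<kappa> where "\<kappa> n = real d * M.nm (rnd n t) (r' n) + real d * N.nm (rnd n t) (r' n)" for n
  have \<kappa>0: "0 \<le> \<kappa> n" for n
    unfolding \<kappa>_def using M.nm_nonneg[OF rnd_nonneg r'(2)] N.nm_nonneg[OF rnd_nonneg r'(2)] by simp
  have step: "\<bar>J n (Suc (pos n t)) - J n (pos n t)\<bar> \<le> L * \<kappa> n" for n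
  proof -
    let ?k = "pos n t"
    let ?G = "jinc (real ?k * stp n) (real (Suc ?k) * stp n)"
    have G: "nlaw ?P (\<kappa> n) ?G"
      using nlaw_jinc[OF rnd_nonneg r'(2), of n t n] by (simp add: \<kappa>_def rnd_def r'_def)
    have A: "nexp (?k * ?P) (iter (jincl (stp n) 0 ?k))" using nexp_jincl[OF stp_pos(2), of ?k 0] by simp
    have c: "cblip (?k * ?P + ?P) (\<lambda>ys. \<theta> (bsum ?P (Suc ?k) ys))"
      using cblip_jlaw_arg[OF \<theta>, of "Suc ?k"] by (simp add: add.commute)
    have "J n (Suc ?k) = iter (jincl (stp n) 0 ?k) (\<lambda>xs. ?G (\<lambda>y. \<theta> (bsum ?P (Suc ?k) (xs @ y))))"
      by (simp add: J_def jincl_def iter_append)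
    moreover have "\<bar>?G (\<lambda>y. \<theta> (bsum ?P (Suc ?k) (xs @ y))) - \<theta> (bsum ?P ?k xs)\<bar> \<le> L * \<kappa> n"
      if xs: "length xs = ?k * ?P" for xs
    proof -
      let ?w = "bsum ?P ?k xs"
      have b: "bsum ?P (Suc ?k) (xs @ y) = vadd ?w y" if "length y = ?P" for y
        using bsum_append[OF xs, of 1 y] that by simp
      have w: "length ?w = ?P" using xs by simp
      have le: "\<bar>\<theta> (bsum ?P (Suc ?k) (xs @ y)) - \<theta> ?w\<bar> \<le> L * l1 y" if "length y = ?P" for y
        using L(2)[of "vadd ?w y" ?w] w that unfolding b[OF that] by (simp add: ld_vadd_self)
      have "?G (\<lambda>y. \<theta> (bsum ?P (Suc ?k) (xs @ y))) \<le> ?G (\<lambda>_. \<theta> ?w) + 0 + L * \<kappa> n"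
        using le by (intro nlawD[OF G L(1) cblip_section[OF c xs]]) (auto simp: abs_le_iff algebra_simps)
      moreover have "?G (\<lambda>_. \<theta> ?w) \<le> ?G (\<lambda>y. \<theta> (bsum ?P (Suc ?k) (xs @ y))) + 0 + L * \<kappa> n"
        using le by (intro nlawD[OF G L(1) _ cblip_section[OF c xs]]) (auto simp: abs_le_iff algebra_simps)
      ultimately show ?thesis using nexp_const[OF nlaw_nexp[OF G]] by (simp add: abs_le_iff)
    qed
    ultimately show ?thesis
      unfolding J_def
      using nexp_abs_diff[OF A cblip_partial[OF nlaw_nexp[OF G] c] cblip_jlaw_arg[OF \<theta>], of "L * \<kappa> n"]
      by simp
  qed
  have bd: "norm (jlaw n s (t + s) \<theta> - jlaw n 0 t \<theta>) \<le> L * \<kappa> n" for n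
  proof -
    \<comment> \<open>The three roundings together leave a number of steps that is either
      \<open>pos n t\<close> or one more.\<close>
    have "real (pos n (t + s)) - real (pos n s) < real (pos n t) + 2"
      "real (pos n t) < real (pos n (t + s)) - real (pos n s) + 1"
      using pos_bounds(1)[OF s, of n] pos_bounds(1)[OF t, of n] pos_bounds(1)[of "t + s" n]
        pos_bounds(2)[of s n] pos_bounds(2)[of t n] pos_bounds(2)[of "t + s" n] s t
      by (simp_all add: distrib_right)
    then have "pos n (t + s) - pos n s = pos n t \<or> pos n (t + s) - pos n s = Suc (pos n t)"
      by linarith
    moreover have "jlaw n s (t + s) \<theta> = J n (pos n (t + s) - pos n s)" "jlaw n 0 t \<theta> = J n (pos n t)"
      using jl[of s "t + s" n] jl[of 0 t n] t by simp_all
    ultimately show ?thesis using step[of n] L(1) \<kappa>0[of n] by auto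
  qed
  have lim: "(\<lambda>n. L * \<kappa> n) \<longlonglongrightarrow> 0"
  proof -
    have r'_lim: "r' \<longlonglongrightarrow> t"
      using tendsto_add[OF rnd_tendsto[OF t] stp_tendsto] by (simp add: r'(1)[abs_def])
    have "(\<lambda>n. M.nm (rnd n t) (r' n)) \<longlonglongrightarrow> 0" "(\<lambda>n. N.nm (rnd n t) (r' n)) \<longlonglongrightarrow> 0"
      by (rule M.nm_tendsto2 N.nm_tendsto2; rule t rnd_nonneg r'(2) rnd_tendsto[OF t] r'_lim)+
    then show ?thesis
      unfolding \<kappa>_def by (intro tendsto_mult_right_zero tendsto_add_zero)
  qed
  show ?thesis by (rule Lim_null_comparison[OF always_eventually lim]) (intro allI bd)
qed

end

section \<open>Passage to the limit\<close>

text \<open>The sample space is the whole type of functions, so values of the wrong length are cut off or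
  padded with zeros.\<close>

definition crd :: "nat \<Rightarrow> real \<Rightarrow> (real \<Rightarrow> real list) \<Rightarrow> real list" where
  "crd p t w = (if t = 0 then replicate p 0 else take p (w t @ replicate p 0))"

definition scale :: "real \<Rightarrow> (real \<Rightarrow> real list) \<Rightarrow> real \<Rightarrow> real list" where
  "scale c w t = map ((*) c) (w t)"

lemma length_crd [simp]: "length (crd p t w) = p"
  by (auto simp: crd_def min_def)

lemma crd_0 [simp]: "crd p 0 w = replicate p 0"
  by (simp add: crd_def)

lemma crd_eq: "length (w t) = p \<Longrightarrow> t \<noteq> 0 \<Longrightarrow> crd p t w = w t"
  by (simp add: crd_def)

lemma crd_scale: "crd p t (scale c w) = map ((*) c) (crd p t w)"
  by (simp add: crd_def scale_def flip: take_map)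

lemma length_fdv_crd [simp]: "length (fdv (crd p) ts w) = length ts * p"
  by (induction ts) (auto simp: fdv_def)

lemma ld_fdv_append:
  "ld (fdv (crd p) (ts @ us) w) (fdv (crd p) (ts @ us) w')
    = ld (fdv (crd p) ts w) (fdv (crd p) ts w') + ld (fdv (crd p) us w) (fdv (crd p) us w')"
proof -
  have "fdv (crd p) (ts @ us) w = fdv (crd p) ts w @ fdv (crd p) us w" for w by (simp add: fdv_def)
  then show ?thesis by simp
qed

lemma ld_fdv_single: "ld (fdv X [t] w) (fdv X [t] w') = ld (X t w) (X t w')"
  by (simp add: fdv_def)

lemma l1_eq_sum_nth: "l1 xs = (\<Sum>i<length xs. \<bar>xs ! i\<bar>)"
  by (simp add: l1_def sum_list_sum_nth atLeast0LessThan)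

lemma ld_eq_sum_nth: "length x = n \<Longrightarrow> length y = n \<Longrightarrow> ld x y = (\<Sum>i<n. \<bar>x ! i - y ! i\<bar>)"
  by (simp add: l1_eq_sum_nth)

section \<open>Cylinder functions on path space\<close>

definition cyl :: "nat \<Rightarrow> ((real \<Rightarrow> real list) \<Rightarrow> real) \<Rightarrow> bool" where
  "cyl p f \<longleftrightarrow> (\<exists>ts L. (\<forall>t\<in>set ts. 0 \<le> t) \<and> 0 \<le> L \<and>
     (\<forall>w w'. \<bar>f w - f w'\<bar> \<le> L * ld (fdv (crd p) ts w) (fdv (crd p) ts w')))"

definition cbd :: "nat \<Rightarrow> ((real \<Rightarrow> real list) \<Rightarrow> real) set" where
  "cbd p = {f. cyl p f \<and> (\<exists>C. \<forall>w. \<bar>f w\<bar> \<le> C)}"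

text \<open>The factor c runs over all reals, negative ones included, so that such a function is odd
  and cannot be bounded on one side unless it vanishes.\<close>

definition chom :: "nat \<Rightarrow> ((real \<Rightarrow> real list) \<Rightarrow> real) set" where
  "chom p = {f. cyl p f \<and> (\<forall>c w. f (scale c w) = c * f w)}"

text \<open>The coordinates must belong to the space although they are unbounded, while the limit is
  available for bounded functions only. Adding just the homogeneous functions is enough, since
  composition with a bounded Lipschitz function leads back to the bounded ones.\<close>

definition csp :: "nat \<Rightarrow> ((real \<Rightarrow> real list) \<Rightarrow> real) set" where
  "csp p = {f. \<exists>b\<in>cbd p. \<exists>l\<in>chom p. f = (\<lambda>w. b w + l w)}"

text \<open>Unique on \<open>csp p\<close>: the bounded parts of two decompositions differ by a
  function that is both bounded and homogeneous, hence zero.\<close>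

definition bpart :: "nat \<Rightarrow> ((real \<Rightarrow> real list) \<Rightarrow> real) \<Rightarrow> (real \<Rightarrow> real list) \<Rightarrow> real" where
  "bpart p f = (SOME b. b \<in> cbd p \<and> (\<lambda>w. f w - b w) \<in> chom p)"

lemma cylI:
  assumes "\<And>t. t \<in> set ts \<Longrightarrow> 0 \<le> t" "0 \<le> L"
    and "\<And>w w'. f w - f w' \<le> L * ld (fdv (crd p) ts w) (fdv (crd p) ts w')"
  shows "cyl p f"
proof -
  have "\<bar>f w - f w'\<bar> \<le> L * ld (fdv (crd p) ts w) (fdv (crd p) ts w')" for w w'
    using assms(3)[of w w'] assms(3)[of w' w] ld_sym[of "fdv (crd p) ts w"] by (simp add: abs_le_iff)
  then show ?thesis unfolding cyl_def using assms(1,2) by blast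
qed

lemma cyl_const: "cyl p (\<lambda>_. c)"
  by (rule cylI[of "[]" 0]) auto

lemma cyl_family:
  fixes n :: nat
  assumes "\<And>i. i < n \<Longrightarrow> cyl p (f i)"
  shows "\<exists>ts L. (\<forall>t\<in>set ts. 0 \<le> t) \<and> 0 \<le> L \<and>
      (\<forall>w w'. (\<Sum>i<n. \<bar>f i w - f i w'\<bar>) \<le> L * ld (fdv (crd p) ts w) (fdv (crd p) ts w'))"
  using assms
proof (induction n)
  case 0
  show ?case by (intro exI[of _ "[]"] exI[of _ 0]) auto
next
  case (Suc n)
  obtain ts L where 1: "\<forall>t\<in>set ts. 0 \<le> t" "0 \<le> L"
    "\<And>w w'. (\<Sum>i<n. \<bar>f i w - f i w'\<bar>) \<le> L * ld (fdv (crd p) ts w) (fdv (crd p) ts w')"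
    using Suc.IH Suc.prems by (meson less_SucI)
  obtain us L' where 2: "\<forall>t\<in>set us. 0 \<le> t" "0 \<le> L'"
    "\<And>w w'. \<bar>f n w - f n w'\<bar> \<le> L' * ld (fdv (crd p) us w) (fdv (crd p) us w')"
    using Suc.prems[of n] unfolding cyl_def by blast
  have "(\<Sum>i<Suc n. \<bar>f i w - f i w'\<bar>)
      \<le> (L + L') * ld (fdv (crd p) (ts @ us) w) (fdv (crd p) (ts @ us) w')" for w w'
  proof -
    let ?a = "ld (fdv (crd p) ts w) (fdv (crd p) ts w')" and ?b = "ld (fdv (crd p) us w) (fdv (crd p) us w')"
    have "(\<Sum>i<Suc n. \<bar>f i w - f i w'\<bar>) \<le> L * ?a + L' * ?b"
      using 1(3)[of w w'] 2(3)[of w w'] by simp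
    moreover have "0 \<le> L * ?b" "0 \<le> L' * ?a" using 1(2) 2(2) by simp_all
    ultimately show ?thesis unfolding ld_fdv_append by (simp add: algebra_simps)
  qed
  then show ?case using 1(1,2) 2(1,2) by (intro exI[of _ "ts @ us"] exI[of _ "L + L'"]) auto
qed

lemma cyl_comp:
  assumes "\<And>i. i < n \<Longrightarrow> cyl p (\<lambda>w. Y w ! i)" "\<And>w. length (Y w) = n"
    and "0 \<le> L" "\<And>x y. length x = n \<Longrightarrow> length y = n \<Longrightarrow> \<bar>\<phi> x - \<phi> y\<bar> \<le> L * ld x y"
  shows "cyl p (\<lambda>w. \<phi> (Y w))"
proof -
  obtain ts L' where *: "\<And>t. t \<in> set ts \<Longrightarrow> 0 \<le> t" "0 \<le> L'"
    "\<And>w w'. (\<Sum>i<n. \<bar>Y w ! i - Y w' ! i\<bar>) \<le> L' * ld (fdv (crd p) ts w) (fdv (crd p) ts w')"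
    using cyl_family[of n p "\<lambda>i w. Y w ! i"] assms(1) by auto
  show ?thesis
  proof (rule cylI[OF *(1)])
    fix w w'
    have "\<phi> (Y w) - \<phi> (Y w') \<le> L * ld (Y w) (Y w')"
      using assms(4)[OF assms(2,2), of w w'] by (simp add: abs_le_iff)
    also have "\<dots> \<le> L * (L' * ld (fdv (crd p) ts w) (fdv (crd p) ts w'))"
      using assms(2,3) *(3)[of w w'] by (intro mult_left_mono) (auto simp: ld_eq_sum_nth)
    finally show "\<phi> (Y w) - \<phi> (Y w') \<le> L * L' * ld (fdv (crd p) ts w) (fdv (crd p) ts w')"
      by (simp add: mult.assoc)
  qed (use assms(3) *(2) in auto)
qed

lemma cyl_add:
  assumes "cyl p f" "cyl p g" shows "cyl p (\<lambda>w. f w + g w)"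
proof -
  have "cyl p (\<lambda>w. (\<lambda>x. x ! 0 + x ! 1) [f w, g w])"
  proof (rule cyl_comp[where n = 2 and L = 1])
    show "cyl p (\<lambda>w. [f w, g w] ! i)" if "i < 2" for i
      using that assms by (auto simp: less_2_cases_iff)
    show "\<bar>(x ! 0 + x ! 1) - (y ! 0 + y ! 1)\<bar> \<le> 1 * ld x y" if "length x = 2" "length y = 2" for x y
      using that by (simp add: ld_eq_sum_nth[of _ 2] numeral_2_eq_2)
  qed auto
  then show ?thesis by simp
qed

lemma cyl_cmult:
  assumes "cyl p f" shows "cyl p (\<lambda>w. c * f w)"
proof -
  have "cyl p (\<lambda>w. (\<lambda>x. c * x ! 0) [f w])"
  proof (rule cyl_comp[where n = 1 and L = "\<bar>c\<bar>"])
    show "\<bar>c * x ! 0 - c * y ! 0\<bar> \<le> \<bar>c\<bar> * ld x y" if "length x = 1" "length y = 1" for x y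
      using that by (simp add: ld_eq_sum_nth[of _ 1] abs_mult flip: right_diff_distrib)
  qed (use assms in auto)
  then show ?thesis by simp
qed

lemma cbd_add: "f \<in> cbd p \<Longrightarrow> g \<in> cbd p \<Longrightarrow> (\<lambda>w. f w + g w) \<in> cbd p"
  unfolding cbd_def
proof (clarsimp simp: cyl_add)
  fix C C' assume "\<forall>w. \<bar>f w\<bar> \<le> C" "\<forall>w. \<bar>g w\<bar> \<le> C'"
  then have "\<bar>f w + g w\<bar> \<le> C + C'" for w by (meson abs_triangle_ineq add_mono order_trans)
  then show "\<exists>C. \<forall>w. \<bar>f w + g w\<bar> \<le> C" by blast
qed

lemma cbd_cmult: "f \<in> cbd p \<Longrightarrow> (\<lambda>w. c * f w) \<in> cbd p"
  unfolding cbd_def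
proof (clarsimp simp: cyl_cmult)
  fix C assume "\<forall>w. \<bar>f w\<bar> \<le> C"
  then have "\<bar>c * f w\<bar> \<le> \<bar>c\<bar> * C" for w by (simp add: abs_mult mult_left_mono)
  then show "\<exists>C. \<forall>w. \<bar>c * f w\<bar> \<le> C" by blast
qed

lemma cbd_const: "(\<lambda>_. c) \<in> cbd p"
  by (auto simp: cbd_def cyl_const)

lemma chom_add: "f \<in> chom p \<Longrightarrow> g \<in> chom p \<Longrightarrow> (\<lambda>w. f w + g w) \<in> chom p"
  by (auto simp: chom_def cyl_add distrib_left)

lemma chom_cmult: "f \<in> chom p \<Longrightarrow> (\<lambda>w. c * f w) \<in> chom p"
  by (auto simp: chom_def cyl_cmult)

lemma chom_zero: "(\<lambda>_. 0) \<in> chom p"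
  by (auto simp: chom_def cyl_const)

lemma chom_diff: "f \<in> chom p \<Longrightarrow> g \<in> chom p \<Longrightarrow> (\<lambda>w. f w - g w) \<in> chom p"
  using chom_add[of f p "\<lambda>w. (-1) * g w"] chom_cmult[of g p "-1"] by simp

lemma chom_bounded_below:
  assumes "l \<in> chom p" "\<And>w. - C \<le> l w"
  shows "l w = 0"
proof (rule ccontr)
  assume nz: "l w \<noteq> 0"
  \<comment> \<open>The scaling factor is chosen so that the value becomes
    \<open>- (\<bar>C\<bar> + 1)\<close>, which lies below \<open>- C\<close>.\<close>
  have "- C \<le> l (scale (- (\<bar>C\<bar> + 1) / l w) w)" by (rule assms(2))
  also have "\<dots> = - (\<bar>C\<bar> + 1)" using assms(1) nz by (simp add: chom_def)
  finally show False by simp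
qed

lemma chom_coord: "0 \<le> t \<Longrightarrow> i < p \<Longrightarrow> (\<lambda>w. crd p t w ! i) \<in> chom p"
proof -
  assume t: "0 \<le> t" and i: "i < p"
  have "cyl p (\<lambda>w. crd p t w ! i)"
  proof (rule cylI[of "[t]" 1])
    fix w w'
    have "crd p t w ! i - crd p t w' ! i \<le> \<bar>crd p t w ! i - crd p t w' ! i\<bar>" by simp
    also have "\<dots> \<le> ld (crd p t w) (crd p t w')"
      using i member_le_sum[of i "{..<p}" "\<lambda>i. \<bar>crd p t w ! i - crd p t w' ! i\<bar>"]
      by (simp add: ld_eq_sum_nth[of _ p])
    finally show "crd p t w ! i - crd p t w' ! i \<le> 1 * ld (fdv (crd p) [t] w) (fdv (crd p) [t] w')"
      by (simp add: ld_fdv_single)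
  qed (use t in auto)
  then show ?thesis using i by (simp add: chom_def crd_scale)
qed

lemma csp_cyl: "f \<in> csp p \<Longrightarrow> cyl p f"
  by (auto simp: csp_def cbd_def chom_def cyl_add)

lemma cbd_csp: "f \<in> cbd p \<Longrightarrow> f \<in> csp p"
  using chom_zero by (force simp: csp_def)

lemma chom_csp: "f \<in> chom p \<Longrightarrow> f \<in> csp p"
  using cbd_const[of 0] by (force simp: csp_def)

lemma bpart_eq:
  assumes "b \<in> cbd p" "l \<in> chom p"
  shows "bpart p (\<lambda>w. b w + l w) = b"
  unfolding bpart_def
proof (rule some_equality)
  show "b \<in> cbd p \<and> (\<lambda>w. b w + l w - b w) \<in> chom p" using assms by simp
  fix b' assume b': "b' \<in> cbd p \<and> (\<lambda>w. b w + l w - b' w) \<in> chom p"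
  have "(\<lambda>w. (b w + l w - b' w) - l w) \<in> chom p" by (rule chom_diff[OF conjunct2[OF b'] assms(2)])
  then have hom: "(\<lambda>w. b w - b' w) \<in> chom p" by (simp add: algebra_simps)
  obtain C C' where C: "\<And>w. \<bar>b w\<bar> \<le> C" "\<And>w. \<bar>b' w\<bar> \<le> C'" using assms(1) b' by (auto simp: cbd_def)
  have "- (C + C') \<le> b w - b' w" for w using C(1)[of w] C(2)[of w] by linarith
  from chom_bounded_below[OF hom this] show "b' = b" by (simp add: fun_eq_iff)
qed

lemma bpart_cbd: "b \<in> cbd p \<Longrightarrow> bpart p b = b"
  using bpart_eq[OF _ chom_zero] by simp

lemma cspE:
  assumes "f \<in> csp p"
  obtains b l where "b \<in> cbd p" "l \<in> chom p" "f = (\<lambda>w. b w + l w)"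
  using assms by (auto simp: csp_def)

lemma cspI: "b \<in> cbd p \<Longrightarrow> l \<in> chom p \<Longrightarrow> (\<lambda>w. b w + l w) \<in> csp p"
  by (auto simp: csp_def)

lemma lin_space_csp: "lin_space (csp p)"
  unfolding lin_space_def
proof (intro conjI ballI allI impI)
  show "(\<lambda>_. 0) \<in> csp p" by (rule cbd_csp[OF cbd_const])
next
  fix f g assume f: "f \<in> csp p" and g: "g \<in> csp p"
  obtain b l where 1: "b \<in> cbd p" "l \<in> chom p" "f = (\<lambda>w. b w + l w)" using f by (rule cspE)
  obtain b' l' where 2: "b' \<in> cbd p" "l' \<in> chom p" "g = (\<lambda>w. b' w + l' w)" using g by (rule cspE)
  note * = 1(1,2) 2(1,2) 1(3) 2(3)
  have "(\<lambda>w. f w + g w) = (\<lambda>w. (b w + b' w) + (l w + l' w))" by (simp add: * algebra_simps)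
  then show "(\<lambda>w. f w + g w) \<in> csp p"
    using cspI[OF cbd_add[OF *(1,3)] chom_add[OF *(2,4)]] by simp
next
  fix f and c :: real assume "f \<in> csp p"
  then obtain b l where *: "b \<in> cbd p" "l \<in> chom p" "f = (\<lambda>w. b w + l w)" by (rule cspE)
  have "(\<lambda>w. c * f w) = (\<lambda>w. c * b w + c * l w)" by (simp add: * algebra_simps)
  then show "(\<lambda>w. c * f w) \<in> csp p"
    using cspI[OF cbd_cmult[OF *(1)] chom_cmult[OF *(2)]] by simp
next
  fix n Y \<phi> assume "rvec (csp p) n Y \<and> cblip n \<phi>"
  then have Y: "\<And>w. length (Y w) = n" "\<And>i. i < n \<Longrightarrow> (\<lambda>w. Y w ! i) \<in> csp p" and \<phi>: "cblip n \<phi>"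
    by (auto simp: rvec_def)
  obtain C L where *: "0 \<le> L" "\<And>x. length x = n \<Longrightarrow> \<bar>\<phi> x\<bar> \<le> C"
    "\<And>x y. length x = n \<Longrightarrow> length y = n \<Longrightarrow> \<bar>\<phi> x - \<phi> y\<bar> \<le> L * ld x y"
    using cblipE[OF \<phi>] by metis
  have "cyl p (\<lambda>w. \<phi> (Y w))"
    by (rule cyl_comp[where n = n and L = L]) (use Y csp_cyl * in auto)
  then show "(\<lambda>w. \<phi> (Y w)) \<in> csp p" using *(2) Y(1) by (intro cbd_csp) (auto simp: cbd_def)
qed

lemma cbdI:
  assumes "cblip n \<phi>" "\<And>w. length (Y w) = n" "\<And>t. t \<in> set ts \<Longrightarrow> 0 \<le> t"
    and "\<And>w w'. ld (Y w) (Y w') \<le> ld (fdv (crd p) ts w) (fdv (crd p) ts w')"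
  shows "(\<lambda>w. \<phi> (Y w)) \<in> cbd p"
proof -
  obtain C L where *: "0 \<le> L" "\<And>x. length x = n \<Longrightarrow> \<bar>\<phi> x\<bar> \<le> C"
    "\<And>x y. length x = n \<Longrightarrow> length y = n \<Longrightarrow> \<bar>\<phi> x - \<phi> y\<bar> \<le> L * ld x y"
    using cblipE[OF assms(1)] by metis
  have "cyl p (\<lambda>w. \<phi> (Y w))"
  proof (rule cylI[OF assms(3) *(1)])
    fix w w'
    have "\<phi> (Y w) - \<phi> (Y w') \<le> L * ld (Y w) (Y w')"
      using *(3)[OF assms(2,2), of w w'] by (simp add: abs_le_iff)
    also have "\<dots> \<le> L * ld (fdv (crd p) ts w) (fdv (crd p) ts w')" by (intro mult_left_mono assms *)
    finally show "\<phi> (Y w) - \<phi> (Y w') \<le> L * ld (fdv (crd p) ts w) (fdv (crd p) ts w')" .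
  qed
  then show ?thesis using *(2) assms(2) by (auto simp: cbd_def)
qed

lemma cbd_fdv: "cblip (length ts * p) \<phi> \<Longrightarrow> (\<And>t. t \<in> set ts \<Longrightarrow> 0 \<le> t) \<Longrightarrow> (\<lambda>w. \<phi> (fdv (crd p) ts w)) \<in> cbd p"
  by (rule cbdI[where ts = ts]) auto

lemma cbd_incr:
  assumes "cblip (length us * p + p) \<phi>" "\<And>t. t \<in> set us \<Longrightarrow> 0 \<le> t" "0 \<le> s" "0 \<le> t"
  shows "(\<lambda>w. \<phi> (fdv (crd p) us w @ vsub (crd p t w) (crd p s w))) \<in> cbd p"
proof (rule cbdI[OF assms(1), where ts = "us @ [t] @ [s]"])
  fix w w'
  have "ld (vsub (crd p t w) (crd p s w)) (vsub (crd p t w') (crd p s w'))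
      \<le> ld (crd p t w) (crd p t w') + ld (crd p s w) (crd p s w')"
    by (rule ld_vsub[of _ p]) auto
  then show "ld (fdv (crd p) us w @ vsub (crd p t w) (crd p s w)) (fdv (crd p) us w' @ vsub (crd p t w') (crd p s w'))
      \<le> ld (fdv (crd p) (us @ [t] @ [s]) w) (fdv (crd p) (us @ [t] @ [s]) w')"
    unfolding ld_fdv_append ld_fdv_single by simp
qed (use assms in auto)

text \<open>The step path built from a vector of increments. Evaluating path functions on it
  transports the chains of all levels to one path space.\<close>

definition gpath :: "nat \<Rightarrow> nat \<Rightarrow> real list \<Rightarrow> real \<Rightarrow> real list" where
  "gpath p n zs t = bsum p (pos n t) zs"

lemma crd_gpath: "pos n t * p \<le> length zs \<Longrightarrow> crd p t (gpath p n zs) = bsum p (pos n t) zs"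
  by (cases "t = 0") (auto simp: gpath_def crd_eq)

lemma fdv_gpath:
  "(\<And>t. t \<in> set ts \<Longrightarrow> pos n t * p \<le> length zs) \<Longrightarrow> fdv (crd p) ts (gpath p n zs) = sv p n ts zs"
  unfolding fdv_def sv_def by (intro arg_cong[where f = concat] map_cong refl crd_gpath) auto

text \<open>Holds only from some n on, once the grid reaches all times that \<open>f\<close>
  observes.\<close>

lemma cblip_gpath:
  assumes "f \<in> cbd p"
  shows "\<forall>\<^sub>F n in sequentially. cblip (num n * p) (\<lambda>zs. f (gpath p n zs))"
proof -
  obtain ts L C where ts: "\<And>t. t \<in> set ts \<Longrightarrow> 0 \<le> t" and L: "0 \<le> L"
    "\<And>w w'. \<bar>f w - f w'\<bar> \<le> L * ld (fdv (crd p) ts w) (fdv (crd p) ts w')" and C: "\<And>w. \<bar>f w\<bar> \<le> C"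
    using assms unfolding cbd_def cyl_def by blast
  have "\<forall>\<^sub>F n in sequentially. \<forall>t\<in>set ts. pos n t \<le> num n" by (rule eventually_pos_le_num) (rule ts)
  then show ?thesis
  proof eventually_elim
    case (elim n)
    have sc: "pos n t * p \<le> num n * p" if "t \<in> set ts" for t using elim that by simp
    show ?case
    proof (rule cblipI[OF C])
      fix x y :: "real list" assume xy: "length x = num n * p" "length y = num n * p"
      have "f (gpath p n x) - f (gpath p n y) \<le> L * ld (fdv (crd p) ts (gpath p n x)) (fdv (crd p) ts (gpath p n y))"
        using L(2)[of "gpath p n x" "gpath p n y"] by (simp add: abs_le_iff)
      also have "\<dots> = L * ld (sv p n ts x) (sv p n ts y)" using xy sc by (simp add: fdv_gpath)
      also have "\<dots> \<le> L * (real (length ts) * ld x y)"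
        using xy sc by (intro mult_left_mono ld_sv L(1)) auto
      finally show "f (gpath p n x) - f (gpath p n y) \<le> L * real (length ts) * ld x y" by (simp add: mult.assoc)
    qed
  qed
qed

section \<open>The limit expectation and its properties\<close>

locale coupled_limit = coupled H1 E1 Et1 H2 E2 Et2 d M N
  for H1 :: "('a \<Rightarrow> real) set" and E1 Et1 and H2 :: "('b \<Rightarrow> real) set" and E2 Et2 and d M N +
  fixes F :: "nat filter"
  assumes F_nontriv: "F \<noteq> bot" and F_le: "F \<le> sequentially"
    and F_conv: "\<And>(a :: nat \<Rightarrow> real) C. \<forall>\<^sub>F n in sequentially. \<bar>a n\<bar> \<le> C \<Longrightarrow> \<exists>l. (a \<longlongrightarrow> l) F"
begin

abbreviation P :: nat where "P \<equiv> d + d"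

definition En :: "nat \<Rightarrow> ((real \<Rightarrow> real list) \<Rightarrow> real) \<Rightarrow> real" where
  "En n f = jn n (\<lambda>zs. f (gpath P n zs))"

definition EB :: "((real \<Rightarrow> real list) \<Rightarrow> real) \<Rightarrow> real" where
  "EB f = Lim F (\<lambda>n. En n f)"

text \<open>The homogeneous part of a random variable can be ignored: it vanishes as soon as it is
  bounded below, so monotonicity is not affected, and distributions only involve bounded
  random variables.\<close>

definition EH :: "((real \<Rightarrow> real list) \<Rightarrow> real) \<Rightarrow> real" where
  "EH f = EB (bpart P f)"

lemma eventually_F: "eventually Q sequentially \<Longrightarrow> eventually Q F"
  using F_le by (simp add: le_filter_def)

lemma EB_tendsto:
  assumes "f \<in> cbd P" shows "((\<lambda>n. En n f) \<longlongrightarrow> EB f) F"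
proof -
  obtain C where C: "\<And>w. \<bar>f w\<bar> \<le> C" using assms by (auto simp: cbd_def)
  have "\<forall>\<^sub>F n in sequentially. \<bar>En n f\<bar> \<le> C"
    using cblip_gpath[OF assms] by eventually_elim (auto simp: En_def intro!: nexp_bound[OF nexp_jn] C)
  from F_conv[OF this] obtain l where "((\<lambda>n. En n f) \<longlongrightarrow> l) F" by blast
  then show ?thesis unfolding EB_def using tendsto_Lim[OF F_nontriv, of "\<lambda>n. En n f" l] by simp
qed

lemma EB_eqI:
  assumes "f \<in> cbd P" "((\<lambda>n. g n) \<longlongrightarrow> l) F" "\<forall>\<^sub>F n in sequentially. En n f = g n"
  shows "EB f = l"
proof -
  have "((\<lambda>n. g n) \<longlongrightarrow> EB f) F"
    by (rule Lim_transform_eventually[OF EB_tendsto[OF assms(1)] eventually_F[OF assms(3)]])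
  then show ?thesis using tendsto_unique[OF F_nontriv] assms(2) by blast
qed

lemma EB_le:
  assumes "f \<in> cbd P" "g \<in> cbd P" "\<And>w. f w \<le> g w + a"
  shows "EB f \<le> EB g + a"
proof (rule tendsto_le[OF F_nontriv tendsto_add[OF EB_tendsto[OF assms(2)] tendsto_const] EB_tendsto[OF assms(1)]])
  show "\<forall>\<^sub>F n in F. En n f \<le> En n g + a"
    using eventually_F[OF cblip_gpath[OF assms(1)]] eventually_F[OF cblip_gpath[OF assms(2)]]
    by eventually_elim (auto simp: En_def intro!: nexp_le[OF nexp_jn] assms(3))
qed

lemma EB_const: "EB (\<lambda>_. c) = c"
  by (rule EB_eqI[OF cbd_const tendsto_const]) (simp add: En_def nexp_const[OF nexp_jn])

lemma EH_cbd: "f \<in> cbd P \<Longrightarrow> EH f = EB f"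
  by (simp add: EH_def bpart_cbd)

lemma EH_eq: "b \<in> cbd P \<Longrightarrow> l \<in> chom P \<Longrightarrow> EH (\<lambda>w. b w + l w) = EB b"
  by (simp add: EH_def bpart_eq)

lemma nl_expectation_EH: "nl_expectation (csp P) EH"
  unfolding nl_expectation_def
proof (intro conjI ballI impI allI)
  fix c show "EH (\<lambda>_. c) = c" by (simp add: EH_cbd cbd_const EB_const)
next
  fix f g assume f: "f \<in> csp P" and g: "g \<in> csp P" and le: "\<forall>w. g w \<le> f w"
  obtain b l where 1: "b \<in> cbd P" "l \<in> chom P" "f = (\<lambda>w. b w + l w)" using f by (rule cspE)
  obtain b' l' where 2: "b' \<in> cbd P" "l' \<in> chom P" "g = (\<lambda>w. b' w + l' w)" using g by (rule cspE)
  note * = 1(1,2) 2(1,2) 1(3) 2(3)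
  obtain C C' where C: "\<And>w. \<bar>b w\<bar> \<le> C" "\<And>w. \<bar>b' w\<bar> \<le> C'" using *(1,3) by (auto simp: cbd_def)
  \<comment> \<open>The inequality between \<open>g\<close> and \<open>f\<close> bounds the
    homogeneous function \<open>l - l'\<close> below, so the homogeneous parts coincide and the
    bounded parts are ordered.\<close>
  have "- (C + C') \<le> l w - l' w" for w
    using C(1)[of w] C(2)[of w] le[rule_format, of w] unfolding *(5,6) by linarith
  from chom_bounded_below[OF chom_diff[OF *(2,4)] this]
  have "b' w \<le> b w + 0" for w using le[rule_format, of w] unfolding *(5,6) by (simp add: algebra_simps)
  from EB_le[OF *(3,1) this] show "EH g \<le> EH f" unfolding *(5,6) using * by (simp add: EH_eq)
qed

text \<open>Compositions of sublinear laws are sublinear, so each joint chain is, and the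
  inequalities survive the limit.\<close>

lemma sl_expectation_EH:
  assumes "sl_expectation H1 E1" "sl_expectation H2 E2"
  shows "sl_expectation (csp P) EH"
proof -
  have sl: "slaw (num n * P) (jn n)" for n
  proof -
    have "slaw P T" if T: "T \<in> set (jincl (stp n) 0 (num n))" for T
    proof -
      obtain i where i: "T = jinc (real i * stp n) (real (Suc i) * stp n)"
        using T by (auto simp: jincl_def simp del: of_nat_Suc)
      have "0 \<le> real i * stp n" "0 \<le> real (Suc i) * stp n" using stp_pos(2) by auto
      then show ?thesis
        unfolding i jinc_def using step_laws(3,4)[OF stp_pos(2)]
        by (intro slaw_comp_law M.slaw_inc N.slaw_inc assms) auto
    qed
    moreover have "nexp P T" if "T \<in> set (jincl (stp n) 0 (num n))" for T
      using that step_laws(5)[OF stp_pos(2)] by (auto simp: jincl_def simp del: of_nat_Suc)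
    ultimately show ?thesis using iter_slaw[of "jincl (stp n) 0 (num n)" P] by simp
  qed
  have add: "EB (\<lambda>w. f w + g w) \<le> EB f + EB g" if "f \<in> cbd P" "g \<in> cbd P" for f g
  proof (rule tendsto_le[OF F_nontriv tendsto_add[OF EB_tendsto[OF that(1)] EB_tendsto[OF that(2)]]
        EB_tendsto[OF cbd_add[OF that]]])
    show "\<forall>\<^sub>F n in F. En n (\<lambda>w. f w + g w) \<le> En n f + En n g"
      using eventually_F[OF cblip_gpath[OF that(1)]] eventually_F[OF cblip_gpath[OF that(2)]]
      by eventually_elim (use sl in \<open>auto simp: En_def slaw_def\<close>)
  qed
  have cmult: "EB (\<lambda>w. c * f w) = c * EB f" if "f \<in> cbd P" "0 \<le> c" for f c
  proof (rule EB_eqI[OF cbd_cmult[OF that(1)] tendsto_mult[OF tendsto_const EB_tendsto[OF that(1)]]])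
    show "\<forall>\<^sub>F n in sequentially. En n (\<lambda>w. c * f w) = c * En n f"
      using cblip_gpath[OF that(1)] by eventually_elim (use sl that(2) in \<open>auto simp: En_def slaw_def\<close>)
  qed
  show ?thesis
    unfolding sl_expectation_def
  proof (intro conjI ballI allI impI nl_expectation_EH)
    fix f g assume f: "f \<in> csp P" and g: "g \<in> csp P"
    obtain b l where 1: "b \<in> cbd P" "l \<in> chom P" "f = (\<lambda>w. b w + l w)" using f by (rule cspE)
    obtain b' l' where 2: "b' \<in> cbd P" "l' \<in> chom P" "g = (\<lambda>w. b' w + l' w)" using g by (rule cspE)
    note * = 1(1,2) 2(1,2) 1(3) 2(3)
    have "(\<lambda>w. f w + g w) = (\<lambda>w. (b w + b' w) + (l w + l' w))" by (simp add: * algebra_simps)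
    then have "EH (\<lambda>w. f w + g w) = EB (\<lambda>w. b w + b' w)"
      using EH_eq[OF cbd_add[OF *(1,3)] chom_add[OF *(2,4)]] by simp
    then show "EH (\<lambda>w. f w + g w) \<le> EH f + EH g" using add[OF *(1,3)] * by (simp add: EH_eq)
  next
    fix f and c :: real assume f: "f \<in> csp P" and c: "0 \<le> c"
    obtain b l where *: "b \<in> cbd P" "l \<in> chom P" "f = (\<lambda>w. b w + l w)" using f by (rule cspE)
    have "(\<lambda>w. c * f w) = (\<lambda>w. c * b w + c * l w)" by (simp add: * algebra_simps)
    then have "EH (\<lambda>w. c * f w) = EB (\<lambda>w. c * b w)"
      using EH_eq[OF cbd_cmult[OF *(1)] chom_cmult[OF *(2)]] by simp
    then show "EH (\<lambda>w. c * f w) = c * EH f" using cmult[OF *(1) c] * by (simp add: EH_eq)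
  qed
qed

lemma En_fdv:
  assumes "\<And>t. t \<in> set ts \<Longrightarrow> pos n t \<le> num n" "cblip (length ts * P) \<phi>"
  shows "En n (\<lambda>w. \<phi> (fdv (crd P) ts w)) = jn n (\<lambda>zs. \<phi> (sv P n ts zs))"
  unfolding En_def
proof (rule nexp_cong[OF nexp_jn, symmetric])
  show "cblip (num n * P) (\<lambda>zs. \<phi> (sv P n ts zs))" using assms by (intro cblip_sv) auto
  fix zs :: "real list" assume "length zs = num n * P"
  then show "\<phi> (sv P n ts zs) = \<phi> (fdv (crd P) ts (gpath P n zs))"
    using assms(1) by (subst fdv_gpath) (auto simp: mult_le_mono1)
qed

lemma En_incr:
  assumes "\<And>t. t \<in> set us \<Longrightarrow> t \<le> s" "s \<le> t'" "pos n t' \<le> num n" "cblip (length us * P + P) \<phi>"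
  shows "En n (\<lambda>w. \<phi> (fdv (crd P) us w @ vsub (crd P t' w) (crd P s w)))
    = jn n (\<lambda>zs. jlaw n s t' (\<lambda>y. \<phi> (sv P n us zs @ y)))"
  unfolding En_def
proof (rule trans[OF nexp_cong[OF nexp_jn, symmetric] jn_incr[OF assms]])
  have le: "pos n t \<le> num n" if "t \<in> set us \<or> t = s \<or> t = t'" for t
    using that assms(1-3) pos_mono[of t s n] pos_mono[of s t' n] by fastforce
  then show "cblip (num n * P) (\<lambda>zs. \<phi> (sv P n us zs @ vsub (bsum P (pos n t') zs) (bsum P (pos n s) zs)))"
    using assms(4) by (intro cblip_sv_incr) auto
  fix zs :: "real list" assume "length zs = num n * P"
  then have "pos n t * P \<le> length zs" if "t \<in> set us \<or> t = s \<or> t = t'" for t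
    using le[OF that] by (simp add: mult_le_mono1)
  then show "\<phi> (sv P n us zs @ vsub (bsum P (pos n t') zs) (bsum P (pos n s) zs))
      = \<phi> (fdv (crd P) us (gpath P n zs) @ vsub (crd P t' (gpath P n zs)) (crd P s (gpath P n zs)))"
    by (simp add: fdv_gpath crd_gpath)
qed

lemma eventually_pos1: "0 \<le> t \<Longrightarrow> \<forall>\<^sub>F n in sequentially. pos n t \<le> num n"
  using eventually_pos_le_num[of "[t]"] by simp

text \<open>The case of an empty past in \<open>En_incr\<close>: the chain then integrates a
  constant, which leaves \<open>jlaw\<close> itself.\<close>

lemma EB_incr1:
  assumes "0 \<le> s" "s \<le> t'" "cblip P \<theta>"
  shows "((\<lambda>n. jlaw n s t' \<theta>) \<longlongrightarrow> EB (\<lambda>w. \<theta> (vsub (crd P t' w) (crd P s w)))) F"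
proof -
  have mem: "(\<lambda>w. \<theta> (vsub (crd P t' w) (crd P s w))) \<in> cbd P"
    using cbd_incr[of "[]" P \<theta> s t'] assms by (simp add: fdv_def)
  have "\<forall>\<^sub>F n in F. En n (\<lambda>w. \<theta> (vsub (crd P t' w) (crd P s w))) = jlaw n s t' \<theta>"
  proof (rule eventually_F)
    have "0 \<le> t'" using assms by simp
    from eventually_pos1[OF this]
    show "\<forall>\<^sub>F n in sequentially. En n (\<lambda>w. \<theta> (vsub (crd P t' w) (crd P s w))) = jlaw n s t' \<theta>"
      by eventually_elim
        (use En_incr[of "[]" s t' _ \<theta>] assms nexp_const[OF nexp_jn] in \<open>simp add: fdv_def sv_def\<close>)
  qed
  from Lim_transform_eventually[OF EB_tendsto[OF mem] this] show ?thesis .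
qed

text \<open>The conditional expectations given the past at level \<open>n\<close> are uniformly bounded and uniformly
  Lipschitz, hence converge uniformly on bounded sets. Uniform tightness does the rest.\<close>

lemma indep_incr_EH: "indep_incr EH P (crd P)"
  unfolding indep_incr_def indep_def
proof (intro allI impI)
  fix ts :: "real list" and \<phi>
  assume "2 \<le> length ts \<and> sorted_wrt (<) ts \<and> 0 \<le> hd ts"
  then have ts: "2 \<le> length ts" "sorted_wrt (<) ts" "0 \<le> hd ts" by auto
  assume "cblip ((length ts - 1) * P + P) \<phi>"
  define us where "us = butlast ts"
  define t' where "t' = last ts"
  define s where "s = last us"
  have us: "us \<noteq> []" "ts = us @ [t']" "length us = length ts - 1"
    using ts(1) unfolding us_def t'_def by (cases ts rule: rev_cases; force)+
  have us': "us = butlast us @ [s]" using us(1) by (simp add: s_def)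
  have st: "s < t'" using ts(2) us by (auto simp: sorted_wrt_append s_def)
  have sus: "t \<le> s" if "t \<in> set us" for t
  proof -
    have "sorted_wrt (<) us" using ts(2) unfolding us(2) by (simp add: sorted_wrt_append)
    then have "sorted_wrt (<) (butlast us @ [s])" using us' by metis
    then have "\<forall>t\<in>set (butlast us). t < s" by (simp add: sorted_wrt_append)
    moreover have "set us = insert s (set (butlast us))" using arg_cong[OF us', of set] by simp
    ultimately show ?thesis using that by (auto simp: less_imp_le)
  qed
  have us0: "0 \<le> t" if "t \<in> set us" for t
  proof -
    have "hd ts \<le> t"
    proof (cases us)
      case (Cons u vs)
      then show ?thesis using ts(2) us(2) that by (auto simp: less_imp_le)
    qed (use us in simp)
    then show ?thesis using ts(3) by simp
  qed
  have s0: "0 \<le> s" and t0: "0 \<le> t'" using us0[of s] us(1) st by (auto simp: s_def)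
  have \<phi>: "cblip (length us * P + P) \<phi>" using \<open>cblip ((length ts - 1) * P + P) \<phi>\<close> us(3) by simp
  obtain C L where CL: "0 \<le> C" "0 \<le> L" "\<And>x. length x = length us * P + P \<Longrightarrow> \<bar>\<phi> x\<bar> \<le> C"
    "\<And>x y. length x = length us * P + P \<Longrightarrow> length y = length us * P + P \<Longrightarrow> \<bar>\<phi> x - \<phi> y\<bar> \<le> L * ld x y"
    using cblipE[OF \<phi>] by metis
  let ?k = "length us * P"
  let ?Y = "\<lambda>w. vsub (crd P t' w) (crd P s w)"
  \<comment> \<open>The conditional expectation given the past at level n, where independence is
    exact; \<open>\<psi>\<close> below is the one that independence in the limit asks for.\<close>
  define \<psi>n where "\<psi>n n u = jlaw n s t' (\<lambda>y. \<phi> (u @ y))" for n u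
  define \<psi> where "\<psi> u = EB (\<lambda>w. \<phi> (u @ ?Y w))" for u
  have \<psi>n_lim: "((\<lambda>n. \<psi>n n u) \<longlongrightarrow> \<psi> u) F" if "length u = ?k" for u
    unfolding \<psi>n_def \<psi>_def using EB_incr1[OF s0 _ cblip_section[OF \<phi> that]] st by simp
  have \<psi>n_lip: "\<bar>\<psi>n n u - \<psi>n n v\<bar> \<le> L * ld u v" if "length u = ?k" "length v = ?k" for n u v
    unfolding \<psi>n_def
  proof (rule nexp_abs_diff[OF nexp_jlaw cblip_section[OF \<phi> that(1)] cblip_section[OF \<phi> that(2)]])
    fix y :: "real list" assume "length y = P"
    then show "\<bar>\<phi> (u @ y) - \<phi> (v @ y)\<bar> \<le> L * ld u v" using CL(4)[of "u @ y" "v @ y"] that by simp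
  qed
  have \<psi>n_bd: "\<bar>\<psi>n n u\<bar> \<le> C" if "length u = ?k" for n u
    unfolding \<psi>n_def using that CL(3) by (intro nexp_bound[OF nexp_jlaw cblip_section[OF \<phi> that]]) auto
  have \<psi>_lip: "\<bar>\<psi> u - \<psi> v\<bar> \<le> L * ld u v" if "length u = ?k" "length v = ?k" for u v
    by (rule tendsto_upperbound[OF tendsto_rabs[OF tendsto_diff[OF \<psi>n_lim[OF that(1)] \<psi>n_lim[OF that(2)]]] _ F_nontriv])
      (use \<psi>n_lip[OF that] in auto)
  have \<psi>_bd: "\<bar>\<psi> u\<bar> \<le> C" if "length u = ?k" for u
    by (rule tendsto_upperbound[OF tendsto_rabs[OF \<psi>n_lim[OF that]] _ F_nontriv]) (use \<psi>n_bd[OF that] in auto)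
  have \<psi>n_cblip: "cblip ?k (\<psi>n n)" for n
    using \<psi>n_bd \<psi>n_lip by (intro cblipI[of _ _ C L]) (auto simp: abs_le_iff)
  have \<psi>_cblip: "cblip ?k \<psi>"
    using \<psi>_bd \<psi>_lip by (intro cblipI[of _ _ C L]) (auto simp: abs_le_iff)

  let ?f = "\<lambda>w. \<phi> (fdv (crd P) us w @ ?Y w)" and ?g = "\<lambda>w. \<psi> (fdv (crd P) us w)"
  have f: "?f \<in> cbd P" using \<phi> us0 s0 t0 by (intro cbd_incr) auto
  have g: "?g \<in> cbd P" using \<psi>_cblip us0 by (intro cbd_fdv) auto
  obtain K where K: "0 \<le> K" "\<forall>\<^sub>F n in sequentially. \<forall>\<phi> \<psi> a b. 0 \<le> b \<longrightarrow>
      cblip ?k \<phi> \<longrightarrow> cblip ?k \<psi> \<longrightarrow> (\<forall>x. length x = ?k \<longrightarrow> \<phi> x \<le> \<psi> x + a + b * l1 x) \<longrightarrow>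
      jn n (\<lambda>zs. \<phi> (sv P n us zs)) \<le> jn n (\<lambda>zs. \<psi> (sv P n us zs)) + a + b * K"
    using us0 by (rule jn_tight)
  have diff: "((\<lambda>n. En n ?f - En n ?g) \<longlongrightarrow> 0) F"
    unfolding tendsto_iff
  proof (intro allI impI)
    fix e0 :: real assume "0 < e0"
    define e where "e = e0 / 2"
    have e: "0 < e" "e < e0" using \<open>0 < e0\<close> by (auto simp: e_def)
    \<comment> \<open>Beyond radius \<open>2 * C / b\<close> the trivial bound \<open>2 * C\<close>
      on the difference of \<open>\<psi>n n\<close> and \<open>\<psi>\<close> is at most
      \<open>b * l1 x\<close>; tightness turns this into \<open>b * K\<close>, which takes half of
      \<open>e\<close>.\<close>
    define b where "b = e / (2 * (K + 1))"
    have b: "0 < b" "b * K \<le> e / 2" using e(1) K(1) by (auto simp: b_def field_simps)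
    \<comment> \<open>Moving to a net point costs \<open>L * r\<close> for each of the two
      functions, together at most \<open>e / 4\<close>; convergence at the net points takes another
      \<open>e / 4\<close>.\<close>
    define r where "r = e / (8 * (L + 1))"
    have r: "0 < r" "2 * L * r \<le> e / 4" using e(1) CL(2) by (auto simp: r_def field_simps)
    obtain Z where Z: "finite Z" "\<And>z. z \<in> Z \<Longrightarrow> length z = ?k"
      "\<And>x. length x = ?k \<Longrightarrow> l1 x \<le> 2 * C / b \<Longrightarrow> \<exists>z\<in>Z. ld x z \<le> r"
      using finite_net[OF r(1)] by metis
    have net: "\<forall>\<^sub>F n in F. \<forall>z\<in>Z. \<bar>\<psi>n n z - \<psi> z\<bar> < e / 4"
    proof (intro eventually_ball_finite Z(1) ballI)
      fix z assume "z \<in> Z"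
      then show "\<forall>\<^sub>F n in F. \<bar>\<psi>n n z - \<psi> z\<bar> < e / 4"
        using tendstoD[OF \<psi>n_lim[OF Z(2)], of z "e / 4"] e(1) by (simp add: dist_real_def)
    qed
    have num: "\<forall>\<^sub>F n in F. \<forall>t\<in>set us. pos n t \<le> num n"
      by (rule eventually_F[OF eventually_pos_le_num]) (rule us0)
    show "\<forall>\<^sub>F n in F. dist (En n ?f - En n ?g) 0 < e0"
      using net num eventually_F[OF eventually_pos1[OF t0]] eventually_F[OF K(2)]
    proof eventually_elim
      case (elim n)
      have near: "\<bar>\<psi>n n x - \<psi> x\<bar> \<le> e / 2 + b * l1 x" if x: "length x = ?k" for x
      proof (cases "l1 x \<le> 2 * C / b")
        case True
        then obtain z where z: "z \<in> Z" "ld x z \<le> r" using Z(3)[OF x] by blast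
        have "L * ld x z \<le> L * r" using z(2) CL(2) by (rule mult_left_mono)
        moreover have "\<bar>\<psi>n n z - \<psi> z\<bar> < e / 4" using elim(1) z(1) by blast
        moreover have "0 \<le> b * l1 x" using b(1) by simp
        ultimately show ?thesis
          using \<psi>n_lip[OF x Z(2)[OF z(1)], of n] \<psi>_lip[OF x Z(2)[OF z(1)]] r(2) by linarith
      next
        case False
        then have "2 * C \<le> b * l1 x" using b(1) by (simp add: field_simps)
        then show ?thesis using \<psi>n_bd[OF x, of n] \<psi>_bd[OF x] e(1) by linarith
      qed
      have "En n ?f = jn n (\<lambda>zs. \<psi>n n (sv P n us zs))"
        unfolding \<psi>n_def using sus st elim(3) \<phi> by (intro En_incr) auto
      moreover have "En n ?g = jn n (\<lambda>zs. \<psi> (sv P n us zs))"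
        using elim(2) \<psi>_cblip by (intro En_fdv) auto
      moreover have "jn n (\<lambda>zs. \<psi>n n (sv P n us zs)) \<le> jn n (\<lambda>zs. \<psi> (sv P n us zs)) + e / 2 + b * K"
        using elim(4)[rule_format, of b "\<psi>n n" \<psi> "e / 2"] near b(1) \<psi>n_cblip \<psi>_cblip
        by (force simp: abs_le_iff algebra_simps)
      moreover have "jn n (\<lambda>zs. \<psi> (sv P n us zs)) \<le> jn n (\<lambda>zs. \<psi>n n (sv P n us zs)) + e / 2 + b * K"
        using elim(4)[rule_format, of b \<psi> "\<psi>n n" "e / 2"] near b(1) \<psi>n_cblip \<psi>_cblip
        by (force simp: abs_le_iff algebra_simps)
      ultimately show ?case using b(2) e(2) by (simp add: dist_real_def)
    qed
  qed
  have "EB ?f - EB ?g = 0"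
    by (rule tendsto_unique[OF F_nontriv tendsto_diff[OF EB_tendsto[OF f] EB_tendsto[OF g]] diff])
  moreover have "EH (\<lambda>w'. \<phi> (fdv (crd P) us w @ ?Y w')) = \<psi> (fdv (crd P) us w)" for w
  proof -
    have "(\<lambda>w'. \<phi> (fdv (crd P) us w @ ?Y w')) \<in> cbd P"
      using cbd_incr[of "[]" P "\<lambda>y. \<phi> (fdv (crd P) us w @ y)" s t'] cblip_section[OF \<phi>, of "fdv (crd P) us w"] s0 t0
      by (simp add: fdv_def[of _ "[]"])
    then show ?thesis by (simp add: EH_cbd \<psi>_def)
  qed
  ultimately show "EH (\<lambda>w. \<phi> (fdv (crd P) (butlast ts) w @ vsub (crd P (last ts) w) (crd P (last (butlast ts)) w)))
      = EH (\<lambda>w. EH (\<lambda>w'. \<phi> (fdv (crd P) (butlast ts) w @ vsub (crd P (last ts) w') (crd P (last (butlast ts)) w'))))"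
    using EH_cbd[OF f] EH_cbd[OF g] by (simp flip: us_def t'_def s_def)
qed

lemma stat_incr_EH:
  assumes "stat_incr E1 d M" "stat_incr E2 d N"
  shows "stat_incr EH P (crd P)"
  unfolding stat_incr_def same_law_def
proof (intro allI impI)
  fix t s :: real and \<theta> assume ts: "0 \<le> t \<and> 0 \<le> s" and \<theta>: "cblip P \<theta>"
  \<comment> \<open>The value at time t is written as the increment from time 0, where the process
    vanishes, so that both sides are limits of \<open>jlaw\<close>.\<close>
  let ?f = "\<lambda>w. \<theta> (vsub (crd P (t + s) w) (crd P s w))" and ?g = "\<lambda>w. \<theta> (vsub (crd P t w) (crd P 0 w))"
  have mem: "(\<lambda>w. \<theta> (vsub (crd P t' w) (crd P s' w))) \<in> cbd P" if "0 \<le> s'" "0 \<le> t'" for s' t'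
    using cbd_incr[of "[]" P \<theta> s' t'] that \<theta> by (simp add: fdv_def)
  have "((\<lambda>n. jlaw n s (t + s) \<theta> - jlaw n 0 t \<theta>) \<longlongrightarrow> EB ?f - EB ?g) F"
    using ts \<theta> by (intro tendsto_diff EB_incr1) auto
  moreover have "((\<lambda>n. jlaw n s (t + s) \<theta> - jlaw n 0 t \<theta>) \<longlongrightarrow> 0) F"
    using jlaw_stat[OF assms _ _ \<theta>, of s t] ts F_le by (auto intro: tendsto_mono)
  ultimately have "EB ?f - EB ?g = 0" by (rule tendsto_unique[OF F_nontriv])
  then have "EH ?f = EH ?g" using EH_cbd[OF mem[of s "t + s"]] EH_cbd[OF mem[of 0 t]] ts by simp
  then show "EH ?f = EH (\<lambda>w. \<theta> (crd P t w))" by simp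
qed

text \<open>On functions of one marginal the joint chain equals the original process at rounded
  times. That sequence of values converges in the ordinary sense, so its limit along the filter is
  the same.\<close>

lemma EH_proj:
  assumes pr: "coord_proj pr P d" and ts: "\<And>t. t \<in> set ts \<Longrightarrow> 0 \<le> t" and \<phi>: "cblip (length ts * d) \<phi>"
    and eq: "\<And>n. (\<And>t. t \<in> set ts \<Longrightarrow> pos n t \<le> num n) \<Longrightarrow>
      jn n (\<lambda>zs. \<phi> (concat (map (\<lambda>t. pr (bsum P (pos n t) zs)) ts))) = g n"
    and lim: "g \<longlonglongrightarrow> l"
  shows "EH (\<lambda>w. \<phi> (fdv (\<lambda>t w. pr (crd P t w)) ts w)) = l"
proof -
  let ?X = "\<lambda>t w. pr (crd P t w)"
  have len: "length (?X t w) = d" for t w using pr by (simp add: coord_proj_def)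
  have mem: "(\<lambda>w. \<phi> (fdv ?X ts w)) \<in> cbd P"
  proof (rule cbdI[OF \<phi> _ ts])
    show "length (fdv ?X ts w) = length ts * d" for w by (induction ts) (auto simp: fdv_def len)
    show "ld (fdv ?X ts w) (fdv ?X ts w') \<le> ld (fdv (crd P) ts w) (fdv (crd P) ts w')" for w w'
      by (induction ts) (use pr len in \<open>auto simp: fdv_def coord_proj_def intro!: add_mono\<close>)
  qed
  have ev: "\<forall>\<^sub>F n in sequentially. \<forall>t\<in>set ts. pos n t \<le> num n"
    by (rule eventually_pos_le_num) (rule ts)
  have "EB (\<lambda>w. \<phi> (fdv ?X ts w)) = l"
  proof (rule EB_eqI[OF mem tendsto_mono[OF F_le lim]])
    show "\<forall>\<^sub>F n in sequentially. En n (\<lambda>w. \<phi> (fdv ?X ts w)) = g n"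
      using ev cblip_gpath[OF mem]
    proof eventually_elim
      case (elim n)
      have "En n (\<lambda>w. \<phi> (fdv ?X ts w)) = jn n (\<lambda>zs. \<phi> (concat (map (\<lambda>t. pr (bsum P (pos n t) zs)) ts)))"
        unfolding En_def
      proof (rule nexp_cong[OF nexp_jn elim(2)])
        fix zs :: "real list" assume "length zs = num n * P"
        then have "crd P t (gpath P n zs) = bsum P (pos n t) zs" if "t \<in> set ts" for t
          using elim(1) that by (intro crd_gpath) (simp add: mult_le_mono1)
        then show "\<phi> (fdv ?X ts (gpath P n zs)) = \<phi> (concat (map (\<lambda>t. pr (bsum P (pos n t) zs)) ts))"
          unfolding fdv_def by (intro arg_cong[where f = \<phi>] arg_cong[where f = concat] map_cong) auto
      qed
      also have "\<dots> = g n" using elim(1) by (intro eq) auto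
      finally show ?case .
    qed
  qed
  then show ?thesis using mem by (simp add: EH_cbd)
qed

lemma same_law_fst: "same_law_proc d EH (\<lambda>t w. take d (crd P t w)) E1 M"
  unfolding same_law_proc_def same_law_def
proof (intro allI impI)
  fix ts :: "real list" and \<phi> assume ts: "\<forall>t\<in>set ts. 0 \<le> t" and \<phi>: "cblip (length ts * d) \<phi>"
  have lim: "(\<lambda>n. E1 (\<lambda>w. \<phi> (fdv M (map (rnd n) ts) w))) \<longlonglongrightarrow> E1 (\<lambda>w. \<phi> (fdv M ts w))"
    using ts \<phi> by (intro M.fdv_tendsto rnd_tendsto) (auto simp: rnd_nonneg)
  show "EH (\<lambda>w. \<phi> (fdv (\<lambda>t w. take d (crd P t w)) ts w)) = E1 (\<lambda>w. \<phi> (fdv M ts w))"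
    by (rule EH_proj[OF coord_proj_take _ \<phi> jn_fst lim]) (use ts \<phi> in auto)
qed

lemma same_law_snd: "same_law_proc d EH (\<lambda>t w. drop d (crd P t w)) E2 N"
  unfolding same_law_proc_def same_law_def
proof (intro allI impI)
  fix ts :: "real list" and \<phi> assume ts: "\<forall>t\<in>set ts. 0 \<le> t" and \<phi>: "cblip (length ts * d) \<phi>"
  have lim: "(\<lambda>n. E2 (\<lambda>w. \<phi> (fdv N (map (rnd n) ts) w))) \<longlonglongrightarrow> E2 (\<lambda>w. \<phi> (fdv N ts w))"
    using ts \<phi> by (intro N.fdv_tendsto rnd_tendsto) (auto simp: rnd_nonneg)
  show "EH (\<lambda>w. \<phi> (fdv (\<lambda>t w. drop d (crd P t w)) ts w)) = E2 (\<lambda>w. \<phi> (fdv N ts w))"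
    by (rule EH_proj[OF coord_proj_drop _ \<phi> jn_snd lim]) (use ts \<phi> in auto)
qed

lemma process_fst: "process (csp P) d (\<lambda>t w. take d (crd P t w))"
  by (auto simp: process_def rvec_def intro!: chom_csp chom_coord)

lemma process_snd: "process (csp P) d (\<lambda>t w. drop d (crd P t w))"
  by (auto simp: process_def rvec_def intro!: chom_csp chom_coord)

end

section \<open>Assembling the coupled process\<close>

lemma sl_expectation_nonneg:
  assumes "sl_expectation H E" "(\<lambda>_. 0) \<in> H" "f \<in> H" "\<And>w. 0 \<le> f w"
  shows "0 \<le> E f"
proof -
  have "\<forall>X\<in>H. \<forall>Y\<in>H. (\<forall>w. Y w \<le> X w) \<longrightarrow> E Y \<le> E X"
    using assms(1) by (simp add: sl_expectation_def nl_expectation_def)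
  from this[rule_format, OF assms(3,2,4)] have "E (\<lambda>_. 0) \<le> E f" .
  then show ?thesis using assms(1) by (simp add: sl_expectation_def nl_expectation_def)
qed

theorem theorem3p1:
  fixes H1 :: "('a \<Rightarrow> real) set" and E1 Et1 :: "('a \<Rightarrow> real) \<Rightarrow> real"
    and H2 :: "('b \<Rightarrow> real) set" and E2 Et2 :: "('b \<Rightarrow> real) \<Rightarrow> real"
    and M :: "real \<Rightarrow> 'a \<Rightarrow> real list" and N :: "real \<Rightarrow> 'b \<Rightarrow> real list"
    and d :: nat
  assumes sp1: "nl_space H1 E1" and sp2: "nl_space H2 E2"
    and M_proc: "process H1 d M" and M_ind: "indep_incr E1 d M"
    and N_proc: "process H2 d N" and N_ind: "indep_incr E2 d N"
    and A1: "sl_expectation H1 Et1" "dominates H1 Et1 E1"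
            "sl_expectation H2 Et2" "dominates H2 Et2 E2"
    and A2_mem: "\<forall>s\<ge>0. \<forall>t\<ge>0. (\<lambda>\<omega>. lnorm (vsub (M s \<omega>) (M t \<omega>))) \<in> H1 \<and>
                                (\<lambda>\<omega>. lnorm (vsub (N s \<omega>) (N t \<omega>))) \<in> H2"
    and A2: "\<forall>t\<ge>0. ((\<lambda>s. Et1 (\<lambda>\<omega>. lnorm (vsub (M s \<omega>) (M t \<omega>)))
                        + Et2 (\<lambda>\<omega>. lnorm (vsub (N s \<omega>) (N t \<omega>)))) \<longlongrightarrow> 0)
                   (at t within {0..})"
  shows "\<exists>(H :: ((real \<Rightarrow> real list) \<Rightarrow> real) set) E Mt Nt.
           nl_space H E \<and>
           (sl_space H1 E1 \<and> sl_space H2 E2 \<longrightarrow> sl_space H E) \<and>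
           process H d Mt \<and> process H d Nt \<and>
           indep_incr E (2 * d) (\<lambda>t \<omega>. Mt t \<omega> @ Nt t \<omega>) \<and>
           same_law_proc d E Mt E1 M \<and> same_law_proc d E Nt E2 N \<and>
           (stat_incr E1 d M \<and> stat_incr E2 d N \<longrightarrow>
              stat_incr E (2 * d) (\<lambda>t \<omega>. Mt t \<omega> @ Nt t \<omega>))"
proof -
  let ?m = "\<lambda>s t \<omega>. lnorm (vsub (M s \<omega>) (M t \<omega>))" and ?n = "\<lambda>s t \<omega>. lnorm (vsub (N s \<omega>) (N t \<omega>))"
  have zero: "(\<lambda>_. 0) \<in> H1" "(\<lambda>_. 0) \<in> H2"
    using sp1 sp2 by (auto simp: nl_space_def lin_space_def)
  have m0: "0 \<le> Et1 (?m s t)" "0 \<le> Et2 (?n s t)" if "0 \<le> s" "0 \<le> t" for s t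
  proof -
    have mem: "?m s t \<in> H1" "?n s t \<in> H2" using A2_mem that by blast+
    show "0 \<le> Et1 (?m s t)" by (rule sl_expectation_nonneg[OF A1(1) zero(1) mem(1) lnorm_nonneg])
    show "0 \<le> Et2 (?n s t)" by (rule sl_expectation_nonneg[OF A1(3) zero(2) mem(2) lnorm_nonneg])
  qed
  have "((\<lambda>s. Et1 (?m s t)) \<longlongrightarrow> 0) (at t within {0..}) \<and> ((\<lambda>s. Et2 (?n s t)) \<longlongrightarrow> 0) (at t within {0..})"
    if t: "0 \<le> t" for t
  proof -
    \<comment> \<open>Each summand is squeezed between 0 and the sum; nonnegativity is known for
      \<open>s \<ge> 0\<close>, which this filter supplies.\<close>
    have ev: "\<forall>\<^sub>F s in at t within {0..}. 0 \<le> s" by (simp add: eventually_at_filter)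
    have lim: "((\<lambda>s. Et1 (?m s t) + Et2 (?n s t)) \<longlongrightarrow> 0) (at t within {0..})" using A2 t by blast
    have "\<forall>\<^sub>F s in at t within {0..}. norm (Et1 (?m s t)) \<le> Et1 (?m s t) + Et2 (?n s t)"
      "\<forall>\<^sub>F s in at t within {0..}. norm (Et2 (?n s t)) \<le> Et1 (?m s t) + Et2 (?n s t)"
      using ev by (eventually_elim; use m0 t in force)+
    then show ?thesis using lim by (auto intro: Lim_null_comparison)
  qed
  then interpret coupled H1 E1 Et1 H2 E2 Et2 d M N
    using assms by unfold_locales (auto simp: nl_space_def)
  obtain F :: "nat filter" where "F \<noteq> bot" "F \<le> sequentially"
    "\<And>(a :: nat \<Rightarrow> real) C. \<forall>\<^sub>F n in sequentially. \<bar>a n\<bar> \<le> C \<Longrightarrow> \<exists>l. (a \<longlongrightarrow> l) F"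
    using ex_limit_filter by blast
  then interpret coupled_limit H1 E1 Et1 H2 E2 Et2 d M N F by unfold_locales
  \<comment> \<open>The two components are the halves of the coordinate process with blocks of
    length \<open>d + d\<close>; joining them gives it back.\<close>
  have pair: "(\<lambda>t \<omega>. take d (crd P t \<omega>) @ drop d (crd P t \<omega>)) = crd P" by simp
  show ?thesis
  proof (intro exI conjI impI)
    show "nl_space (csp P) EH" using lin_space_csp nl_expectation_EH by (simp add: nl_space_def)
    show "sl_space (csp P) EH" if "sl_space H1 E1 \<and> sl_space H2 E2"
      using that lin_space_csp sl_expectation_EH by (simp add: sl_space_def)
    show "process (csp P) d (\<lambda>t \<omega>. take d (crd P t \<omega>))" by (rule process_fst)
    show "process (csp P) d (\<lambda>t \<omega>. drop d (crd P t \<omega>))" by (rule process_snd)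
    show "indep_incr EH (2 * d) (\<lambda>t \<omega>. take d (crd P t \<omega>) @ drop d (crd P t \<omega>))"
      unfolding mult_2 pair by (rule indep_incr_EH)
    show "same_law_proc d EH (\<lambda>t \<omega>. take d (crd P t \<omega>)) E1 M" by (rule same_law_fst)
    show "same_law_proc d EH (\<lambda>t \<omega>. drop d (crd P t \<omega>)) E2 N" by (rule same_law_snd)
    show "stat_incr EH (2 * d) (\<lambda>t \<omega>. take d (crd P t \<omega>) @ drop d (crd P t \<omega>))"
      if "stat_incr E1 d M \<and> stat_incr E2 d N"
      using that unfolding mult_2 pair by (intro stat_incr_EH) auto
  qed
qed

end
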